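(* Fix $\sigma\in\{321,132,213\}$ and a real number $q>0$. For each $n\ge1$ let $\Pi_n$ be a random involution of $\{1,\dots,n\}$ avoiding $\sigma$, distributed according to $\mathbb{P}^{q,\sigma}_n$. Then, as $n\to\infty$, the following hold. (1) If $0<q<1$, then $$\mathrm{fp}(\Pi_{2n})\to_d N_{even}\quad\text{and}\quad \mathrm{fp}(\Pi_{2n+1})\to_d N_{odd},$$ where $N$ has the Negative Binomial distribution with parameters $p=1-q$ and $r=2$, that is, $\mathbb{P}(N=j)=(j+1)q^j(1-q)^2$ for $j\in\{0,1,2,\dots\}$. (2) If $q=1$, then $$\sqrt{\frac1n}\,\mathrm{fp}(\Pi_n)\to_d\frac{1}{\sqrt2}X_2,$$ where $X_2=\Lambda_1-\Lambda_2$ and $\Lambda_1\ge\Lambda_2$ are the eigenvalues of a random matrix drawn from the $2\times2$ Gaussian Orthogonal Ensemble conditioned to have trace $0$. In fact, $X_2/\sqrt2$ has a Rayleigh$(1)$ distribution. (3) If $q>1$, then $$\frac{\mathrm{fp}(\Pi_n)-\frac{q^2-1}{q^2+1}n}{\frac{2q}{q^2+1}\sqrt n}\to_d Z,$$ where $Z$ has a standard normal distribution.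
   Context: Let $[n]=\{1,\dots,n\}$. A permutation $\pi$ of $[n]$ contains a permutation $\sigma$ of $[m]$ if there exist indices $i_1<\dots<i_m$ in $[n]$ such that for all $j<l$ in $[m]$, $\pi(i_j)<\pi(i_l)$ if and only if $\sigma(j)<\sigma(l)$; $\pi$ avoids $\sigma$ if it does not contain $\sigma$. Permutations such as $321$ are written in one-line notation. Let $I_n(\sigma)$ be the set of involutions of $[n]$ (permutations $\pi$ with $\pi\circ\pi=\mathrm{id}$) that avoid $\sigma$. For a permutation $\pi$, $\mathrm{fp}(\pi)$ is its number of fixed points. For $q\in(0,\infty)$, $\mathbb{P}^{q,\sigma}_n$ is the probability measure on $I_n(\sigma)$ with $\mathbb{P}^{q,\sigma}_n(\pi)\propto q^{\mathrm{fp}(\pi)}$, i.e. $\mathbb{P}^{q,\sigma}_n(\pi)=q^{\mathrm{fp}(\pi)}/\sum_{\tau\in I_n(\sigma)}q^{\mathrm{fp}(\tau)}$. For a $\mathbb{Z}$-valued random variable $X$, $X_{even}$ denotes a random variable distributed like $X$ conditioned to be even, and $X_{odd}$ one distributed like $X$ conditioned to be odd. The $2\times2$ Gaussian Orthogonal Ensemble is normalized to have density proportional to $\exp(-\tfrac12\mathrm{tr}(A^2))$ on real symmetric $2\times2$ matrices $A$ (independent centered Gaussian entries on and above the diagonal, with variance $1$ on the diagonal and $1/2$ off the diagonal). Conditioned to have trace $0$, it is the probability measure on the space of trace-zero real symmetric $2\times 2$ matrices with density proportional to $\exp(-\tfrac12\mathrm{tr}(A^2))$ with respect to Lebesgue measure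 on that space; equivalently, it is the law of $A-\frac{\mathrm{tr}(A)}{2}I$ for $A$ drawn from the ensemble. The Rayleigh$(1)$ distribution has density $x e^{-x^2/2}$ on $[0,\infty)$. The symbol $\to_d$ denotes convergence in distribution. *)

theory Defs
  imports "HOL-Probability.Probability" "HOL-Combinatorics.Permutations"
begin

text \<open>
  A permutation of \<open>{1..n}\<close> is a function that \<open>permutes {1..n}\<close>, hence is the identity outside
  \<open>{1..n}\<close>.
\<close>

definition one_line :: "nat list \<Rightarrow> nat \<Rightarrow> nat" where
  "one_line xs = (\<lambda>i. if i \<in> {1..length xs} then xs ! (i - 1) else i)"

definition contains_pattern :: "nat \<Rightarrow> (nat \<Rightarrow> nat) \<Rightarrow> nat \<Rightarrow> (nat \<Rightarrow> nat) \<Rightarrow> bool" where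
  "contains_pattern n \<pi> m \<sigma> \<longleftrightarrow>
     (\<exists>i. i ` {1..m} \<subseteq> {1..n} \<and> strict_mono_on {1..m} i \<and>
        (\<forall>j\<in>{1..m}. \<forall>l\<in>{1..m}. j < l \<longrightarrow> (\<pi> (i j) < \<pi> (i l) \<longleftrightarrow> \<sigma> j < \<sigma> l)))"

definition avoiding_involutions :: "nat \<Rightarrow> nat \<Rightarrow> (nat \<Rightarrow> nat) \<Rightarrow> (nat \<Rightarrow> nat) set" where
  "avoiding_involutions n m \<sigma> =
     {\<pi>. \<pi> permutes {1..n} \<and> \<pi> \<circ> \<pi> = id \<and> \<not> contains_pattern n \<pi> m \<sigma>}"

definition fp :: "nat \<Rightarrow> (nat \<Rightarrow> nat) \<Rightarrow> nat" where
  "fp n \<pi> = card {i \<in> {1..n}. \<pi> i = i}"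

definition involution_pmf :: "real \<Rightarrow> nat \<Rightarrow> nat \<Rightarrow> (nat \<Rightarrow> nat) \<Rightarrow> (nat \<Rightarrow> nat) pmf" where
  "involution_pmf q n m \<sigma> =
     embed_pmf (\<lambda>\<pi>. if \<pi> \<in> avoiding_involutions n m \<sigma>
       then q ^ fp n \<pi> / (\<Sum>\<tau>\<in>avoiding_involutions n m \<sigma>. q ^ fp n \<tau>) else 0)"

lemma finite_avoiding_involutions: "finite (avoiding_involutions n m \<sigma>)"
  unfolding avoiding_involutions_def
  by (rule finite_subset[OF _ finite_permutations[of "{1..n}"]]) auto

lemma pmf_involution_pmf:
  assumes "q > 0" "avoiding_involutions n m \<sigma> \<noteq> {}"
  shows "pmf (involution_pmf q n m \<sigma>) \<pi> =
    (if \<pi> \<in> avoiding_involutions n m \<sigma>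
     then q ^ fp n \<pi> / (\<Sum>\<tau>\<in>avoiding_involutions n m \<sigma>. q ^ fp n \<tau>) else 0)"
proof -
  let ?A = "avoiding_involutions n m \<sigma>"
  let ?Z = "\<Sum>\<tau>\<in>?A. q ^ fp n \<tau>"
  have fin: "finite ?A" by (rule finite_avoiding_involutions)
  have Z: "?Z > 0" using fin assms by (intro sum_pos) auto
  have "(\<integral>\<^sup>+\<pi>. ennreal (if \<pi> \<in> ?A then q ^ fp n \<pi> / ?Z else 0) \<partial>count_space UNIV)
      = (\<Sum>\<pi>\<in>?A. ennreal (q ^ fp n \<pi> / ?Z))"
    by (subst nn_integral_count_space'[OF fin]) (auto intro!: sum.cong)
  also have "\<dots> = ennreal (\<Sum>\<pi>\<in>?A. q ^ fp n \<pi> / ?Z)"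
    using Z assms by (intro sum_ennreal) auto
  also have "\<dots> = 1" using Z by (simp flip: sum_divide_distrib)
  finally show ?thesis
    unfolding involution_pmf_def using Z assms by (subst pmf_embed_pmf) auto
qed

lemma avoiding_involutions_nonempty:
  assumes "\<sigma> \<in> {one_line [3,2,1], one_line [1,3,2], one_line [2,1,3]}"
  shows "id \<in> avoiding_involutions n 3 \<sigma>"
proof -
  have "\<not> contains_pattern n id 3 \<sigma>"
  proof
    assume "contains_pattern n id 3 \<sigma>"
    then obtain i :: "nat \<Rightarrow> nat" where i: "strict_mono_on {1..3} i"
      "\<forall>j\<in>{1..3}. \<forall>l\<in>{1..3}. j < l \<longrightarrow> (i j < i l \<longleftrightarrow> \<sigma> j < \<sigma> l)"
      unfolding contains_pattern_def id_apply by blast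
    have inc: "\<sigma> j < \<sigma> l" if "j \<in> {1..3}" "l \<in> {1..3}" "j < l" for j l
      using i that strict_mono_onD[OF i(1)] by blast
    show False
      using inc[of 1 2] inc[of 2 3] assms by (auto simp: one_line_def)
  qed
  then show ?thesis
    by (simp add: avoiding_involutions_def permutes_id)
qed

lemma pmf_neg_binomial_2:
  assumes "0 < q" "q < 1"
  shows "pmf (neg_binomial_pmf 2 (1 - q)) j = (real j + 1) * q ^ j * (1 - q) ^ 2"
proof -
  have "pmf (neg_binomial_pmf 2 (1 - q)) j = real (Suc j choose j) * (1 - q) ^ 2 * q ^ j"
    using assms by (simp add: pmf_neg_binomial)
  also have "Suc j choose j = Suc j" by (simp add: binomial_Suc_n)
  finally show ?thesis by (simp add: mult.commute mult.left_commute)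
qed

definition eigenvalues :: "real^'n^'n \<Rightarrow> real set" where
  "eigenvalues A = {c. \<exists>v. v \<noteq> 0 \<and> A *v v = c *\<^sub>R v}"

text \<open>
  A real symmetric \<open>2 \<times> 2\<close> matrix has two real eigenvalues, counted with multiplicity; the larger
  one is the maximum and the smaller one the minimum of the set of eigenvalues.
\<close>

definition eigenvalue_gap :: "real^2^2 \<Rightarrow> real" where
  "eigenvalue_gap A = Max (eigenvalues A) - Min (eigenvalues A)"

definition traceless_symmetric :: "real \<times> real \<Rightarrow> real^2^2" where
  "traceless_symmetric = (\<lambda>(a, b). vector [vector [a, b], vector [b, - a]])"

text \<open>
  Lebesgue measure on the two-dimensional space of trace-zero real symmetric matrices, carried by
  the ambient matrix space. It is determined only up to a constant factor, which cancels in the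
  normalised density below.
\<close>

definition traceless_lborel :: "(real^2^2) measure" where
  "traceless_lborel = distr lborel borel traceless_symmetric"

definition traceless_GOE2 :: "(real^2^2) measure" where
  "traceless_GOE2 = density traceless_lborel (\<lambda>A.
     ennreal (exp (- trace (A ** A) / 2) / (LINT B|traceless_lborel. exp (- trace (B ** B) / 2))))"

definition rayleigh_density :: "real \<Rightarrow> real" where
  "rayleigh_density x = (if x < 0 then 0 else x * exp (- x\<^sup>2 / 2))"

lemma range_traceless_symmetric:
  "range traceless_symmetric = {A. transpose A = A \<and> trace A = 0}"
proof (intro set_eqI iffI)
  fix A :: "real^2^2" assume "A \<in> {A. transpose A = A \<and> trace A = 0}"
  then have "transpose A $ 1 $ 2 = A $ 1 $ 2" "A $ 1 $ 1 + A $ 2 $ 2 = 0"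
    by (simp_all add: trace_def sum_2)
  then have "A $ 2 $ 1 = A $ 1 $ 2" "A $ 2 $ 2 = - A $ 1 $ 1"
    by (simp_all add: transpose_def add_eq_0_iff)
  then have "A = traceless_symmetric (A $ 1 $ 1, A $ 1 $ 2)"
    by (simp add: traceless_symmetric_def vec_eq_iff forall_2)
  then show "A \<in> range traceless_symmetric" by (rule range_eqI)
qed (auto simp: traceless_symmetric_def transpose_def trace_def vec_eq_iff forall_2 sum_2)

lemma trace_traceless_symmetric:
  "trace (traceless_symmetric (a, b) ** traceless_symmetric (a, b)) = 2 * (a\<^sup>2 + b\<^sup>2)"
  by (simp add: traceless_symmetric_def trace_def matrix_matrix_mult_def sum_2 power2_eq_square)

lemma measurable_traceless_symmetric [measurable]:
  "traceless_symmetric \<in> borel_measurable borel"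
proof -
  have "traceless_symmetric x =
      fst x *\<^sub>R vector [vector [1, 0], vector [0, - 1]] + snd x *\<^sub>R vector [vector [0, 1], vector [1, 0]]" for x
    by (cases x) (simp add: traceless_symmetric_def vec_eq_iff forall_2)
  then show ?thesis
    by (subst measurable_cong) (auto intro!: borel_measurable_continuous_onI continuous_intros)
qed

lemma eigenvalues_traceless_symmetric:
  "eigenvalues (traceless_symmetric (a, b)) = {sqrt (a\<^sup>2 + b\<^sup>2), - sqrt (a\<^sup>2 + b\<^sup>2)}"
proof -
  have "c \<in> eigenvalues (traceless_symmetric (a, b)) \<longleftrightarrow> c\<^sup>2 = a\<^sup>2 + b\<^sup>2" for c
  proof -
    have "c \<in> eigenvalues (traceless_symmetric (a, b)) \<longleftrightarrow>
        (\<exists>v. v \<noteq> 0 \<and> (traceless_symmetric (a, b) - mat c) *v v = 0)"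
      by (simp add: eigenvalues_def vec_eq_iff forall_2 matrix_vector_mult_def mat_def sum_2
          left_diff_distrib diff_add_eq add_diff_eq)
    also have "\<dots> \<longleftrightarrow> \<not> invertible (traceless_symmetric (a, b) - mat c)"
      by (metis invertible_left_inverse matrix_left_invertible_ker)
    also have "\<dots> \<longleftrightarrow> det (traceless_symmetric (a, b) - mat c) = 0"
      by (simp add: invertible_det_nz)
    also have "\<dots> \<longleftrightarrow> c\<^sup>2 = a\<^sup>2 + b\<^sup>2"
      by (simp add: det_2 traceless_symmetric_def mat_def) (auto simp: power2_eq_square algebra_simps)
    finally show ?thesis .
  qed
  moreover have "c\<^sup>2 = a\<^sup>2 + b\<^sup>2 \<longleftrightarrow> c = sqrt (a\<^sup>2 + b\<^sup>2) \<or> c = - sqrt (a\<^sup>2 + b\<^sup>2)" for c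
    by (metis real_sqrt_abs abs_if minus_minus power2_minus real_sqrt_pow2 sum_power2_ge_zero)
  ultimately show ?thesis by blast
qed

lemma eigenvalue_gap_traceless_symmetric:
  "eigenvalue_gap (traceless_symmetric (a, b)) = 2 * sqrt (a\<^sup>2 + b\<^sup>2)"
proof -
  have "- sqrt (a\<^sup>2 + b\<^sup>2) \<le> sqrt (a\<^sup>2 + b\<^sup>2)"
    using real_sqrt_ge_zero[OF sum_power2_ge_zero[of a b]] by linarith
  then show ?thesis
    by (simp add: eigenvalue_gap_def eigenvalues_traceless_symmetric max_absorb1 min_absorb2)
qed

lemma measurable_trace_square [measurable]:
  "(\<lambda>A::real^2^2. trace (A ** A)) \<in> borel_measurable borel"
  unfolding trace_def matrix_matrix_mult_def
  by (intro borel_measurable_continuous_onI continuous_intros)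

lemma nn_integral_traceless_lborel:
  "(\<integral>\<^sup>+A. ennreal (exp (- trace (A ** A) / 2)) \<partial>traceless_lborel) = ennreal pi"
proof -
  have "(\<integral>\<^sup>+x. ennreal (exp (- x\<^sup>2)) \<partial>lborel) =
      (\<integral>\<^sup>+x. ennreal (sqrt pi) * ennreal (normal_density 0 (1 / sqrt 2) x) \<partial>lborel)"
    by (intro nn_integral_cong)
      (simp add: normal_density_def power_divide real_sqrt_divide flip: ennreal_mult')
  also have "\<dots> = ennreal (sqrt pi)"
    by (simp add: nn_integral_cmult nn_integral_eq_integral integral_normal_density)
  finally have gauss: "(\<integral>\<^sup>+x. ennreal (exp (- x\<^sup>2)) \<partial>lborel) = ennreal (sqrt pi)" .
  have "(\<integral>\<^sup>+A. ennreal (exp (- trace (A ** A) / 2)) \<partial>traceless_lborel) =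
      (\<integral>\<^sup>+(a, b). ennreal (exp (- a\<^sup>2)) * ennreal (exp (- b\<^sup>2)) \<partial>(lborel \<Otimes>\<^sub>M lborel))"
    unfolding traceless_lborel_def
    by (subst nn_integral_distr)
      (auto simp: trace_traceless_symmetric lborel_prod add_divide_distrib mult_exp_exp
        simp flip: ennreal_mult' intro!: nn_integral_cong)
  also have "\<dots> = ennreal (sqrt pi) * ennreal (sqrt pi)"
    by (subst lborel.nn_integral_fst[symmetric])
      (simp_all add: nn_integral_cmult nn_integral_multc gauss split_beta')
  also have "\<dots> = ennreal pi"
    by (simp flip: ennreal_mult')
  finally show ?thesis .
qed

lemma prob_space_traceless_GOE2: "prob_space traceless_GOE2"
proof -
  have meas [measurable]:
    "(\<lambda>A. exp (- trace (A ** A) / 2)) \<in> borel_measurable traceless_lborel"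
    by (simp add: traceless_lborel_def)
  have "(LINT B|traceless_lborel. exp (- trace (B ** B) / 2)) = pi"
    by (rule integral_eq_nn_integral[OF meas, THEN trans])
      (simp, simp only: nn_integral_traceless_lborel enn2real_ennreal pi_ge_zero)
  then have "emeasure traceless_GOE2 (space traceless_GOE2) =
      (\<integral>\<^sup>+A. ennreal (exp (- trace (A ** A) / 2)) / ennreal pi \<partial>traceless_lborel)"
    unfolding traceless_GOE2_def space_density
    by (subst emeasure_density) (measurable, auto simp: divide_ennreal intro!: nn_integral_cong)
  also have "\<dots> = 1"
    by (subst nn_integral_divide) (measurable, simp only: nn_integral_traceless_lborel, simp add: divide_ennreal)
  finally show ?thesis by (rule prob_spaceI)
qed

end

theory Submission
  imports Defs "HOL-Real_Asymp.Real_Asymp"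
begin

text \<open>
  The three limits rest on one exact count. For each of the three patterns, the avoiding
  involutions of \<open>{1..n}\<close> with \<open>n - 2 * j\<close> fixed points, that is, with \<open>j\<close> two-cycles, are
  counted by the ballot number \<open>(n choose j) - (n choose (j - 1))\<close>. This is the number of walks
  with \<open>n\<close> steps \<open>1\<close> or \<open>-1\<close> that start at \<open>0\<close>, never become negative and end at \<open>n - 2 * j\<close>;
  the difference is what the reflection principle gives for such walks.

  To see the count, draw an involution as a set of arcs (its two-cycles) and isolated points.
  Avoiding 321 means that no arc covers a fixed point or another arc. If such a diagram is read from
  left to right, then the only choice at each point is between opening an arc, closing the one
  that has been open longest, and, when no arc is open, placing a fixed point
  (\<open>card_open_nonnesting\<close>). For 132 a walk is read from the number of top values that appear in
  increasing order. One may either demand that one more value joins them or, in the remaining case,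
  delete the arc at the first point; this is a step up or a step down
  (\<open>card_low_start_132\<close>). In both cases a recursion with one extra parameter, the current height,
  follows, and it is solved by a difference of two unrestricted walk counts. The pattern 213 is 132
  read backwards and upside down.

  So \<open>fp = n - 2 * j\<close> has probability proportional to
  \<open>q ^ (n - 2 * j) * ((n choose j) - (n choose (j - 1)))\<close>, and what dominates depends on \<open>q\<close>.

  For \<open>q < 1\<close> the factor \<open>q ^ k\<close> keeps \<open>k = n - 2 * j\<close> bounded. Near the centre the ballot number is
  asymptotically proportional to \<open>k + 1\<close>, which leaves \<open>(k + 1) * q ^ k\<close> on one parity class.
  Dominated convergence handles the normalisation (\<open>subcritical_weights_limit\<close>).

  For \<open>q = 1\<close> the sum of ballot numbers telescopes, so that the tail of \<open>fp\<close> is exactly a quotient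
  of two binomial coefficients. At distance \<open>x * sqrt n / 2\<close> from the centre this quotient tends to
  \<open>exp (- x\<^sup>2 / 2)\<close> (\<open>binomial_local_limit\<close>), the tail of the Rayleigh distribution. The
  eigenvalue gap of a trace-zero symmetric matrix with entries \<open>a\<close>, \<open>b\<close> is \<open>2 * sqrt (a\<^sup>2 + b\<^sup>2)\<close>,
  and the radius of a planar Gaussian vector has the same tail (\<open>distr_GOE2_gap_eq_rayleigh\<close>).

  For \<open>q > 1\<close> the weights are, up to a factor depending only on \<open>n\<close>, differences
  \<open>b i - b (i + 1) / q\<^sup>2\<close> of the probabilities \<open>b\<close> of a binomial distribution with success
  probability \<open>q\<^sup>2 / (q\<^sup>2 + 1) > 1 / 2\<close>, where \<open>i = n - j\<close>. The restriction \<open>i \<ge> n - n div 2\<close> is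
  satisfied with probability tending to \<open>1\<close>, and the shift by one is invisible at scale \<open>sqrt n\<close>, so
  the factor \<open>1 - 1 / q\<^sup>2\<close> cancels and the central limit theorem for the binomial distribution remains
  (\<open>sum_fp_weight_as_binomial\<close>, \<open>binomial_clt\<close>).
\<close>

section \<open>Walks with unit steps\<close>

text \<open>
  The number of walks with \<open>n\<close> steps \<open>1\<close> or \<open>-1\<close> from \<open>0\<close> to \<open>z\<close>. Endpoints are integers and the
  values are integers too, because the counts below are differences of two of these numbers with
  endpoints that may be negative.
\<close>

fun walks :: "nat \<Rightarrow> int \<Rightarrow> int" where
  "walks 0 z = (if z = 0 then 1 else 0)"
| "walks (Suc n) z = walks n (z - 1) + walks n (z + 1)"

lemma walks_beyond_eq_0: "z > int n \<Longrightarrow> walks n z = 0"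
  by (induction n arbitrary: z) auto

lemma walks_odd_eq_0: "odd (int n + z) \<Longrightarrow> walks n z = 0"
  by (induction n arbitrary: z) auto

lemma walks_eq_binomial: "walks n (int n - 2 * int j) = int (n choose j)"
proof (induction n arbitrary: j)
  case (Suc n)
  show ?case
  proof (cases j)
    case 0
    then show ?thesis using Suc[of 0] by (simp add: walks_beyond_eq_0)
  next
    case (Suc i)
    have "int (Suc n) - 2 * int j - 1 = int n - 2 * int (Suc i)"
      "int (Suc n) - 2 * int j + 1 = int n - 2 * int i" using Suc by auto
    then show ?thesis using Suc Suc.IH[of i] Suc.IH[of "Suc i"] by (simp only: walks.simps) simp
  qed
qed simp

section \<open>Involutions as arc diagrams\<close>

text \<open>
  The points may lie in any set: deleting a two-cycle then only makes its two points fixed, without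
  renumbering the others.
\<close>

definition involutions_on :: "'a set \<Rightarrow> ('a \<Rightarrow> 'a) set" where
  "involutions_on S = {\<pi>. \<pi> permutes S \<and> \<pi> \<circ> \<pi> = id}"

definition num_fixed :: "'a set \<Rightarrow> ('a \<Rightarrow> 'a) \<Rightarrow> nat" where
  "num_fixed S \<pi> = card {x \<in> S. \<pi> x = x}"

lemma involutions_onD:
  assumes "\<pi> \<in> involutions_on S"
  shows "\<pi> (\<pi> x) = x" "x \<notin> S \<Longrightarrow> \<pi> x = x" "\<pi> x \<in> S \<longleftrightarrow> x \<in> S" "\<pi> x = \<pi> y \<longleftrightarrow> x = y"
proof -
  have p: "\<pi> permutes S" and i: "\<pi> \<circ> \<pi> = id" using assms by (auto simp: involutions_on_def)
  show inv: "\<pi> (\<pi> x) = x" for x using i by (rule pointfree_idE)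
  show "x \<notin> S \<Longrightarrow> \<pi> x = x" "\<pi> x \<in> S \<longleftrightarrow> x \<in> S" using p by (auto simp: permutes_not_in permutes_in_image)
  show "\<pi> x = \<pi> y \<longleftrightarrow> x = y" by (metis inv)
qed

lemma finite_involutions_on: "finite S \<Longrightarrow> finite (involutions_on S)"
  unfolding involutions_on_def by (rule finite_subset[OF _ finite_permutations[of S]]) auto

lemma id_in_involutions_on: "id \<in> involutions_on S"
  by (simp add: involutions_on_def permutes_id)

lemma involutions_onI:
  assumes "\<And>x. \<pi> (\<pi> x) = x" "\<And>x. x \<notin> S \<Longrightarrow> \<pi> x = x"
  shows "\<pi> \<in> involutions_on S"
proof -
  have "\<exists>!x. \<pi> x = y" for y by (rule ex1I[of _ "\<pi> y"]) (use assms(1) in auto)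
  then show ?thesis using assms by (auto simp: involutions_on_def permutes_def)
qed

lemma involutions_on_drop_fixed:
  assumes "x \<notin> S"
  shows "\<pi> \<in> involutions_on (insert x S) \<and> \<pi> x = x \<longleftrightarrow> \<pi> \<in> involutions_on S"
proof
  assume *: "\<pi> \<in> involutions_on (insert x S) \<and> \<pi> x = x"
  then have "\<pi> \<in> involutions_on (insert x S)" by (rule conjunct1)
  note D = involutions_onD(1,2)[OF this]
  show "\<pi> \<in> involutions_on S" by (rule involutions_onI) (metis D * insert_iff)+
next
  assume "\<pi> \<in> involutions_on S"
  note D = involutions_onD(1,2)[OF this]
  have "\<pi> \<in> involutions_on (insert x S)" by (rule involutions_onI) (use D in \<open>blast\<close>)+
  then show "\<pi> \<in> involutions_on (insert x S) \<and> \<pi> x = x" using D(2)[OF assms] by blast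
qed

lemma arc_apply:
  assumes "\<pi> \<in> involutions_on S" "a \<notin> S" "b \<notin> S"
  shows "(\<pi> \<circ> Transposition.transpose a b) x = (if x = a then b else if x = b then a else \<pi> x)"
  using involutions_onD(2)[OF assms(1)] assms(2,3) by (auto simp: transpose_def)

lemma num_fixed_arc:
  assumes "\<pi> \<in> involutions_on S" "a \<notin> S" "b \<notin> S" "a \<noteq> b"
  shows "num_fixed (insert a (insert b S)) (\<pi> \<circ> Transposition.transpose a b) = num_fixed S \<pi>"
  unfolding num_fixed_def arc_apply[OF assms(1-3)] using assms
  by (intro arg_cong[where f = card]) auto

text \<open>
  Composing with the transposition of \<open>a\<close> and \<open>b\<close> deletes the arc between them from a diagram that has
  it, and inserts the arc into a diagram in which both points are fixed. It is its own inverse, so the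
  same map serves in both directions.
\<close>

lemma card_involutions_on_arc:
  assumes "a \<noteq> b" "a \<notin> S" "b \<notin> S"
    and Q: "\<And>\<pi>. \<pi> \<in> involutions_on S \<Longrightarrow> Q (\<pi> \<circ> Transposition.transpose a b) \<longleftrightarrow> Q' \<pi>"
  shows "card {\<pi> \<in> involutions_on (insert a (insert b S)). \<pi> a = b \<and> Q \<pi>} =
    card {\<pi> \<in> involutions_on S. Q' \<pi>}"
proof -
  let ?\<tau> = "Transposition.transpose a b"
  have inv: "\<pi> \<circ> ?\<tau> \<circ> ?\<tau> = \<pi>" for \<pi> :: "'a \<Rightarrow> 'a" by (simp add: fun_eq_iff)
  have add: "\<pi> \<circ> ?\<tau> \<in> involutions_on (insert a (insert b S))" "(\<pi> \<circ> ?\<tau>) a = b"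
    if "\<pi> \<in> involutions_on S" for \<pi>
  proof -
    note D = involutions_onD[OF that]
    show "\<pi> \<circ> ?\<tau> \<in> involutions_on (insert a (insert b S))"
    proof (rule involutions_onI, goal_cases)
      case (1 x)
      show ?case using D(1)[of x] D(2)[of x] D(3)[of x] assms(1-3) unfolding arc_apply[OF that assms(2,3)] by auto
    next
      case (2 x)
      then show ?case using D(2)[of x] unfolding arc_apply[OF that assms(2,3)] by auto
    qed
    show "(\<pi> \<circ> ?\<tau>) a = b" unfolding arc_apply[OF that assms(2,3)] by simp
  qed
  have remove: "\<pi> \<circ> ?\<tau> \<in> involutions_on S"
    if "\<pi> \<in> involutions_on (insert a (insert b S))" "\<pi> a = b" for \<pi>
  proof -
    note D = involutions_onD[OF that(1)]
    have b: "\<pi> b = a" using D(1)[of a] that(2) by simp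
    have ap: "(\<pi> \<circ> ?\<tau>) x = (if x = a then a else if x = b then b else \<pi> x)" for x
      using b that(2) by (auto simp: transpose_def)
    show ?thesis
    proof (rule involutions_onI, goal_cases)
      case (1 x)
      show ?case
      proof (cases "x = a \<or> x = b")
        case True
        then show ?thesis by (metis ap)
      next
        case False
        then have "\<pi> x \<noteq> a" "\<pi> x \<noteq> b" using D(1)[of x] b that(2) by metis+
        then show ?thesis using False by (simp only: ap de_Morgan_disj if_False simp_thms D(1))
      qed
    next
      case (2 x)
      then show ?case by (metis ap D(2) insert_iff)
    qed
  qed
  have "bij_betw (\<lambda>\<pi>. \<pi> \<circ> ?\<tau>) {\<pi> \<in> involutions_on S. Q' \<pi>}
    {\<pi> \<in> involutions_on (insert a (insert b S)). \<pi> a = b \<and> Q \<pi>}"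
  proof (rule bij_betwI[where g = "\<lambda>\<pi>. \<pi> \<circ> ?\<tau>"])
    show "(\<lambda>\<pi>. \<pi> \<circ> ?\<tau>) \<in> {\<pi> \<in> involutions_on S. Q' \<pi>} \<rightarrow>
        {\<pi> \<in> involutions_on (insert a (insert b S)). \<pi> a = b \<and> Q \<pi>}"
    proof (intro Pi_I CollectI conjI; elim CollectE conjE)
      fix \<pi> assume \<pi>: "\<pi> \<in> involutions_on S" "Q' \<pi>"
      show "\<pi> \<circ> ?\<tau> \<in> involutions_on (insert a (insert b S))" "(\<pi> \<circ> ?\<tau>) a = b"
        by (rule add[OF \<pi>(1)])+
      show "Q (\<pi> \<circ> ?\<tau>)" using Q[OF \<pi>(1)] \<pi>(2) by blast
    qed
    show "(\<lambda>\<pi>. \<pi> \<circ> ?\<tau>) \<in> {\<pi> \<in> involutions_on (insert a (insert b S)). \<pi> a = b \<and> Q \<pi>} \<rightarrow>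
        {\<pi> \<in> involutions_on S. Q' \<pi>}"
    proof (intro Pi_I CollectI conjI; elim CollectE conjE)
      fix \<pi> assume \<pi>: "\<pi> \<in> involutions_on (insert a (insert b S))" "\<pi> a = b" "Q \<pi>"
      show "\<pi> \<circ> ?\<tau> \<in> involutions_on S" by (rule remove[OF \<pi>(1,2)])
      then show "Q' (\<pi> \<circ> ?\<tau>)" using Q[of "\<pi> \<circ> ?\<tau>"] \<pi>(3) by (simp only: inv)
    qed
  qed (rule inv)+
  from bij_betw_same_card[OF this] show ?thesis by (rule sym)
qed

section \<open>Nonnesting involutions\<close>

text \<open>
  With \<open>j = \<pi> j\<close> allowed, a fixed point counts as a degenerate arc: neither an arc nor a fixed point
  may lie under an arc.
\<close>

definition nonnesting_on :: "'a::linorder set \<Rightarrow> ('a \<Rightarrow> 'a) \<Rightarrow> bool" where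
  "nonnesting_on S \<pi> \<longleftrightarrow> (\<forall>i\<in>S. \<forall>j\<in>S. \<not> (i < j \<and> j \<le> \<pi> j \<and> \<pi> j < \<pi> i))"


text \<open>
  Diagrams read up to the last point of \<open>P\<close>, with one point of \<open>T\<close> for each arc that is still open:
  the points of \<open>T\<close>, which lie to the right of \<open>P\<close>, are the future right ends of these arcs. Since
  arcs do not nest, the arcs close in the order in which they were opened.
\<close>

definition open_nonnesting :: "'a::linorder set \<Rightarrow> 'a set \<Rightarrow> nat \<Rightarrow> ('a \<Rightarrow> 'a) set" where
  "open_nonnesting P T k = {\<pi> \<in> involutions_on (P \<union> T).
     nonnesting_on (P \<union> T) \<pi> \<and> (\<forall>t\<in>T. \<pi> t \<in> P) \<and> num_fixed (P \<union> T) \<pi> = k}"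

lemma finite_open_nonnesting: "finite P \<Longrightarrow> finite T \<Longrightarrow> finite (open_nonnesting P T k)"
  unfolding open_nonnesting_def using finite_involutions_on[of "P \<union> T"] by simp

context
  fixes P T :: "'a::linorder set" and p :: 'a
  assumes finP: "finite P" and finT: "finite T"
    and Pp: "\<And>x. x \<in> P \<Longrightarrow> x < p" and pT: "\<And>t. t \<in> T \<Longrightarrow> p < t"
begin

lemma next_notin: "p \<notin> P" "p \<notin> T"
  using Pp pT by blast+

lemma less_open: "x \<in> P \<Longrightarrow> t \<in> T \<Longrightarrow> x < t"
  using Pp pT by (meson order_less_trans)

text \<open>
  The following lemmas read a point \<open>p\<close> between \<open>P\<close> and \<open>T\<close>. A fixed point must not
  lie under an open arc, so it can only occur when no arc is open.
\<close>

lemma open_nonnesting_fixed: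
  "{\<pi> \<in> open_nonnesting (insert p P) T k. \<pi> p = p} =
    (if T = {} \<and> k > 0 then open_nonnesting P {} (k - 1) else {})"
proof (cases "T = {}")
  case True
  have "\<pi> \<in> open_nonnesting (insert p P) {} k \<and> \<pi> p = p \<longleftrightarrow>
      \<pi> \<in> open_nonnesting P {} (k - 1) \<and> k > 0" for \<pi>
  proof -
    have 1: "num_fixed (insert p P) \<pi> = Suc (num_fixed P \<pi>)" if "\<pi> p = p"
    proof -
      have "{x \<in> insert p P. \<pi> x = x} = insert p {x \<in> P. \<pi> x = x}" using that by auto
      then show ?thesis unfolding num_fixed_def using finP next_notin by simp
    qed
    have 2: "nonnesting_on (insert p P) \<pi> \<longleftrightarrow> nonnesting_on P \<pi>"
      if "\<pi> p = p" "\<pi> \<in> involutions_on P"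
    proof -
      have "\<pi> i < p" if "i \<in> P" for i
        using that Pp involutions_onD(3)[OF \<open>\<pi> \<in> involutions_on P\<close>] by blast
      then show ?thesis
        using \<open>\<pi> p = p\<close> Pp unfolding nonnesting_on_def by (auto dest: order_less_asym)
    qed
    show ?thesis
      using involutions_on_drop_fixed[OF next_notin(1), of \<pi>] 1 2 unfolding open_nonnesting_def
      by auto
  qed
  then show ?thesis using True by auto
next
  case False
  have "False" if "\<pi> \<in> open_nonnesting (insert p P) T k" "\<pi> p = p" for \<pi>
  proof -
    from False obtain t where t: "t \<in> T" by auto
    have D: "\<pi> (\<pi> t) = t" "\<pi> t \<in> insert p P" "nonnesting_on (insert p P \<union> T) \<pi>"
      using that t involutions_onD(1)[of \<pi> "insert p P \<union> T"] by (auto simp: open_nonnesting_def)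
    have "\<pi> t \<noteq> p" using D(1) that(2) pT[OF t] by auto
    then have "\<pi> t < p" using D(2) Pp by auto
    moreover have "p < \<pi> (\<pi> t)" using D(1) pT[OF t] by simp
    ultimately show False
      using D(2,3) that(2) unfolding nonnesting_on_def by (metis UnI1 insertI1 order_refl)
  qed
  then show ?thesis using False by auto
qed

text \<open>
  If \<open>p\<close> closes an arc, then before reading it that arc was open, and \<open>p\<close> itself is its future
  right end. The two descriptions concern the same involutions.
\<close>

lemma open_nonnesting_closer:
  "{\<pi> \<in> open_nonnesting (insert p P) T k. \<pi> p < p} = open_nonnesting P (insert p T) k"
proof -
  have S: "P \<union> insert p T = insert p P \<union> T" by auto
  have "(\<forall>t\<in>T. \<pi> t \<in> insert p P) \<and> \<pi> p < p \<longleftrightarrow> (\<forall>t\<in>insert p T. \<pi> t \<in> P)"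
    if "\<pi> \<in> involutions_on (insert p P \<union> T)" for \<pi>
  proof
    note D = involutions_onD[OF that]
    assume *: "(\<forall>t\<in>T. \<pi> t \<in> insert p P) \<and> \<pi> p < p"
    have "\<pi> p \<in> P" using * D(3)[of p] pT by (auto dest: order_less_asym)
    moreover have "\<pi> t \<noteq> p" if "t \<in> T" for t using D(1)[of t] \<open>\<pi> p \<in> P\<close> less_open[OF _ that, of t] that by auto
    ultimately show "\<forall>t\<in>insert p T. \<pi> t \<in> P" using * by auto
  qed (use Pp in auto)
  then show ?thesis unfolding open_nonnesting_def S by blast
qed

text \<open>
  An arc opened at \<open>p\<close> is the youngest open arc. It must close last, for otherwise the arc that
  closes last would enclose it.
\<close>

lemma open_nonnesting_opener_arc:
  assumes \<pi>: "\<pi> \<in> open_nonnesting (insert p P) T k" "\<pi> p > p"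
  shows "T \<noteq> {}" "\<pi> p = Max T"
proof -
  have D: "\<pi> (\<pi> x) = x" "\<pi> p \<in> insert p P \<union> T" "nonnesting_on (insert p P \<union> T) \<pi>" for x
    using \<pi> involutions_onD(1,3)[of \<pi> "insert p P \<union> T"] by (auto simp: open_nonnesting_def)
  have T: "\<pi> p \<in> T" using D(2) \<pi>(2) Pp by (auto dest: order_less_asym)
  then show "T \<noteq> {}" by auto
  define t where "t = Max T"
  have t: "t \<in> T" "\<pi> p \<le> t" using T finT \<open>T \<noteq> {}\<close> unfolding t_def by (auto intro: Max_in)
  show "\<pi> p = Max T"
  proof (rule ccontr)
    assume "\<pi> p \<noteq> Max T"
    then have less: "\<pi> p < t" using t by (simp add: t_def)
    have "\<pi> t \<in> insert p P" using \<pi> t by (auto simp: open_nonnesting_def)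
    moreover have "\<pi> t \<noteq> p" using D(1)[of t] less by auto
    ultimately have "\<pi> t < p" "\<pi> t \<in> insert p P \<union> T" using Pp by auto
    moreover have "p \<in> insert p P \<union> T" by simp
    ultimately show False
      using D(3) \<pi>(2) less unfolding nonnesting_on_def
      by (metis D(1) order_less_imp_le)
  qed
qed

lemma card_open_nonnesting_opener:
  assumes "T \<noteq> {}"
  shows "card {\<pi> \<in> open_nonnesting (insert p P) T k. \<pi> p > p} =
    card (open_nonnesting P (T - {Max T}) k)"
proof -
  define t where "t = Max T"
  define T' where "T' = T - {t}"
  have t: "t \<in> T" unfolding t_def using finT assms by auto
  have T: "T = insert t T'" "t \<notin> T'" using t by (auto simp: T'_def)
  have T't: "x < t" if "x \<in> T'" for x
    using that Max_ge[OF finT, of x] unfolding T'_def t_def by (simp add: less_le)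
  have S: "insert p P \<union> T = insert p (insert t (P \<union> T'))" using T by auto
  have notin: "p \<noteq> t" "p \<notin> P \<union> T'" "t \<notin> P \<union> T'" using T pT[OF t] less_open[OF _ t] next_notin by auto
  let ?Q = "\<lambda>\<pi>. nonnesting_on (insert p (insert t (P \<union> T'))) \<pi> \<and> (\<forall>t\<in>T. \<pi> t \<in> insert p P) \<and>
      num_fixed (insert p (insert t (P \<union> T'))) \<pi> = k"
  let ?Q' = "\<lambda>\<pi>. nonnesting_on (P \<union> T') \<pi> \<and> (\<forall>t\<in>T'. \<pi> t \<in> P) \<and> num_fixed (P \<union> T') \<pi> = k"
  have *: "{\<pi> \<in> open_nonnesting (insert p P) T k. \<pi> p > p} =
      {\<pi> \<in> involutions_on (insert p (insert t (P \<union> T'))). \<pi> p = t \<and> ?Q \<pi>}"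
    using open_nonnesting_opener_arc pT[OF t] unfolding t_def[symmetric] S[symmetric] open_nonnesting_def
    by blast
  have "card {\<pi> \<in> involutions_on (insert p (insert t (P \<union> T'))). \<pi> p = t \<and> ?Q \<pi>} =
      card {\<pi> \<in> involutions_on (P \<union> T'). ?Q' \<pi>}"
  proof (rule card_involutions_on_arc[OF notin])
    fix \<pi> assume \<pi>: "\<pi> \<in> involutions_on (P \<union> T')"
    note D = involutions_onD[OF \<pi>]
    define \<rho> where "\<rho> = \<pi> \<circ> Transposition.transpose p t"
    have ap: "\<rho> x = (if x = p then t else if x = t then p else \<pi> x)" for x
      unfolding \<rho>_def by (rule arc_apply[OF \<pi> notin(2,3)])
    have ap': "\<rho> x = \<pi> x" if "x \<in> P \<union> T'" for x unfolding ap using that notin by auto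
    have 1: "(\<forall>x\<in>T. \<rho> x \<in> insert p P) \<longleftrightarrow> (\<forall>x\<in>T'. \<pi> x \<in> P)"
    proof -
      have "\<rho> x \<in> insert p P \<longleftrightarrow> \<pi> x \<in> P" if "x \<in> T'" for x
        using that notin D(3)[of x] ap'[of x] by auto
      moreover have "\<rho> t \<in> insert p P" unfolding ap by simp
      ultimately show ?thesis unfolding T(1) by blast
    qed
    have 2: "nonnesting_on (insert p (insert t (P \<union> T'))) \<rho> \<longleftrightarrow> nonnesting_on (P \<union> T') \<pi>"
      if *: "\<forall>x\<in>T'. \<pi> x \<in> P"
    proof
      assume N: "nonnesting_on (insert p (insert t (P \<union> T'))) \<rho>"
      show "nonnesting_on (P \<union> T') \<pi>" unfolding nonnesting_on_def
      proof (intro ballI)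
        fix i j assume ij: "i \<in> P \<union> T'" "j \<in> P \<union> T'"
        then show "\<not> (i < j \<and> j \<le> \<pi> j \<and> \<pi> j < \<pi> i)"
          using N[unfolded nonnesting_on_def, rule_format, of i j, unfolded ap'[OF ij(1)] ap'[OF ij(2)]]
          by blast
      qed
    next
      assume N: "nonnesting_on (P \<union> T') \<pi>"
      show "nonnesting_on (insert p (insert t (P \<union> T'))) \<rho>" unfolding nonnesting_on_def
      proof (intro ballI notI; elim conjE)
        fix i j assume ij: "i \<in> insert p (insert t (P \<union> T'))" "j \<in> insert p (insert t (P \<union> T'))"
          "i < j" "j \<le> \<rho> j" "\<rho> j < \<rho> i"
        have le: "x \<le> t" if "x \<in> insert p (insert t (P \<union> T'))" for x
          using that T't less_open[OF _ t] pT[OF t] by (auto intro: order_less_imp_le)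
        have "j \<noteq> t" using ij(4) pT[OF t] notin(1) unfolding ap by (auto split: if_splits)
        have "i \<noteq> t" using ij(2,3) le by (metis leD)
        have "i \<noteq> p"
        proof
          assume "i = p"
          then have j: "j \<in> T'" using ij(2,3) \<open>j \<noteq> t\<close> by (auto dest!: Pp)
          then have "\<pi> j < j" using * less_open[of "\<pi> j" j] T by auto
          then show False using ij(4) ap'[of j] j by auto
        qed
        then have i: "i \<in> P \<union> T'" "\<rho> i = \<pi> i" using ij(1) \<open>i \<noteq> t\<close> ap'[of i] by auto
        then have "\<pi> i \<in> P \<union> T'" using D(3) by blast
        then have "\<pi> i \<le> t" using le by blast
        then have "j \<noteq> p" using ij(5) ap[of p] i(2) by auto
        then have j: "j \<in> P \<union> T'" using ij(2) \<open>j \<noteq> t\<close> by auto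
        show False
          using N i(1) j ij(3-5) unfolding i(2) ap'[OF j] nonnesting_on_def by blast
      qed
    qed
    have 3: "num_fixed (insert p (insert t (P \<union> T'))) \<rho> = num_fixed (P \<union> T') \<pi>"
      unfolding \<rho>_def by (rule num_fixed_arc[OF \<pi> notin(2,3,1)])
    show "?Q (\<pi> \<circ> Transposition.transpose p t) \<longleftrightarrow> ?Q' \<pi>"
      unfolding \<rho>_def[symmetric] 1 3 using 2 by metis
  qed
  then show ?thesis unfolding * by (simp only: open_nonnesting_def[of P] T'_def t_def)
qed

lemma card_open_nonnesting_split:
  "card (open_nonnesting (insert p P) T k) =
     card {\<pi> \<in> open_nonnesting (insert p P) T k. \<pi> p = p} +
     card {\<pi> \<in> open_nonnesting (insert p P) T k. \<pi> p < p} +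
     card {\<pi> \<in> open_nonnesting (insert p P) T k. \<pi> p > p}" (is "card ?A = _")
proof -
  have fin: "finite ?A" using finP finT by (intro finite_open_nonnesting) auto
  have A: "({\<pi> \<in> ?A. \<pi> p = p} \<union> {\<pi> \<in> ?A. \<pi> p < p}) \<union> {\<pi> \<in> ?A. \<pi> p > p} = ?A"
    using less_linear by blast
  have "card ({\<pi> \<in> ?A. \<pi> p = p} \<union> {\<pi> \<in> ?A. \<pi> p < p} \<union> {\<pi> \<in> ?A. \<pi> p > p}) =
      card ({\<pi> \<in> ?A. \<pi> p = p} \<union> {\<pi> \<in> ?A. \<pi> p < p}) + card {\<pi> \<in> ?A. \<pi> p > p}"
    by (rule card_Un_disjoint) (use fin in auto)
  moreover have "card ({\<pi> \<in> ?A. \<pi> p = p} \<union> {\<pi> \<in> ?A. \<pi> p < p}) =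
      card {\<pi> \<in> ?A. \<pi> p = p} + card {\<pi> \<in> ?A. \<pi> p < p}"
    by (rule card_Un_disjoint) (use fin in auto)
  ultimately show ?thesis unfolding A by simp
qed

end

lemma walks_uminus: "walks n (- z) = walks n z"
proof (induction n arbitrary: z)
  case (Suc n)
  have "- z - 1 = - (z + 1)" "- z + 1 = - (z - 1)" by simp_all
  then show ?case by (simp only: walks.simps Suc add.commute)
qed simp

text \<open>
  With \<open>h = card T\<close> open arcs and \<open>k\<close> fixed points, the count is that of the nonnegative walks of
  \<open>card P\<close> steps ending at height \<open>k + h\<close>: fixed points behave like arcs that are never closed.
  If \<open>k = h = 0\<close>, there is no fixed point to remove; the missing term vanishes because the two walk
  counts that would make it up agree by symmetry.
\<close>

theorem card_open_nonnesting:
  fixes P T :: "'a::linorder set"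
  assumes "finite P" "finite T" "\<forall>x\<in>P. \<forall>y\<in>T. x < y"
  shows "int (card (open_nonnesting P T k)) =
    walks (card P) (int k + int (card T)) - walks (card P) (int k + int (card T) + 2)"
  using assms
proof (induction "card P" arbitrary: P T k)
  case 0
  then have P: "P = {}" by simp
  show ?case
  proof (cases "T = {}")
    case True
    have "open_nonnesting {} {} k = (if k = 0 then {id} else {} :: ('a \<Rightarrow> 'a) set)"
      by (auto simp: open_nonnesting_def involutions_on_def nonnesting_on_def num_fixed_def)
    then show ?thesis using P True by simp
  next
    case False
    then have "open_nonnesting P T k = {}" using P by (auto simp: open_nonnesting_def)
    moreover have "card T > 0" using False 0 by auto
    ultimately show ?thesis using P by simp
  qed
next
  case (Suc n P0 T k)
  define p where "p = Max P0"
  define P where "P = P0 - {p}"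
  have "P0 \<noteq> {}" using Suc(2) by auto
  then have p: "p \<in> P0" unfolding p_def using Suc.prems(1) by (intro Max_in)
  have P: "P0 = insert p P" "p \<notin> P" "finite P" "card P = n" using p Suc(2) Suc.prems(1) unfolding P_def by auto
  have Pp: "x < p" if "x \<in> P" for x
    using that Max_ge[OF Suc.prems(1), of x] unfolding P_def p_def by (simp add: less_le)
  have pT: "\<And>t. t \<in> T \<Longrightarrow> p < t" and PT: "\<forall>x\<in>P. \<forall>t\<in>T. x < t" using Suc.prems(3) p P(1) by auto
  have IH: "int (card (open_nonnesting P T' k')) =
      walks n (int k' + int (card T')) - walks n (int k' + int (card T') + 2)"
    if "finite T'" "\<forall>x\<in>P. \<forall>y\<in>T'. x < y" for T' k'
    using Suc.hyps(1)[of P T' k'] that P(3,4) by simp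
  note hyps = \<open>finite P\<close> \<open>finite T\<close> Pp pT
  have close: "int (card {\<pi> \<in> open_nonnesting (insert p P) T k. \<pi> p < p}) =
      walks n (int k + int (card T) + 1) - walks n (int k + int (card T) + 3)"
  proof -
    have c: "int (card (insert p T)) = int (card T) + 1"
      using pT Suc.prems(2) by (subst card_insert_disjoint) auto
    have "int (card (open_nonnesting P (insert p T) k)) =
        walks n (int k + int (card (insert p T))) - walks n (int k + int (card (insert p T)) + 2)"
      using PT Pp Suc.prems(2) by (intro IH) auto
    then show ?thesis using open_nonnesting_closer[OF hyps, of k] by (simp add: c add.assoc)
  qed
  show ?case
  proof (cases "T = {}")
    case True
    have fixed: "int (card {\<pi> \<in> open_nonnesting (insert p P) T k. \<pi> p = p}) = walks n (int k - 1) - walks n (int k + 1)"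
    proof (cases k)
      case 0
      then have "card {\<pi> \<in> open_nonnesting (insert p P) T k. \<pi> p = p} = 0"
        using arg_cong[OF open_nonnesting_fixed[OF hyps, of k], of card] by (simp only: simp_thms less_irrefl if_False card.empty)
      then show ?thesis using 0 walks_uminus[of n 1] by simp
    next
      case (Suc i)
      then show ?thesis using open_nonnesting_fixed[OF hyps, of k] True IH[of "{}" i] by (simp add: add.commute)
    qed
    have empty: "{\<pi> \<in> open_nonnesting (insert p P) T k. \<pi> p > p} = {}"
      using open_nonnesting_opener_arc(1)[OF hyps] True by auto
    have "card {\<pi> \<in> open_nonnesting (insert p P) T k. \<pi> p > p} = 0"
      using arg_cong[OF empty, of card] by (simp only: card.empty)
    then show ?thesis
      using card_open_nonnesting_split[OF hyps, of k] fixed close True Suc(2)[symmetric] P(1)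
      by (simp add: algebra_simps)
  next
    case False
    have c: "int (card (T - {Max T})) = int (card T) - 1" "finite (T - {Max T})"
      using False Suc(4) by (auto simp: card_Diff_singleton Suc_leI card_gt_0_iff of_nat_diff)
    have "card {\<pi> \<in> open_nonnesting (insert p P) T k. \<pi> p = p} = 0"
      using arg_cong[OF open_nonnesting_fixed[OF hyps, of k], of card] False by (simp only: simp_thms if_False card.empty)
    then show ?thesis
      using card_open_nonnesting_split[OF hyps, of k] close False Suc(2)[symmetric]
        card_open_nonnesting_opener[OF hyps False, of k] IH[of "T - {Max T}" k] c PT P(1)
      by (simp add: algebra_simps)
  qed
qed

section \<open>Involutions avoiding 132\<close>

definition avoids_132_on :: "'a::linorder set \<Rightarrow> ('a \<Rightarrow> 'a) \<Rightarrow> bool" where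
  "avoids_132_on S \<pi> \<longleftrightarrow>
     (\<forall>i\<in>S. \<forall>j\<in>S. \<forall>l\<in>S. i < j \<and> j < l \<longrightarrow> \<not> (\<pi> i < \<pi> l \<and> \<pi> l < \<pi> j))"

text \<open>
  For a 132-avoiding permutation the values above that of the first point appear in increasing order,
  so the condition on \<open>T\<close>, a set of top elements, says that all of \<open>T\<close> appears in increasing order.
  In terms of walks, \<open>card T\<close> is the height at which the walk starts.
\<close>

definition low_start_132 :: "'a::linorder set \<Rightarrow> 'a set \<Rightarrow> nat \<Rightarrow> ('a \<Rightarrow> 'a) set" where
  "low_start_132 P T k = {\<pi> \<in> involutions_on (P \<union> T).
     avoids_132_on (P \<union> T) \<pi> \<and> (\<forall>t\<in>T. \<pi> (Min (P \<union> T)) \<le> t) \<and> num_fixed (P \<union> T) \<pi> = k}"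

lemma finite_low_start_132: "finite P \<Longrightarrow> finite T \<Longrightarrow> finite (low_start_132 P T k)"
  unfolding low_start_132_def using finite_involutions_on[of "P \<union> T"] by simp

lemma avoids_132_onD:
  assumes "avoids_132_on S \<pi>" "i \<in> S" "j \<in> S" "l \<in> S" "i < j" "j < l" "\<pi> i < \<pi> l" "\<pi> l < \<pi> j"
  shows False
  using assms unfolding avoids_132_on_def by blast

text \<open>
  When \<open>T\<close> is everything, the first point is fixed, and every two-cycle would form a 132 pattern with
  it.
\<close>

lemma low_start_132_empty:
  assumes T: "finite T" and \<pi>: "\<pi> \<in> low_start_132 {} T k"
  shows "\<pi> = id"
proof (rule ccontr)
  assume "\<pi> \<noteq> id"
  then obtain x where x: "\<pi> x \<noteq> x" by (auto simp: fun_eq_iff)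
  have inv: "\<pi> \<in> involutions_on T" and av: "avoids_132_on T \<pi>"
    and low: "t \<in> T \<Longrightarrow> \<pi> (Min T) \<le> t" for t
    using \<pi> by (auto simp: low_start_132_def)
  note D = involutions_onD[OF inv]
  \<comment> \<open>Of the two points of a moved pair, take the smaller one.\<close>
  define y where "y = min x (\<pi> x)"
  have y: "y < \<pi> y" using x D(1)[of x] unfolding y_def by (auto simp: min_def)
  have yT: "y \<in> T" using y D(2)[of y] by (cases "y \<in> T") auto
  define a where "a = Min T"
  have a: "a \<in> T" "\<And>t. t \<in> T \<Longrightarrow> a \<le> t" using T yT Min_in[of T] unfolding a_def by fastforce+
  have "\<pi> a \<le> a" using low a(1) unfolding a_def by blast
  moreover have "a \<le> \<pi> a" using a D(3) by blast
  ultimately have fa: "\<pi> a = a" by simp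
  have "a < y" using a(2)[OF yT] y fa by (metis order_less_irrefl le_neq_trans)
  then show False
    using avoids_132_onD[OF av a(1) yT _ _ y] D(1)[of y] D(3)[of y] fa yT y by simp
qed

context
  fixes P T :: "'a::linorder set" and a t :: 'a
  assumes finP: "finite P" and finT: "finite T"
    and aP: "\<And>x. x \<in> P \<Longrightarrow> a < x" and Pt: "\<And>x. x \<in> P \<Longrightarrow> x < t" 
    and tT: "\<And>x. x \<in> T \<Longrightarrow> t < x" and at: "a < t"
begin

lemma arc_notin: "a \<noteq> t" "a \<notin> P \<union> T" "t \<notin> P \<union> T"
  using aP Pt tT at by (auto dest: order_less_asym)

lemma arc_start_less: "x \<in> insert t (P \<union> T) \<Longrightarrow> a < x"
  using aP tT at by (auto intro: order_less_trans)

lemma Min_arc_set: "Min (insert a (insert t (P \<union> T))) = a"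
  using finP finT arc_start_less by (intro Min_eqI) (auto intro: order_less_imp_le)

text \<open>
  Inserting an arc that joins a new first point \<open>a\<close> to a new point \<open>t\<close> just below \<open>T\<close>: the new
  permutation avoids 132 precisely if the old one does and, in addition, the values of \<open>T\<close>, which
  exceed that of \<open>a\<close>, appear in increasing order; in the old permutation this is the condition that
  its first value is low.
\<close>

lemma low_start_132_add_arc:
  assumes \<pi>: "\<pi> \<in> involutions_on (P \<union> T)"
    and \<rho>: "\<And>x. \<rho> x = (if x = a then t else if x = t then a else \<pi> x)"
  shows "avoids_132_on (insert a (insert t (P \<union> T))) \<rho> \<longleftrightarrow>
    avoids_132_on (P \<union> T) \<pi> \<and> (\<forall>y\<in>T. \<pi> (Min (P \<union> T)) \<le> y)"
proof
  note D = involutions_onD[OF \<pi>]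
  have \<rho>': "\<rho> x = \<pi> x" if "x \<in> P \<union> T" for x unfolding \<rho> using that arc_notin by auto
  assume av: "avoids_132_on (insert a (insert t (P \<union> T))) \<rho>"
  have "avoids_132_on (P \<union> T) \<pi>"
    unfolding avoids_132_on_def
  proof (intro ballI impI; elim conjE)
    fix i j l assume ijl: "i \<in> P \<union> T" "j \<in> P \<union> T" "l \<in> P \<union> T" "i < j" "j < l"
    show "\<not> (\<pi> i < \<pi> l \<and> \<pi> l < \<pi> j)"
      using avoids_132_onD[OF av, of i j l] ijl \<rho>' by auto
  qed
  moreover have "\<pi> (Min (P \<union> T)) \<le> y" if y: "y \<in> T" for y
  proof (rule ccontr)
    \<comment> \<open>Otherwise the values \<open>t < y < \<pi> (Min (P \<union> T))\<close> stand in the order of a 132 pattern.\<close>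
    define b where "b = Min (P \<union> T)"
    have b: "b \<in> P \<union> T" "\<And>x. x \<in> P \<union> T \<Longrightarrow> b \<le> x" using finP finT y Min_in[of "P \<union> T"] unfolding b_def by auto
    assume "\<not> \<pi> (Min (P \<union> T)) \<le> y"
    then have less: "y < \<pi> b" by (simp add: b_def)
    have py: "\<pi> y \<in> P \<union> T" using D(3)[of y] y by auto
    have "\<pi> y \<noteq> b" using D(1)[of y] less by auto
    then have "b < \<pi> y" using b(2)[OF py] by simp
    then show False
      using avoids_132_onD[OF av, of a b "\<pi> y"] arc_start_less[of b] b(1) py \<rho>'[OF b(1)] \<rho>'[OF py] 
        \<rho>[of a] D(1)[of y] less tT[OF y] by auto
  qed
  ultimately show "avoids_132_on (P \<union> T) \<pi> \<and> (\<forall>y\<in>T. \<pi> (Min (P \<union> T)) \<le> y)" by blast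
next
  note D = involutions_onD[OF \<pi>]
  have \<rho>': "\<rho> x = \<pi> x" if "x \<in> P \<union> T" for x unfolding \<rho> using that arc_notin by auto
  assume "avoids_132_on (P \<union> T) \<pi> \<and> (\<forall>y\<in>T. \<pi> (Min (P \<union> T)) \<le> y)"
  then have av: "avoids_132_on (P \<union> T) \<pi>" and low: "\<And>y. y \<in> T \<Longrightarrow> \<pi> (Min (P \<union> T)) \<le> y" by auto
  define b where "b = Min (P \<union> T)"
  have b: "b \<in> P \<union> T" "b \<le> x" if "x \<in> P \<union> T" for x
    using finP finT that Min_in[of "P \<union> T"] unfolding b_def by auto
  \<comment> \<open>A descent of \<open>\<pi>\<close> whose lower value lies in \<open>T\<close> would form a 132 pattern with the first
    point. Applied to the inverse, that is, to \<open>\<pi>\<close> again, this excludes descents at positions in \<open>T\<close>.\<close>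
  have no_desc: False if jl: "j \<in> P \<union> T" "l \<in> P \<union> T" "j < l" "\<pi> l < \<pi> j" and "\<pi> l \<in> T" for j l
  proof -
    have "\<pi> b \<le> \<pi> l" using low \<open>\<pi> l \<in> T\<close> unfolding b_def by blast
    moreover have "b \<noteq> l" using b(2)[OF jl(1)] jl(3) by auto
    ultimately have "\<pi> b < \<pi> l" using D(4)[of b l] by auto
    moreover have "b < j"
      using b(2)[OF jl(1)] \<open>\<pi> b < \<pi> l\<close> jl(4) by (metis le_neq_trans order_less_asym)
    ultimately show False using avoids_132_onD[OF av b(1)[OF jl(1)] jl(1,2)] jl by blast
  qed
  show "avoids_132_on (insert a (insert t (P \<union> T))) \<rho>" unfolding avoids_132_on_def
  proof (intro ballI impI notI; elim conjE)
    fix i j l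
    assume S: "i \<in> insert a (insert t (P \<union> T))" "j \<in> insert a (insert t (P \<union> T))"
        "l \<in> insert a (insert t (P \<union> T))"
      and o: "i < j" "j < l" "\<rho> i < \<rho> l" "\<rho> l < \<rho> j"
    have a_le: "a \<le> \<rho> x" if "x \<in> insert a (insert t (P \<union> T))" for x
    proof (cases "x = a \<or> x = t")
      case False
      then have "\<rho> x \<in> P \<union> T" using that \<rho>' D(3)[of x] by auto
      then show ?thesis using arc_start_less by (auto intro: order_less_imp_le)
    qed (use \<rho> at in auto)
    have "a \<le> i" using S(1) arc_start_less by (auto intro: order_less_imp_le)
    then have "j \<noteq> a" "l \<noteq> a" using o by auto
    moreover have "\<rho> t = a" using \<rho> at by auto
    then have "j \<noteq> t" "l \<noteq> t" using o a_le[OF S(1)] by (auto dest: order_less_trans)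
    ultimately have jl: "j \<in> P \<union> T" "l \<in> P \<union> T" using S by auto
    then have \<rho>jl: "\<rho> j = \<pi> j" "\<rho> l = \<pi> l" by (auto simp: \<rho>')
    have pjl: "\<pi> j \<in> P \<union> T" "\<pi> l \<in> P \<union> T" using D(3) jl by blast+
    consider "i = a" | "i = t" | "i \<in> P \<union> T" using S by blast
    then show False
    proof cases
      case 1
      then have "t < \<pi> l" using o(3) \<rho>[of a] \<rho>jl by simp
      then have "\<pi> l \<in> T" using pjl(2) Pt by (auto dest: order_less_asym)
      then show False using no_desc[OF jl o(2)] o(4) \<rho>jl by simp
    next
      case 2
      then have "j \<in> T" using o(1) jl(1) Pt by (auto dest: order_less_asym)
      then show False
        using no_desc[OF pjl(2,1)] o(2,4) \<rho>jl D(1)[of j] D(1)[of l] by simp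
    next
      case 3
      then show False using avoids_132_onD[OF av 3 jl o(1,2)] o(3,4) \<rho>jl \<rho>'[OF 3] by simp
    qed
  qed
qed

lemma card_low_start_132_arc:
  "card {\<pi> \<in> low_start_132 (insert a P) (insert t T) k. \<pi> a = t} = card (low_start_132 P T k)"
proof -
  let ?S = "insert a (insert t (P \<union> T))"
  have S: "insert a P \<union> insert t T = ?S" by auto
  have tle: "\<forall>y\<in>insert t T. t \<le> y" using tT by (auto intro: order_less_imp_le)
  let ?Q = "\<lambda>\<pi>. avoids_132_on ?S \<pi> \<and> num_fixed ?S \<pi> = k"
  let ?Q' = "\<lambda>\<pi>. avoids_132_on (P \<union> T) \<pi> \<and> (\<forall>t\<in>T. \<pi> (Min (P \<union> T)) \<le> t) \<and> num_fixed (P \<union> T) \<pi> = k"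
  have *: "{\<pi> \<in> low_start_132 (insert a P) (insert t T) k. \<pi> a = t} =
      {\<pi> \<in> involutions_on ?S. \<pi> a = t \<and> ?Q \<pi>}"
    unfolding low_start_132_def S Min_arc_set using tle by blast
  have "card {\<pi> \<in> involutions_on ?S. \<pi> a = t \<and> ?Q \<pi>} = card {\<pi> \<in> involutions_on (P \<union> T). ?Q' \<pi>}"
  proof (rule card_involutions_on_arc[OF arc_notin])
    fix \<pi> assume \<pi>: "\<pi> \<in> involutions_on (P \<union> T)"
    define \<rho> where "\<rho> = \<pi> \<circ> Transposition.transpose a t"
    have \<rho>: "\<rho> x = (if x = a then t else if x = t then a else \<pi> x)" for x
      unfolding \<rho>_def by (rule arc_apply[OF \<pi> arc_notin(2,3)])
    have "num_fixed ?S \<rho> = num_fixed (P \<union> T) \<pi>"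
      unfolding \<rho>_def by (rule num_fixed_arc[OF \<pi> arc_notin(2,3,1)])
    then show "?Q (\<pi> \<circ> Transposition.transpose a t) \<longleftrightarrow> ?Q' \<pi>"
      unfolding \<rho>_def[symmetric] low_start_132_add_arc[OF \<pi> \<rho>] by metis
  qed
  then show ?thesis unfolding * by (simp only: low_start_132_def)
qed

end

text \<open>
  Let \<open>a\<close> be the first point and \<open>p\<close> the largest element of \<open>P\<close>. Either the value at \<open>a\<close> is at most
  \<open>p\<close>, so that \<open>p\<close> may join \<open>T\<close> and the starting height rises, or it is exactly the smallest element
  of \<open>T\<close>; deleting this arc lowers the starting height by one. This is the recursion for walks
  that start at height \<open>card T\<close>, stay nonnegative and end at \<open>k\<close>.
\<close>

theorem card_low_start_132:
  fixes P T :: "'a::linorder set"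
  assumes "finite P" "finite T" "\<forall>x\<in>P. \<forall>y\<in>T. x < y"
  shows "int (card (low_start_132 P T k)) =
    walks (card P) (int k - int (card T)) - walks (card P) (int k + int (card T) + 2)"
  using assms
proof (induction "card P" arbitrary: P T)
  case 0
  then have P: "P = {}" by simp
  have *: "num_fixed T id = card T" by (simp add: num_fixed_def)
  have "\<pi> \<in> low_start_132 {} T k \<longleftrightarrow> \<pi> = id \<and> k = card T" for \<pi> :: "'a \<Rightarrow> 'a"
  proof
    assume "\<pi> \<in> low_start_132 {} T k"
    then show "\<pi> = id \<and> k = card T"
      using low_start_132_empty[OF 0(3), of \<pi> k] * by (auto simp: low_start_132_def)
  next
    assume "\<pi> = id \<and> k = card T"
    then show "\<pi> \<in> low_start_132 {} T k"
      using * id_in_involutions_on[of T] 0(3) by (auto simp: low_start_132_def avoids_132_on_def)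
  qed
  then have "low_start_132 {} T k = (if k = card T then {id} else {})" by auto
  then show ?case using P by simp
next
  case (Suc n P T)
  have ne: "P \<noteq> {}" using Suc(2) by auto
  define p where "p = Max P"
  define S where "S = P \<union> T"
  define a where "a = Min S"
  have finS: "finite S" using Suc.prems by (simp add: S_def)
  have p: "p \<in> P" unfolding p_def using Suc.prems(1) ne by (rule Max_in)
  have ple: "x \<le> p" if "x \<in> P" for x unfolding p_def using Suc.prems(1) that by (rule Max_ge)
  have a: "a \<in> S" "\<And>x. x \<in> S \<Longrightarrow> a \<le> x" using finS p Min_in[of S] by (auto simp: a_def S_def)
  have aP: "a \<in> P"
  proof (rule ccontr)
    assume "a \<notin> P"
    then have "p < a" using a(1) p Suc.prems(3) by (auto simp: S_def)
    then show False using a(2)[of p] p by (auto simp: S_def)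
  qed
  define P' where "P' = P - {p}"
  have P': "finite P'" "card P' = n" "P' \<union> insert p T = S" "p \<notin> T" "\<forall>x\<in>P'. \<forall>y\<in>insert p T. x < y"
    using Suc.prems Suc(2) p ple by (auto simp: P'_def S_def order.strict_iff_order)
  have up: "{\<pi> \<in> low_start_132 P T k. \<pi> a \<le> p} = low_start_132 P' (insert p T) k"
  proof -
    have "(\<forall>t\<in>T. \<pi> a \<le> t) \<and> \<pi> a \<le> p \<longleftrightarrow> (\<forall>t\<in>insert p T. \<pi> a \<le> t)" for \<pi> by auto
    then show ?thesis unfolding low_start_132_def P'(3) S_def[symmetric] a_def[symmetric] by blast
  qed
  have upcard: "int (card (low_start_132 P' (insert p T) k)) =
      walks n (int k - int (card T) - 1) - walks n (int k + int (card T) + 3)"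
  proof -
    have "int (card (low_start_132 P' (insert p T) k)) = walks (card P') (int k - int (card (insert p T)))
        - walks (card P') (int k + int (card (insert p T)) + 2)"
      using P' Suc.prems by (intro Suc.hyps(1)) auto
    moreover have "int (card (insert p T)) = int (card T) + 1" using P'(4) Suc.prems(2) by simp
    ultimately show ?thesis using P'(2) by (simp add: algebra_simps)
  qed
  have split: "card (low_start_132 P T k) =
      card {\<pi> \<in> low_start_132 P T k. \<pi> a \<le> p} + card {\<pi> \<in> low_start_132 P T k. \<not> \<pi> a \<le> p}"
  proof -
    have "card ({\<pi> \<in> low_start_132 P T k. \<pi> a \<le> p} \<union> {\<pi> \<in> low_start_132 P T k. \<not> \<pi> a \<le> p}) =
      card {\<pi> \<in> low_start_132 P T k. \<pi> a \<le> p} + card {\<pi> \<in> low_start_132 P T k. \<not> \<pi> a \<le> p}"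
      by (rule card_Un_disjoint) (use finite_low_start_132[OF Suc.prems(1,2)] in auto)
    moreover have "{\<pi> \<in> low_start_132 P T k. \<pi> a \<le> p} \<union> {\<pi> \<in> low_start_132 P T k. \<not> \<pi> a \<le> p} = low_start_132 P T k"
      by blast
    ultimately show ?thesis by simp
  qed
  have down: "int (card {\<pi> \<in> low_start_132 P T k. \<not> \<pi> a \<le> p}) =
      walks n (int k - int (card T) + 1) - walks n (int k + int (card T) + 1)"
  proof (cases "T = {}")
    case True
    have "\<pi> a \<le> p" if "\<pi> \<in> low_start_132 P T k" for \<pi>
    proof -
      have "\<pi> \<in> involutions_on P" using that True by (auto simp: low_start_132_def)
      then have "\<pi> a \<in> P" using involutions_onD(3)[of \<pi> P a] aP by simp
      then show ?thesis by (rule ple)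
    qed
    then have empty: "{\<pi> \<in> low_start_132 P T k. \<not> \<pi> a \<le> p} = {}" by blast
    have "card {\<pi> \<in> low_start_132 P T k. \<not> \<pi> a \<le> p} = 0"
      using arg_cong[OF empty, of card] by (simp only: card.empty)
    then show ?thesis using True by simp
  next
    case False
    define t where "t = Min T"
    define T' where "T' = T - {t}"
    define P'' where "P'' = P - {a}"
    have t: "t \<in> T" unfolding t_def using Suc.prems(2) False by (rule Min_in)
    have tle: "t \<le> x" if "x \<in> T" for x unfolding t_def using Suc.prems(2) that by (rule Min_le)
    have P'': "finite P''" "card P'' = n" "P = insert a P''"
      using Suc.prems Suc(2) aP by (auto simp: P''_def)
    have T': "finite T'" "T = insert t T'" "int (card T') = int (card T) - 1"
      using Suc.prems t False by (auto simp: T'_def card_Diff_singleton Suc_leI card_gt_0_iff of_nat_diff)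
    have aless: "a < x" if "x \<in> P''" for x using that a(2)[of x] by (auto simp: P''_def S_def order.strict_iff_order)
    have Pless: "x < t" if "x \<in> P''" for x using that Suc.prems(3) t by (auto simp: P''_def)
    have tless: "t < x" if "x \<in> T'" for x using that tle[of x] by (auto simp: T'_def order.strict_iff_order)
    have at: "a < t" using Suc.prems(3) aP t by blast
    have "\<not> \<pi> a \<le> p \<longleftrightarrow> \<pi> a = t" if \<pi>: "\<pi> \<in> low_start_132 P T k" for \<pi>
    proof -
      have mem: "\<pi> a \<in> P \<union> T" and low: "\<pi> a \<le> t"
        using \<pi> involutions_onD(3)[of \<pi> S a] a(1) t
        unfolding low_start_132_def S_def[symmetric] a_def[symmetric] by blast+
      show ?thesis
      proof
        assume "\<not> \<pi> a \<le> p"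
        then have "\<pi> a \<in> T" using mem ple by blast
        then show "\<pi> a = t" using tle low by (blast intro: antisym)
      next
        assume "\<pi> a = t"
        then show "\<not> \<pi> a \<le> p" using Suc.prems(3) p t by (auto simp: not_le)
      qed
    qed
    then have "{\<pi> \<in> low_start_132 P T k. \<not> \<pi> a \<le> p} = {\<pi> \<in> low_start_132 P T k. \<pi> a = t}" by blast
    then have "card {\<pi> \<in> low_start_132 P T k. \<not> \<pi> a \<le> p} = card (low_start_132 P'' T' k)"
      using card_low_start_132_arc[OF P''(1) T'(1) aless Pless tless at, of k, folded P''(3) T'(2)] by simp
    also have "int \<dots> = walks (card P'') (int k - int (card T')) - walks (card P'') (int k + int (card T') + 2)"
      using P'' T'(1) Suc.prems(3) by (intro Suc.hyps(1)) (auto simp: T'_def)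
    finally show ?thesis using P''(2) T'(3) by (simp add: algebra_simps)
  qed
  have "card P = Suc n" using Suc(2) by simp
  then show ?case using split up upcard down by (simp add: algebra_simps)
qed

section \<open>Pattern-avoiding involutions by number of fixed points\<close>

lemma contains_pattern_3:
  "contains_pattern n \<pi> 3 \<sigma> \<longleftrightarrow>
     (\<exists>a\<in>{1..n}. \<exists>b\<in>{1..n}. \<exists>c\<in>{1..n}. a < b \<and> b < c \<and> (\<pi> a < \<pi> b \<longleftrightarrow> \<sigma> 1 < \<sigma> 2) \<and>
        (\<pi> a < \<pi> c \<longleftrightarrow> \<sigma> 1 < \<sigma> 3) \<and> (\<pi> b < \<pi> c \<longleftrightarrow> \<sigma> 2 < \<sigma> 3))"
proof -
  have three: "{1..3::nat} = {1, 2, 3}" by auto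
  show ?thesis
  proof
    assume "contains_pattern n \<pi> 3 \<sigma>"
    then obtain i :: "nat \<Rightarrow> nat" where i: "i ` {1..3} \<subseteq> {1..n}" "strict_mono_on {1..3} i"
      and o: "\<And>j l. j \<in> {1..3} \<Longrightarrow> l \<in> {1..3} \<Longrightarrow> j < l \<Longrightarrow> \<pi> (i j) < \<pi> (i l) \<longleftrightarrow> \<sigma> j < \<sigma> l"
      unfolding contains_pattern_def by blast
    have "i 1 < i 2" "i 2 < i 3" using strict_mono_onD[OF i(2)] by auto
    moreover have "i 1 \<in> {1..n}" "i 2 \<in> {1..n}" "i 3 \<in> {1..n}" using i(1) three by blast+
    ultimately show "\<exists>a\<in>{1..n}. \<exists>b\<in>{1..n}. \<exists>c\<in>{1..n}. a < b \<and> b < c \<and> (\<pi> a < \<pi> b \<longleftrightarrow> \<sigma> 1 < \<sigma> 2) \<and>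
        (\<pi> a < \<pi> c \<longleftrightarrow> \<sigma> 1 < \<sigma> 3) \<and> (\<pi> b < \<pi> c \<longleftrightarrow> \<sigma> 2 < \<sigma> 3)"
      using o[of 1 2] o[of 1 3] o[of 2 3] by (intro bexI[of _ "i 1"] bexI[of _ "i 2"] bexI[of _ "i 3"]) auto
  next
    assume "\<exists>a\<in>{1..n}. \<exists>b\<in>{1..n}. \<exists>c\<in>{1..n}. a < b \<and> b < c \<and> (\<pi> a < \<pi> b \<longleftrightarrow> \<sigma> 1 < \<sigma> 2) \<and>
        (\<pi> a < \<pi> c \<longleftrightarrow> \<sigma> 1 < \<sigma> 3) \<and> (\<pi> b < \<pi> c \<longleftrightarrow> \<sigma> 2 < \<sigma> 3)"
    then obtain a b c where abc: "a \<in> {1..n}" "b \<in> {1..n}" "c \<in> {1..n}" "a < b" "b < c"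
      "\<pi> a < \<pi> b \<longleftrightarrow> \<sigma> 1 < \<sigma> 2" "\<pi> a < \<pi> c \<longleftrightarrow> \<sigma> 1 < \<sigma> 3" "\<pi> b < \<pi> c \<longleftrightarrow> \<sigma> 2 < \<sigma> 3"
      by blast
    define i :: "nat \<Rightarrow> nat" where "i j = (if j = 1 then a else if j = 2 then b else c)" for j
    have ev: "i 1 = a" "i 2 = b" "i 3 = c" by (auto simp: i_def)
    have "i ` {1..3} \<subseteq> {1..n}" unfolding three using abc ev by auto
    moreover have "strict_mono_on {1..3} i"
      unfolding three strict_mono_on_def using abc ev by auto
    moreover have "\<forall>j\<in>{1..3}. \<forall>l\<in>{1..3}. j < l \<longrightarrow> (\<pi> (i j) < \<pi> (i l) \<longleftrightarrow> \<sigma> j < \<sigma> l)"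
      unfolding three using abc ev by auto
    ultimately show "contains_pattern n \<pi> 3 \<sigma>" unfolding contains_pattern_def by blast
  qed
qed

lemma one_line_values:
  "one_line [x, y, z] 1 = x" "one_line [x, y, z] 2 = y" "one_line [x, y, z] 3 = z"
  by (simp_all add: one_line_def)

text \<open>
  A nesting gives a decreasing triple consisting of the left end of the outer arc, the left end of
  the inner arc (or the fixed point) and the right end of the outer arc. Conversely, a decreasing
  triple contains two values in the wrong order on the same side of the diagonal, and for an
  involution these are nested arcs, the inner one possibly a fixed point.
\<close>

lemma avoiding_involutions_321:
  "avoiding_involutions n 3 (one_line [3, 2, 1]) = {\<pi> \<in> involutions_on {1..n}. nonnesting_on {1..n} \<pi>}"
proof -
  have "contains_pattern n \<pi> 3 (one_line [3, 2, 1]) \<longleftrightarrow> \<not> nonnesting_on {1..n} \<pi>"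
    if \<pi>: "\<pi> \<in> involutions_on {1..n}" for \<pi>
  proof
    note D = involutions_onD[OF \<pi>]
    assume "contains_pattern n \<pi> 3 (one_line [3, 2, 1])"
    then obtain a b c where abc: "a \<in> {1..n}" "b \<in> {1..n}" "c \<in> {1..n}" "a < b" "b < c"
      "\<pi> b \<le> \<pi> a" "\<pi> c \<le> \<pi> b"
      unfolding contains_pattern_3 one_line_values by (auto simp: not_less)
    then have less: "\<pi> b < \<pi> a" "\<pi> c < \<pi> b" using D(4)[of a b] D(4)[of b c] by auto
    show "\<not> nonnesting_on {1..n} \<pi>"
    proof (cases "b \<le> \<pi> b")
      case True
      then show ?thesis using abc less unfolding nonnesting_on_def by blast
    next
      case False
      \<comment> \<open>The other ends of the arcs at \<open>b\<close> and \<open>c\<close> form the nesting.\<close>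
      have "\<pi> c \<in> {1..n}" "\<pi> b \<in> {1..n}" using D(3) abc by blast+
      moreover have "\<pi> b \<le> \<pi> (\<pi> b)" "\<pi> (\<pi> b) < \<pi> (\<pi> c)" using D(1) False abc by auto
      ultimately show ?thesis using less(2) unfolding nonnesting_on_def by blast
    qed
  next
    note D = involutions_onD[OF \<pi>]
    assume "\<not> nonnesting_on {1..n} \<pi>"
    then obtain i j where ij: "i \<in> {1..n}" "j \<in> {1..n}" "i < j" "j \<le> \<pi> j" "\<pi> j < \<pi> i"
      unfolding nonnesting_on_def by blast
    have "\<pi> i \<in> {1..n}" using D(3) ij by blast
    moreover have "j < \<pi> i" "\<not> \<pi> i < \<pi> j" "\<not> \<pi> i < \<pi> (\<pi> i)" "\<not> \<pi> j < \<pi> (\<pi> i)"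
      using ij D(1)[of i] by auto
    ultimately show "contains_pattern n \<pi> 3 (one_line [3, 2, 1])"
      unfolding contains_pattern_3 one_line_values using ij
      by (intro bexI[of _ i] bexI[of _ j] bexI[of _ "\<pi> i"]) auto
  qed
  then show ?thesis unfolding avoiding_involutions_def involutions_on_def by blast
qed

lemma avoiding_involutions_132:
  "avoiding_involutions n 3 (one_line [1, 3, 2]) = {\<pi> \<in> involutions_on {1..n}. avoids_132_on {1..n} \<pi>}"
proof -
  have "contains_pattern n \<pi> 3 (one_line [1, 3, 2]) \<longleftrightarrow> \<not> avoids_132_on {1..n} \<pi>"
    if \<pi>: "\<pi> \<in> involutions_on {1..n}" for \<pi>
  proof -
    note D = involutions_onD[OF \<pi>]
    have "(\<pi> a < \<pi> b \<longleftrightarrow> (1::nat) < 3) \<and> (\<pi> a < \<pi> c \<longleftrightarrow> (1::nat) < 2) \<and> (\<pi> b < \<pi> c \<longleftrightarrow> (3::nat) < 2) \<longleftrightarrow>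
        \<pi> a < \<pi> c \<and> \<pi> c < \<pi> b" if "b < c" for a b c
      using D(4)[of b c] that by auto
    then show ?thesis unfolding contains_pattern_3 one_line_values avoids_132_on_def by blast
  qed
  then show ?thesis unfolding avoiding_involutions_def involutions_on_def by blast
qed

lemma avoiding_involutions_213:
  "avoiding_involutions n 3 (one_line [2, 1, 3]) =
    {\<pi> \<in> involutions_on {1..n}. \<not> (\<exists>a\<in>{1..n}. \<exists>b\<in>{1..n}. \<exists>c\<in>{1..n}. a < b \<and> b < c \<and> \<pi> b < \<pi> a \<and> \<pi> a < \<pi> c)}"
proof -
  have "contains_pattern n \<pi> 3 (one_line [2, 1, 3]) \<longleftrightarrow>
      (\<exists>a\<in>{1..n}. \<exists>b\<in>{1..n}. \<exists>c\<in>{1..n}. a < b \<and> b < c \<and> \<pi> b < \<pi> a \<and> \<pi> a < \<pi> c)"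
    if \<pi>: "\<pi> \<in> involutions_on {1..n}" for \<pi>
  proof -
    note D = involutions_onD[OF \<pi>]
    have "(\<pi> a < \<pi> b \<longleftrightarrow> (2::nat) < 1) \<and> (\<pi> a < \<pi> c \<longleftrightarrow> (2::nat) < 3) \<and> (\<pi> b < \<pi> c \<longleftrightarrow> (1::nat) < 3) \<longleftrightarrow>
        \<pi> b < \<pi> a \<and> \<pi> a < \<pi> c" if "a < b" for a b c
      using D(4)[of a b] that by auto
    then show ?thesis unfolding contains_pattern_3 one_line_values by blast
  qed
  then show ?thesis unfolding avoiding_involutions_def involutions_on_def by blast
qed

text \<open>
  Conjugation with this map reverses a permutation and complements its values. Outside \<open>{1..n}\<close> the
  map is the identity, so that conjugates again permute \<open>{1..n}\<close>.
\<close>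

definition reflect :: "nat \<Rightarrow> nat \<Rightarrow> nat" where
  "reflect n i = (if i \<in> {1..n} then n + 1 - i else i)"

lemma reflect:
  "reflect n (reflect n i) = i" "reflect n i \<in> {1..n} \<longleftrightarrow> i \<in> {1..n}"
  "i \<in> {1..n} \<Longrightarrow> j \<in> {1..n} \<Longrightarrow> reflect n i < reflect n j \<longleftrightarrow> j < i"
  by (auto simp: reflect_def)

lemma card_avoiding_213_eq_132:
  "card {\<pi> \<in> avoiding_involutions n 3 (one_line [2, 1, 3]). fp n \<pi> = k} =
   card {\<pi> \<in> avoiding_involutions n 3 (one_line [1, 3, 2]). fp n \<pi> = k}"
proof -
  let ?r = "reflect n"
  define conj where "conj \<pi> = (\<lambda>i. ?r (\<pi> (?r i)))" for \<pi> :: "nat \<Rightarrow> nat"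
  let ?A = "\<lambda>\<sigma>. {\<pi> \<in> avoiding_involutions n 3 \<sigma>. fp n \<pi> = k}"
  have inv: "conj \<pi> \<in> involutions_on {1..n}" if "\<pi> \<in> involutions_on {1..n}" for \<pi>
  proof (rule involutions_onI)
    note D = involutions_onD[OF that]
    show "conj \<pi> (conj \<pi> x) = x" for x unfolding conj_def by (simp add: reflect(1) D(1))
    fix x assume "x \<notin> {1..n}"
    then have "?r x = x" "\<pi> x = x" by (simp_all only: reflect_def if_False D(2) not_False_eq_True)
    then show "conj \<pi> x = x" by (simp only: conj_def)
  qed
  have fp: "fp n (conj \<pi>) = fp n \<pi>" for \<pi>
  proof -
    have "bij_betw ?r {i \<in> {1..n}. \<pi> i = i} {i \<in> {1..n}. conj \<pi> i = i}"
    proof (rule bij_betwI[where g = ?r])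
      show "?r \<in> {i \<in> {1..n}. \<pi> i = i} \<rightarrow> {i \<in> {1..n}. conj \<pi> i = i}"
        unfolding conj_def using reflect(2) by (auto simp: reflect(1))
      show "?r \<in> {i \<in> {1..n}. conj \<pi> i = i} \<rightarrow> {i \<in> {1..n}. \<pi> i = i}"
        unfolding conj_def using reflect by (auto simp: Pi_iff) (metis reflect(1,2) atLeastAtMost_iff)+
    qed (simp_all add: reflect(1))
    then show ?thesis unfolding fp_def by (rule bij_betw_same_card[symmetric])
  qed
  have cc: "conj (conj \<pi>) = \<pi>" for \<pi> by (auto simp: conj_def reflect(1))
  have pat: "conj \<pi> \<in> avoiding_involutions n 3 (one_line [1, 3, 2])"
    if "\<pi> \<in> avoiding_involutions n 3 (one_line [2, 1, 3])" for \<pi>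
  proof -
    have \<pi>: "\<pi> \<in> involutions_on {1..n}"
      and av: "\<not> (\<exists>a\<in>{1..n}. \<exists>b\<in>{1..n}. \<exists>c\<in>{1..n}. a < b \<and> b < c \<and> \<pi> b < \<pi> a \<and> \<pi> a < \<pi> c)"
      using that unfolding avoiding_involutions_213 by blast+
    note D = involutions_onD(3)[OF \<pi>]
    have "avoids_132_on {1..n} (conj \<pi>)" unfolding avoids_132_on_def
    proof (intro ballI impI notI; elim conjE)
      fix i j l assume S: "i \<in> {1..n}" "j \<in> {1..n}" "l \<in> {1..n}"
        and o: "i < j" "j < l" "conj \<pi> i < conj \<pi> l" "conj \<pi> l < conj \<pi> j"
      have S': "?r i \<in> {1..n}" "?r j \<in> {1..n}" "?r l \<in> {1..n}" using S reflect(2) by blast+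
      have P: "\<pi> (?r i) \<in> {1..n}" "\<pi> (?r j) \<in> {1..n}" "\<pi> (?r l) \<in> {1..n}" using S' D by blast+
      have "?r l < ?r j" "?r j < ?r i" using o(1,2) S reflect(3) by blast+
      moreover have "\<pi> (?r j) < \<pi> (?r l)" "\<pi> (?r l) < \<pi> (?r i)"
        using o(3,4) P reflect(3) unfolding conj_def by blast+
      ultimately show False using av S' by blast
    qed
    then show ?thesis unfolding avoiding_involutions_132 using inv[OF \<pi>] by blast
  qed
  have pat': "conj \<pi> \<in> avoiding_involutions n 3 (one_line [2, 1, 3])"
    if "\<pi> \<in> avoiding_involutions n 3 (one_line [1, 3, 2])" for \<pi>
  proof -
    have \<pi>: "\<pi> \<in> involutions_on {1..n}" and av: "avoids_132_on {1..n} \<pi>"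
      using that unfolding avoiding_involutions_132 by blast+
    note D = involutions_onD(3)[OF \<pi>]
    have "\<not> (\<exists>a\<in>{1..n}. \<exists>b\<in>{1..n}. \<exists>c\<in>{1..n}. a < b \<and> b < c \<and> conj \<pi> b < conj \<pi> a \<and> conj \<pi> a < conj \<pi> c)"
    proof (intro notI; elim bexE conjE)
      fix i j l assume S: "i \<in> {1..n}" "j \<in> {1..n}" "l \<in> {1..n}"
        and o: "i < j" "j < l" "conj \<pi> j < conj \<pi> i" "conj \<pi> i < conj \<pi> l"
      have S': "?r i \<in> {1..n}" "?r j \<in> {1..n}" "?r l \<in> {1..n}" using S reflect(2) by blast+
      have P: "\<pi> (?r i) \<in> {1..n}" "\<pi> (?r j) \<in> {1..n}" "\<pi> (?r l) \<in> {1..n}" using S' D by blast+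
      have "?r l < ?r j" "?r j < ?r i" using o(1,2) S reflect(3) by blast+
      moreover have "\<pi> (?r l) < \<pi> (?r i)" "\<pi> (?r i) < \<pi> (?r j)"
        using o(3,4) P reflect(3) unfolding conj_def by blast+
      ultimately show False using avoids_132_onD[OF av S'(3,2,1)] by blast
    qed
    then show ?thesis unfolding avoiding_involutions_213 using inv[OF \<pi>] by blast
  qed
  have "bij_betw conj (?A (one_line [2, 1, 3])) (?A (one_line [1, 3, 2]))"
  proof (rule bij_betwI[where g = conj])
    show "conj \<in> ?A (one_line [2, 1, 3]) \<rightarrow> ?A (one_line [1, 3, 2])" using pat fp by blast
    show "conj \<in> ?A (one_line [1, 3, 2]) \<rightarrow> ?A (one_line [2, 1, 3])" using pat' fp by blast
  qed (rule cc)+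
  then show ?thesis by (rule bij_betw_same_card)
qed

theorem card_avoiding_involutions_fp:
  assumes "\<sigma> \<in> {one_line [3,2,1], one_line [1,3,2], one_line [2,1,3]}"
  shows "int (card {\<pi> \<in> avoiding_involutions n 3 \<sigma>. fp n \<pi> = k}) = walks n (int k) - walks n (int k + 2)"
proof -
  have "{\<pi> \<in> avoiding_involutions n 3 (one_line [3,2,1]). fp n \<pi> = k} = open_nonnesting {1..n} {} k"
    unfolding avoiding_involutions_321 open_nonnesting_def fp_def num_fixed_def by auto
  then have A: "int (card {\<pi> \<in> avoiding_involutions n 3 (one_line [3,2,1]). fp n \<pi> = k}) =
      walks n (int k) - walks n (int k + 2)"
    using card_open_nonnesting[of "{1..n}" "{}" k] by simp
  have "{\<pi> \<in> avoiding_involutions n 3 (one_line [1,3,2]). fp n \<pi> = k} = low_start_132 {1..n} {} k"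
    unfolding avoiding_involutions_132 low_start_132_def fp_def num_fixed_def by auto
  then have B: "int (card {\<pi> \<in> avoiding_involutions n 3 (one_line [1,3,2]). fp n \<pi> = k}) =
      walks n (int k) - walks n (int k + 2)"
    using card_low_start_132[of "{1..n}" "{}" k] by simp
  show ?thesis using assms A B card_avoiding_213_eq_132[of n k] by auto
qed

text \<open>
  The ballot number. The index is the number \<open>j\<close> of two-cycles, so that the number of fixed points is
  \<open>n - 2 * j\<close>.
\<close>

definition fp_count :: "nat \<Rightarrow> nat \<Rightarrow> real" where
  "fp_count n j = real (n choose j) - (if j = 0 then 0 else real (n choose (j - 1)))"

text \<open>
  The number of fixed points has the parity of \<open>n\<close>, hence is of the form \<open>n - 2 * j\<close>.
\<close>

lemma sum_avoiding_involutions_by_fp: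
  fixes g :: "nat \<Rightarrow> real"
  assumes "\<sigma> \<in> {one_line [3,2,1], one_line [1,3,2], one_line [2,1,3]}"
  shows "(\<Sum>\<pi>\<in>avoiding_involutions n 3 \<sigma>. g (fp n \<pi>)) =
    (\<Sum>j\<le>n div 2. fp_count n j * g (n - 2 * j))"
proof -
  let ?A = "avoiding_involutions n 3 \<sigma>"
  have fin: "finite ?A" by (rule finite_avoiding_involutions)
  have le: "fp n \<pi> \<le> n" for \<pi>
    unfolding fp_def using card_mono[of "{1..n}" "{i \<in> {1..n}. \<pi> i = i}", OF _ Collect_restrict] by simp
  have cnt: "real (card {\<pi> \<in> ?A. fp n \<pi> = k}) = real_of_int (walks n (int k) - walks n (int k + 2))" for k
    using arg_cong[OF card_avoiding_involutions_fp[OF assms, of n k], of real_of_int]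
    by (simp only: of_int_of_nat_eq)
  have "(\<Sum>\<pi>\<in>?A. g (fp n \<pi>)) = (\<Sum>k\<le>n. \<Sum>\<pi>\<in>{\<pi> \<in> ?A. fp n \<pi> = k}. g (fp n \<pi>))"
    by (rule sum.group[symmetric]) (use fin le in auto)
  also have "\<dots> = (\<Sum>k\<le>n. real_of_int (walks n (int k) - walks n (int k + 2)) * g k)"
  proof (intro sum.cong refl)
    fix k
    have "(\<Sum>\<pi>\<in>{\<pi> \<in> ?A. fp n \<pi> = k}. g (fp n \<pi>)) = (\<Sum>\<pi>\<in>{\<pi> \<in> ?A. fp n \<pi> = k}. g k)"
      by (rule sum.cong) auto
    also have "\<dots> = real (card {\<pi> \<in> ?A. fp n \<pi> = k}) * g k" by (rule sum_constant)
    finally show "(\<Sum>\<pi>\<in>{\<pi> \<in> ?A. fp n \<pi> = k}. g (fp n \<pi>)) =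
        real_of_int (walks n (int k) - walks n (int k + 2)) * g k" unfolding cnt .
  qed
  also have "\<dots> = (\<Sum>k\<in>{k. k \<le> n \<and> even (n - k)}. real_of_int (walks n (int k) - walks n (int k + 2)) * g k)"
  proof (rule sum.mono_neutral_right)
    show "\<forall>i\<in>{..n} - {k. k \<le> n \<and> even (n - k)}. real_of_int (walks n (int i) - walks n (int i + 2)) * g i = 0"
      using walks_odd_eq_0 by auto
  qed auto
  also have "\<dots> = (\<Sum>j\<le>n div 2. fp_count n j * g (n - 2 * j))"
  proof (rule sum.reindex_bij_witness[where i = "\<lambda>j. n - 2 * j" and j = "\<lambda>k. (n - k) div 2"])
    fix k assume "k \<in> {k. k \<le> n \<and> even (n - k)}"
    then have k: "k \<le> n" "even (n - k)" by auto
    then show "n - 2 * ((n - k) div 2) = k" "(n - k) div 2 \<in> {..n div 2}" by auto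
    define j where "j = (n - k) div 2"
    have jk: "int k = int n - 2 * int j"
    proof -
      obtain d where "n - k = 2 * d" using k(2) by (elim evenE)
      then show ?thesis using k(1) unfolding j_def by simp
    qed
    have "walks n (int k + 2) = (if j = 0 then 0 else int (n choose (j - 1)))"
    proof (cases j)
      case 0
      then show ?thesis using jk by (simp add: walks_beyond_eq_0)
    next
      case (Suc i)
      then have "int k + 2 = int n - 2 * int i" using jk by simp
      then show ?thesis using walks_eq_binomial Suc by simp
    qed
    then have "real_of_int (walks n (int k) - walks n (int k + 2)) = fp_count n j"
      unfolding fp_count_def jk walks_eq_binomial by (auto simp flip: jk)
    then show "fp_count n ((n - k) div 2) * g (n - 2 * ((n - k) div 2)) =
        real_of_int (walks n (int k) - walks n (int k + 2)) * g k"
      using \<open>n - 2 * ((n - k) div 2) = k\<close> by (simp add: j_def)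
  qed auto
  finally show ?thesis .
qed

section \<open>Binomial coefficients near the centre\<close>

lemma binomial_ratio_prod:
  assumes "i \<le> m" "m \<le> n"
  shows "real (n choose (m - i)) = real (n choose m) * (\<Prod>l<i. real (m - l) / real (n - m + l + 1))"
  using assms(1)
proof (induction i)
  case (Suc i)
  define j where "j = m - Suc i"
  have j: "m - i = Suc j" "n - j = n - m + i + 1" using Suc.prems assms(2) by (auto simp: j_def)
  have "Suc j * (n choose Suc j) = (n choose j) * (n - j)"
    using binomial_absorb_comp[of n j] binomial_absorption[of j n] by (simp add: mult.commute)
  then have "real (Suc j) * real (n choose Suc j) = real (n choose j) * real (n - j)"
    by (metis of_nat_mult)
  moreover have "real (n - j) > 0" using j(2) by simp
  ultimately have calc: "real (n choose j) = real (n choose Suc j) * (real (Suc j) / real (n - j))"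
    by (simp add: field_simps)
  have step: "real (n choose (m - Suc i)) = real (n choose (m - i)) * (real (m - i) / real (n - m + i + 1))"
    using calc[unfolded j(2), folded j(1)] by (simp only: j_def)
  have IH: "real (n choose (m - i)) = real (n choose m) * (\<Prod>l<i. real (m - l) / real (n - m + l + 1))"
    using Suc by simp
  show ?case by (simp only: step IH prod.lessThan_Suc mult.assoc)
qed simp

lemma sum_odd_shift: "(\<Sum>l<i. d + 2 * real l + 1) = (real i)\<^sup>2 + d * real i"
  by (induction i) (auto simp: power2_eq_square algebra_simps)

text \<open>
  Each factor of the product equals \<open>1 - (d + 2 * l + 1) / N\<close> with \<open>d = n - 2 * m\<close> and
  \<open>N = n - m + l + 1 \<le> n - m + i\<close>; the bound \<open>1 + u \<le> exp u\<close> turns the product into the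
  exponential of a sum of odd numbers. The reciprocals of the factors give the matching lower bound.
\<close>

lemma binomial_ratio_upper:
  assumes "i \<le> m" "2 * m \<le> n" "n > 0"
  shows "real (n choose (m - i)) \<le>
    real (n choose m) * exp (- (((real i)\<^sup>2 + real (n - 2 * m) * real i) / real (n - m + i)))"
proof -
  let ?d = "real (n - 2 * m)" and ?D = "real (n - m + i)"
  have D: "?D > 0" using assms by simp
  have "(\<Prod>l<i. real (m - l) / real (n - m + l + 1)) \<le> (\<Prod>l<i. exp (- ((?d + 2 * real l + 1) / ?D)))"
  proof (intro prod_mono conjI)
    fix l assume "l \<in> {..<i}"
    then have l: "l < i" by simp
    let ?N = "real (n - m + l + 1)"
    have eq: "real (m - l) = ?N - (?d + 2 * real l + 1)" using l assms by (simp add: of_nat_diff)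
    have N0: "?N \<noteq> 0" by simp
    have "real (m - l) / ?N = 1 + - ((?d + 2 * real l + 1) / ?N)"
      unfolding eq diff_divide_distrib[of ?N] divide_self[OF N0] by simp
    also have "\<dots> \<le> exp (- ((?d + 2 * real l + 1) / ?N))" by (rule exp_ge_add_one_self)
    also have "\<dots> \<le> exp (- ((?d + 2 * real l + 1) / ?D))"
      using l assms D by (simp add: frac_le)
    finally show "real (m - l) / ?N \<le> exp (- ((?d + 2 * real l + 1) / ?D))" .
  qed simp
  also have "\<dots> = exp (- ((\<Sum>l<i. ?d + 2 * real l + 1) / ?D))"
    by (simp only: exp_sum[OF finite_lessThan, symmetric] sum_negf sum_divide_distrib)
  finally have *: "(\<Prod>l<i. real (m - l) / real (n - m + l + 1)) \<le>
      exp (- (((real i)\<^sup>2 + ?d * real i) / ?D))" by (simp only: sum_odd_shift)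
  have "m \<le> n" using assms by simp
  then show ?thesis using binomial_ratio_prod[OF assms(1)] mult_left_mono[OF *, of "real (n choose m)"] by simp
qed

lemma binomial_ratio_lower:
  assumes "i < m" "2 * m \<le> n"
  shows "real (n choose (m - i)) \<ge>
    real (n choose m) * exp (- (((real i)\<^sup>2 + real (n - 2 * m) * real i) / real (m - i)))"
proof -
  let ?d = "real (n - 2 * m)" and ?D = "real (m - i)"
  have D: "?D > 0" using assms by simp
  have "(\<Prod>l<i. exp (- ((?d + 2 * real l + 1) / ?D))) \<le> (\<Prod>l<i. real (m - l) / real (n - m + l + 1))"
  proof (intro prod_mono conjI)
    fix l assume "l \<in> {..<i}"
    then have l: "l < i" by simp
    let ?N = "real (n - m + l + 1)" and ?K = "real (m - l)"
    have K: "?K > 0" using l assms by simp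
    have eq: "?N = ?K + (?d + 2 * real l + 1)" using l assms by (simp add: of_nat_diff)
    have K0: "?K \<noteq> 0" using K by simp
    have "?N / ?K = 1 + (?d + 2 * real l + 1) / ?K"
      unfolding eq add_divide_distrib[of ?K] divide_self[OF K0] by (rule refl)
    also have "\<dots> \<le> exp ((?d + 2 * real l + 1) / ?K)" by (rule exp_ge_add_one_self)
    also have "\<dots> \<le> exp ((?d + 2 * real l + 1) / ?D)"
      using l assms D by (simp add: frac_le)
    finally have "inverse (exp ((?d + 2 * real l + 1) / ?D)) \<le> inverse (?N / ?K)"
      using K by (intro le_imp_inverse_le) auto
    then show "exp (- ((?d + 2 * real l + 1) / ?D)) \<le> ?K / ?N" by (simp add: exp_minus)
  qed simp
  moreover have "(\<Prod>l<i. exp (- ((?d + 2 * real l + 1) / ?D))) = exp (- ((\<Sum>l<i. ?d + 2 * real l + 1) / ?D))"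
    by (simp only: exp_sum[OF finite_lessThan, symmetric] sum_negf sum_divide_distrib)
  ultimately have *: "exp (- (((real i)\<^sup>2 + ?d * real i) / ?D)) \<le>
      (\<Prod>l<i. real (m - l) / real (n - m + l + 1))" by (simp only: sum_odd_shift)
  have "i \<le> m" "m \<le> n" using assms by simp_all
  then show ?thesis using binomial_ratio_prod mult_left_mono[OF *, of "real (n choose m)"] by simp
qed

text \<open>
  For \<open>i\<close> of order \<open>sqrt n\<close> and \<open>m = n div 2\<close>, both bounds have an exponent equivalent to
  \<open>i\<^sup>2 / (n / 2)\<close>.
\<close>

lemma binomial_local_limit:
  fixes i :: "nat \<Rightarrow> nat"
  assumes lim: "(\<lambda>n. real (i n) / sqrt (real n)) \<longlonglongrightarrow> y"
  shows "(\<lambda>n. real (n choose (n div 2 - i n)) / real (n choose (n div 2))) \<longlonglongrightarrow> exp (- (2 * y\<^sup>2))"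
proof -
  have sq: "(\<lambda>n. (real (i n))\<^sup>2 / real n) \<longlonglongrightarrow> y\<^sup>2"
    using tendsto_power[OF lim, of 2] by (simp add: power_divide)
  have inv: "(\<lambda>n. 1 / sqrt (real n)) \<longlonglongrightarrow> 0" by real_asymp
  have "(\<lambda>n. real (i n) / sqrt (real n) * (1 / sqrt (real n))) \<longlonglongrightarrow> y * 0"
    by (intro tendsto_mult lim inv)
  then have lin: "(\<lambda>n. real (i n) / real n) \<longlonglongrightarrow> 0"
    by (simp add: real_sqrt_mult[symmetric] flip: power2_eq_square)
  have half: "(\<lambda>n. real (n div 2) / real n) \<longlonglongrightarrow> 1/2"
  proof (rule real_tendsto_sandwich)
    have div2: "real n - 1 \<le> 2 * real (n div 2)" "2 * real (n div 2) \<le> real n" for n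
    proof -
      have "n \<le> 2 * (n div 2) + 1" "2 * (n div 2) \<le> n" by presburger+
      then have "real n \<le> real (2 * (n div 2) + 1)" "real (2 * (n div 2)) \<le> real n"
        by (simp_all only: of_nat_le_iff)
      then show "real n - 1 \<le> 2 * real (n div 2)" "2 * real (n div 2) \<le> real n" by simp_all
    qed
    show "\<forall>\<^sub>F n in sequentially. (real n - 1) / 2 / real n \<le> real (n div 2) / real n"
      using div2 by (intro always_eventually allI divide_right_mono) (simp_all add: field_simps)
    show "\<forall>\<^sub>F n in sequentially. real (n div 2) / real n \<le> (real n) / 2 / real n"
      using div2 by (intro always_eventually allI divide_right_mono) (simp_all add: field_simps)
    show "(\<lambda>n. (real n - 1) / 2 / real n) \<longlonglongrightarrow> 1/2" by real_asymp
    show "(\<lambda>n. real n / 2 / real n) \<longlonglongrightarrow> 1/2" by real_asymp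
  qed
  have "(\<lambda>n. real (n div 2) / real n - real (i n) / real n) \<longlonglongrightarrow> 1/2 - 0"
    by (intro tendsto_diff half lin)
  then have "eventually (\<lambda>n. real (n div 2) / real n - real (i n) / real n > 0) sequentially"
    by (rule order_tendstoD) simp
  then have ev: "eventually (\<lambda>n. i n < n div 2) sequentially"
  proof eventually_elim
    case (elim n)
    then have "n > 0" by (cases n) auto
    then show ?case using elim by (simp add: divide_less_cancel split: if_splits)
  qed
  let ?d = "\<lambda>n. real (n - 2 * (n div 2))"
  let ?e = "\<lambda>n. (real (i n))\<^sup>2 + ?d n * real (i n)"
  \<comment> \<open>The parity correction \<open>n - 2 * (n div 2)\<close> is \<open>0\<close> or \<open>1\<close> and does not affect the limit.\<close>
  have dlin: "(\<lambda>n. ?d n * (real (i n) / real n)) \<longlonglongrightarrow> 0"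
  proof (rule real_tendsto_sandwich[OF _ _ tendsto_const lin])
    have d: "?d n \<in> {0, 1}" for n by (auto simp: minus_mult_div_eq_mod mult.commute) 
    then show "\<forall>\<^sub>F n in sequentially. 0 \<le> ?d n * (real (i n) / real n)"
      by (intro always_eventually allI) simp
    show "\<forall>\<^sub>F n in sequentially. ?d n * (real (i n) / real n) \<le> real (i n) / real n"
      using d by (intro always_eventually allI) (metis insert_iff singletonD mult_zero_left mult_1 divide_nonneg_nonneg of_nat_0_le_iff order_refl)
  qed
  have num: "(\<lambda>n. ?e n / real n) \<longlonglongrightarrow> y\<^sup>2"
    using tendsto_add[OF sq dlin] by (simp add: add_divide_distrib)
  have "(\<lambda>n. (?e n / real n) / (1 - real (n div 2) / real n + real (i n) / real n)) \<longlonglongrightarrow> y\<^sup>2 / (1 - 1/2 + 0)"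
    by (intro tendsto_intros num half lin) simp
  moreover have "\<forall>\<^sub>F n in sequentially. (?e n / real n) / (1 - real (n div 2) / real n + real (i n) / real n) =
      ?e n / real (n - n div 2 + i n)"
    using eventually_gt_at_top[of 0]
  proof eventually_elim
    case (elim n)
    have "1 - real (n div 2) / real n + real (i n) / real n = real (n - n div 2 + i n) / real n"
      using elim by (simp add: of_nat_diff field_simps)
    then show ?case using elim by simp
  qed
  ultimately have up: "(\<lambda>n. ?e n / real (n - n div 2 + i n)) \<longlonglongrightarrow> 2 * y\<^sup>2"
    by (subst (asm) tendsto_cong) (auto simp: mult.commute)
  have "(\<lambda>n. (?e n / real n) / (real (n div 2) / real n - real (i n) / real n)) \<longlonglongrightarrow> y\<^sup>2 / (1/2 - 0)"
    by (intro tendsto_intros num half lin) simp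
  moreover have "\<forall>\<^sub>F n in sequentially. (?e n / real n) / (real (n div 2) / real n - real (i n) / real n) =
      ?e n / real (n div 2 - i n)"
    using ev
  proof eventually_elim
    case (elim n)
    have "real (n div 2) / real n - real (i n) / real n = real (n div 2 - i n) / real n"
      using elim by (simp add: of_nat_diff diff_divide_distrib)
    moreover have "n > 0" using elim by (cases n) auto
    ultimately show ?case by simp
  qed
  ultimately have low: "(\<lambda>n. ?e n / real (n div 2 - i n)) \<longlonglongrightarrow> 2 * y\<^sup>2"
    by (subst (asm) tendsto_cong) (auto simp: mult.commute)
  show "(\<lambda>n. real (n choose (n div 2 - i n)) / real (n choose (n div 2))) \<longlonglongrightarrow> exp (- (2 * y\<^sup>2))"
  proof (rule real_tendsto_sandwich)
    show "(\<lambda>n. exp (- (?e n / real (n div 2 - i n)))) \<longlonglongrightarrow> exp (- (2 * y\<^sup>2))"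
      by (intro tendsto_intros low)
    show "(\<lambda>n. exp (- (?e n / real (n - n div 2 + i n)))) \<longlonglongrightarrow> exp (- (2 * y\<^sup>2))"
      by (intro tendsto_intros up)
    show "\<forall>\<^sub>F n in sequentially. exp (- (?e n / real (n div 2 - i n))) \<le>
        real (n choose (n div 2 - i n)) / real (n choose (n div 2))"
      using ev
    proof eventually_elim
      case (elim n)
      have "real (n choose (n div 2)) > 0" by simp
      then show ?case using binomial_ratio_lower[OF elim, of n] by (simp add: pos_le_divide_eq mult.commute)
    qed
    show "\<forall>\<^sub>F n in sequentially. real (n choose (n div 2 - i n)) / real (n choose (n div 2)) \<le>
        exp (- (?e n / real (n - n div 2 + i n)))"
      using ev
    proof eventually_elim
      case (elim n)
      have "n > 0" using elim by (cases n) auto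
      moreover have "real (n choose (n div 2)) > 0" by simp
      ultimately show ?case using binomial_ratio_upper[of "i n" "n div 2" n] elim
        by (simp add: pos_divide_le_eq mult.commute)
    qed
  qed
qed

section \<open>The eigenvalue gap of the trace-zero ensemble\<close>

text \<open>
  Writing \<open>exp (- (norm v)\<^sup>2)\<close> as the integral of \<open>exp (- s)\<close> over \<open>s \<ge> (norm v)\<^sup>2\<close> and exchanging
  the integrals replaces polar coordinates by the area of an annulus.
\<close>

lemma nn_integral_gaussian_outside_disc:
  assumes "r \<ge> 0"
  shows "(\<integral>\<^sup>+v. ennreal (exp (- (norm v)\<^sup>2)) * indicator {v::real \<times> real. r < norm v} v \<partial>lborel) =
    ennreal (pi * exp (- r\<^sup>2))"
proof -
  have layer: "ennreal (exp (- a)) = (\<integral>\<^sup>+s. ennreal (exp (- s)) * indicator {a..} s \<partial>lborel)" for a :: real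
  proof -
    have "(\<integral>\<^sup>+s. ennreal (exp (- s)) * indicator {a..} s \<partial>lborel) = ennreal (0 - - exp (- a))"
    proof (rule nn_integral_FTC_atLeast)
      show "((\<lambda>s. - exp (- s)) has_real_derivative exp (- x)) (at x)" for x :: real
        by (auto intro!: derivative_eq_intros)
      show "((\<lambda>s::real. - exp (- s)) \<longlongrightarrow> 0) at_top" by real_asymp
    qed auto
    then show ?thesis by simp
  qed
  have annulus: "emeasure lborel {v::real \<times> real. r < norm v \<and> (norm v)\<^sup>2 \<le> s} = ennreal (pi * (s - r\<^sup>2))"
    if "r\<^sup>2 \<le> s" for s
  proof -
    have s: "0 \<le> s" "r \<le> sqrt s" using that assms real_le_rsqrt by (auto intro: order_trans[OF zero_le_power2])
    have "(norm v)\<^sup>2 \<le> s \<longleftrightarrow> norm v \<le> sqrt s" for v :: "real \<times> real"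
      using s by (metis real_sqrt_le_iff real_sqrt_abs abs_norm_cancel)
    then have "{v::real \<times> real. r < norm v \<and> (norm v)\<^sup>2 \<le> s} = cball 0 (sqrt s) - cball 0 r"
      by (intro set_eqI) (simp add: not_le conj_commute)
    also have "emeasure lborel \<dots> = emeasure lborel (cball (0::real \<times> real) (sqrt s)) - emeasure lborel (cball (0::real \<times> real) r)"
      using s by (intro emeasure_Diff) (auto simp: emeasure_cball assms)
    also have "\<dots> = ennreal (pi * s) - ennreal (pi * r\<^sup>2)"
      using s assms by (simp add: emeasure_cball unit_ball_vol_numeral power2_eq_square)
    also have "\<dots> = ennreal (pi * (s - r\<^sup>2))"
      by (subst ennreal_minus) (auto simp: algebra_simps)
    finally show ?thesis .
  qed
  have "(\<integral>\<^sup>+v. ennreal (exp (- (norm v)\<^sup>2)) * indicator {v::real \<times> real. r < norm v} v \<partial>lborel) =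
      (\<integral>\<^sup>+v. \<integral>\<^sup>+s. ennreal (exp (- s)) * indicator {(v::real \<times> real, s). r < norm v \<and> (norm v)\<^sup>2 \<le> s} (v, s) \<partial>lborel \<partial>lborel)"
  proof (intro nn_integral_cong)
    fix v :: "real \<times> real"
    show "ennreal (exp (- (norm v)\<^sup>2)) * indicator {v. r < norm v} v =
      (\<integral>\<^sup>+s. ennreal (exp (- s)) * indicator {(v, s). r < norm v \<and> (norm v)\<^sup>2 \<le> s} (v, s) \<partial>lborel)"
      by (cases "r < norm v") (simp_all add: layer[of "(norm v)\<^sup>2"] indicator_def)
  qed
  also have "\<dots> = (\<integral>\<^sup>+s. \<integral>\<^sup>+v. ennreal (exp (- s)) * indicator {(v::real \<times> real, s). r < norm v \<and> (norm v)\<^sup>2 \<le> s} (v, s) \<partial>lborel \<partial>lborel)"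
    by (rule lborel_pair.Fubini') measurable
  also have "\<dots> = (\<integral>\<^sup>+s. ennreal (pi * (s - r\<^sup>2) * exp (- s)) * indicator {r\<^sup>2..} s \<partial>lborel)"
  proof (intro nn_integral_cong)
    fix s :: real
    have "(\<integral>\<^sup>+v. ennreal (exp (- s)) * indicator {(v::real \<times> real, s). r < norm v \<and> (norm v)\<^sup>2 \<le> s} (v, s) \<partial>lborel) =
      (\<integral>\<^sup>+v. ennreal (exp (- s)) * indicator {v::real \<times> real. r < norm v \<and> (norm v)\<^sup>2 \<le> s} v \<partial>lborel)"
      by (intro nn_integral_cong) (auto simp: indicator_def)
    also have "\<dots> = ennreal (exp (- s)) * emeasure lborel {v::real \<times> real. r < norm v \<and> (norm v)\<^sup>2 \<le> s}"
      by (rule nn_integral_cmult_indicator) measurable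
    also have "\<dots> = ennreal (pi * (s - r\<^sup>2) * exp (- s)) * indicator {r\<^sup>2..} s"
    proof (cases "r\<^sup>2 \<le> s")
      case True
      then show ?thesis by (simp add: annulus ennreal_mult'[symmetric] mult_ac)
    next
      case False
      have empty: "{v::real \<times> real. r < norm v \<and> (norm v)\<^sup>2 \<le> s} = {}"
        using False power_mono[OF _ assms, of _ 2] by (auto dest!: less_imp_le intro: order_trans)
      show ?thesis unfolding empty using False by simp
    qed
    finally show "(\<integral>\<^sup>+v. ennreal (exp (- s)) * indicator {(v::real \<times> real, s). r < norm v \<and> (norm v)\<^sup>2 \<le> s} (v, s) \<partial>lborel) =
      ennreal (pi * (s - r\<^sup>2) * exp (- s)) * indicator {r\<^sup>2..} s" .
  qed
  also have "\<dots> = ennreal (0 - - (pi * (r\<^sup>2 - r\<^sup>2 + 1) * exp (- r\<^sup>2)))"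
  proof (rule nn_integral_FTC_atLeast[where F = "\<lambda>s. - (pi * (s - r\<^sup>2 + 1) * exp (- s))"])
    show "((\<lambda>s. - (pi * (s - r\<^sup>2 + 1) * exp (- s))) has_real_derivative pi * (x - r\<^sup>2) * exp (- x)) (at x)" for x :: real
      by (auto intro!: derivative_eq_intros simp: algebra_simps)
    show "((\<lambda>s::real. - (pi * (s - r\<^sup>2 + 1) * exp (- s))) \<longlongrightarrow> 0) at_top" by real_asymp
  qed auto
  finally show ?thesis by simp
qed

lemma eigenvalues_2x2: "eigenvalues (A :: real^2^2) = {c. c\<^sup>2 - trace A * c + det A = 0}"
proof -
  have "c \<in> eigenvalues A \<longleftrightarrow> c\<^sup>2 - trace A * c + det A = 0" for c
  proof -
    have "c \<in> eigenvalues A \<longleftrightarrow> (\<exists>v. v \<noteq> 0 \<and> (A - mat c) *v v = 0)"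
      by (simp add: eigenvalues_def vec_eq_iff forall_2 matrix_vector_mult_def mat_def sum_2
          left_diff_distrib diff_add_eq add_diff_eq)
    also have "\<dots> \<longleftrightarrow> \<not> invertible (A - mat c)"
      by (metis invertible_left_inverse matrix_left_invertible_ker)
    also have "\<dots> \<longleftrightarrow> det (A - mat c) = 0"
      by (simp add: invertible_det_nz)
    also have "det (A - mat c) = c\<^sup>2 - trace A * c + det A"
      by (simp add: det_2 mat_def trace_def sum_2 power2_eq_square algebra_simps)
    finally show ?thesis .
  qed
  then show ?thesis by blast
qed

text \<open>
  The discriminant of the characteristic polynomial decides. For a negative discriminant there is no
  real eigenvalue, and \<open>Max {} - Min {}\<close> is some constant; the formula is needed on all matrices to show
  that the gap is measurable.
\<close>

lemma eigenvalue_gap_2x2: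
  "eigenvalue_gap A = (if (trace A)\<^sup>2 - 4 * det A < 0 then Max {} - Min {} else sqrt ((trace A)\<^sup>2 - 4 * det A))"
proof -
  define D where "D = (trace A)\<^sup>2 - 4 * det A"
  have root: "c \<in> eigenvalues A \<longleftrightarrow> (2 * c - trace A)\<^sup>2 = D" for c
    unfolding eigenvalues_2x2 D_def by (auto simp: power2_eq_square algebra_simps)
  show ?thesis
  proof (cases "D < 0")
    case True
    then have "eigenvalues A = {}" using root by (metis all_not_in_conv not_less zero_le_power2)
    then show ?thesis using True by (simp add: eigenvalue_gap_def D_def)
  next
    case False
    have "eigenvalues A = {(trace A + sqrt D) / 2, (trace A - sqrt D) / 2}"
    proof -
      have "(2 * c - trace A)\<^sup>2 = D \<longleftrightarrow> 2 * c - trace A = sqrt D \<or> 2 * c - trace A = - sqrt D" for c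
        using False by (metis linorder_not_less power2_eq_iff real_sqrt_pow2)
      moreover have "2 * c - trace A = s \<longleftrightarrow> c = (trace A + s) / 2" for c s :: real by (auto simp: field_simps)
      ultimately show ?thesis using root by auto
    qed
    moreover have "(trace A - sqrt D) / 2 \<le> (trace A + sqrt D) / 2" using False by simp
    ultimately have "eigenvalue_gap A = (trace A + sqrt D) / 2 - (trace A - sqrt D) / 2"
      by (simp add: eigenvalue_gap_def max_absorb1 min_absorb2)
    then show ?thesis using False by (simp add: D_def field_simps)
  qed
qed

lemma measurable_eigenvalue_gap [measurable]: "eigenvalue_gap \<in> borel_measurable borel"
proof -
  have [measurable]: "(\<lambda>A::real^2^2. (trace A)\<^sup>2 - 4 * det A) \<in> borel_measurable borel"
    unfolding trace_def det_2 by (intro borel_measurable_continuous_onI continuous_intros)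
  show ?thesis unfolding eigenvalue_gap_2x2 by measurable
qed

lemma sets_traceless_GOE2 [simp, measurable_cong]: "sets traceless_GOE2 = sets borel"
  by (simp add: traceless_GOE2_def traceless_lborel_def)

lemma space_traceless_GOE2 [simp]: "space traceless_GOE2 = UNIV"
  by (simp add: traceless_GOE2_def traceless_lborel_def)

lemma GOE2_gap_tail:
  assumes "x \<ge> 0"
  shows "emeasure (distr traceless_GOE2 borel (\<lambda>A. eigenvalue_gap A / sqrt 2)) {x<..} = ennreal (exp (- x\<^sup>2 / 2))"
proof -
  have meas [measurable]: "(\<lambda>A. exp (- trace (A ** A) / 2)) \<in> borel_measurable traceless_lborel"
    by (simp add: traceless_lborel_def)
  have C: "(LINT B|traceless_lborel. exp (- trace (B ** B) / 2)) = pi"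
    by (rule integral_eq_nn_integral[OF meas, THEN trans])
      (simp, simp only: nn_integral_traceless_lborel enn2real_ennreal pi_ge_zero)
  have [measurable]: "(\<lambda>A. eigenvalue_gap A / sqrt 2) \<in> borel_measurable borel" by measurable
  let ?E = "{A. x < eigenvalue_gap A / sqrt 2}"
  have E [measurable]: "?E \<in> sets borel" by measurable
  have "emeasure (distr traceless_GOE2 borel (\<lambda>A. eigenvalue_gap A / sqrt 2)) {x<..} = emeasure traceless_GOE2 ?E"
    by (subst emeasure_distr) (auto intro!: arg_cong[where f = "emeasure traceless_GOE2"])
  also have "\<dots> = (\<integral>\<^sup>+A. ennreal (exp (- trace (A ** A) / 2) / pi) * indicator ?E A \<partial>traceless_lborel)"
    unfolding traceless_GOE2_def C by (subst emeasure_density) (simp_all add: traceless_lborel_def)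
  also have "\<dots> = (\<integral>\<^sup>+v. ennreal (exp (- (norm v)\<^sup>2)) * indicator {v::real \<times> real. x / sqrt 2 < norm v} v / ennreal pi \<partial>lborel)"
    unfolding traceless_lborel_def
  proof (subst nn_integral_distr)
    show "(\<integral>\<^sup>+v. ennreal (exp (- trace (traceless_symmetric v ** traceless_symmetric v) / 2) / pi) *
        indicator ?E (traceless_symmetric v) \<partial>lborel) =
      (\<integral>\<^sup>+v. ennreal (exp (- (norm v)\<^sup>2)) * indicator {v::real \<times> real. x / sqrt 2 < norm v} v / ennreal pi \<partial>lborel)"
    proof (rule nn_integral_cong)
      fix v :: "real \<times> real"
      obtain a b where v: "v = (a, b)" by (cases v)
      have nv: "(norm v)\<^sup>2 = a\<^sup>2 + b\<^sup>2" "norm v = sqrt (a\<^sup>2 + b\<^sup>2)" by (auto simp: v norm_Pair)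
      have "2 * sqrt (a\<^sup>2 + b\<^sup>2) / sqrt 2 = sqrt 2 * norm v"
        unfolding nv(2) by (simp add: field_simps)
      then have "traceless_symmetric v \<in> ?E \<longleftrightarrow> x / sqrt 2 < norm v"
        unfolding v by (simp add: eigenvalue_gap_traceless_symmetric pos_divide_less_eq mult.commute)
      moreover have "- trace (traceless_symmetric v ** traceless_symmetric v) / 2 = - (norm v)\<^sup>2"
        using nv(1) by (simp add: v trace_traceless_symmetric)
      ultimately show "ennreal (exp (- trace (traceless_symmetric v ** traceless_symmetric v) / 2) / pi) *
          indicator ?E (traceless_symmetric v) =
        ennreal (exp (- (norm v)\<^sup>2)) * indicator {v. x / sqrt 2 < norm v} v / ennreal pi"
        by (simp add: indicator_def divide_ennreal)
    qed
  qed measurable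
  also have "\<dots> = ennreal (pi * exp (- (x / sqrt 2)\<^sup>2)) / ennreal pi"
    using assms by (subst nn_integral_divide) (auto simp: nn_integral_gaussian_outside_disc)
  also have "\<dots> = ennreal (exp (- x\<^sup>2 / 2))"
    by (simp add: divide_ennreal power_divide)
  finally show ?thesis .
qed

lemma nn_integral_rayleigh_density_tail:
  assumes "x \<ge> 0"
  shows "(\<integral>\<^sup>+t. ennreal (rayleigh_density t) * indicator {x..} t \<partial>lborel) = ennreal (exp (- x\<^sup>2 / 2))"
proof -
  have "(\<integral>\<^sup>+t. ennreal (rayleigh_density t) * indicator {x..} t \<partial>lborel) =
      (\<integral>\<^sup>+t. ennreal (t * exp (- t\<^sup>2 / 2)) * indicator {x..} t \<partial>lborel)"
    using assms by (intro nn_integral_cong) (auto simp: rayleigh_density_def indicator_def)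
  also have "\<dots> = ennreal (0 - - exp (- x\<^sup>2 / 2))"
  proof (rule nn_integral_FTC_atLeast)
    show "((\<lambda>t. - exp (- t\<^sup>2 / 2)) has_real_derivative t * exp (- t\<^sup>2 / 2)) (at t)" for t :: real
      by (auto intro!: derivative_eq_intros)
    show "((\<lambda>t::real. - exp (- t\<^sup>2 / 2)) \<longlongrightarrow> 0) at_top" by real_asymp
  qed (use assms in auto)
  finally show ?thesis by simp
qed

lemma measurable_rayleigh_density [measurable]: "rayleigh_density \<in> borel_measurable borel"
  unfolding rayleigh_density_def[abs_def] by measurable

lemma rayleigh_tail:
  assumes "x \<ge> 0"
  shows "emeasure (density lborel (\<lambda>t. ennreal (rayleigh_density t))) {x<..} = ennreal (exp (- x\<^sup>2 / 2))"
proof -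
  have "emeasure (density lborel (\<lambda>t. ennreal (rayleigh_density t))) {x<..} =
      (\<integral>\<^sup>+t. ennreal (rayleigh_density t) * indicator {x<..} t \<partial>lborel)"
    by (subst emeasure_density) auto
  also have "\<dots> = (\<integral>\<^sup>+t. ennreal (rayleigh_density t) * indicator {x..} t \<partial>lborel)"
    by (intro nn_integral_cong_AE) (use AE_lborel_singleton[of x] in eventually_elim, auto simp: indicator_def)
  finally show ?thesis using nn_integral_rayleigh_density_tail[OF assms] by simp
qed

lemma real_distribution_rayleigh:
  "real_distribution (density lborel (\<lambda>t. ennreal (rayleigh_density t)))"
proof (intro real_distribution.intro real_distribution_axioms.intro prob_spaceI)
  have "emeasure (density lborel (\<lambda>t. ennreal (rayleigh_density t))) UNIV =
      (\<integral>\<^sup>+t. ennreal (rayleigh_density t) * indicator {0..} t \<partial>lborel)"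
    by (subst emeasure_density) (auto simp: rayleigh_density_def indicator_def intro!: nn_integral_cong)
  then show "emeasure (density lborel (\<lambda>t. ennreal (rayleigh_density t)))
      (space (density lborel (\<lambda>t. ennreal (rayleigh_density t)))) = 1"
    using nn_integral_rayleigh_density_tail[of 0] by simp
qed auto

text \<open>
  The tail at \<open>0\<close> is \<open>1\<close>, so the tails at nonnegative points determine the whole distribution.
\<close>

lemma cdf_of_rayleigh_tail:
  assumes "real_distribution M" "\<And>x. x \<ge> 0 \<Longrightarrow> emeasure M {x<..} = ennreal (exp (- x\<^sup>2 / 2))"
  shows "cdf M x = (if x < 0 then 0 else 1 - exp (- x\<^sup>2 / 2))"
proof -
  interpret real_distribution M by fact
  have nonneg: "cdf M x = 1 - exp (- x\<^sup>2 / 2)" if "x \<ge> 0" for x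
  proof -
    have "measure M {x<..} = exp (- x\<^sup>2 / 2)" using assms(2)[OF that] by (simp add: measure_def)
    moreover have "measure M {x<..} = 1 - measure M {..x}"
      using prob_compl[of "{..x}"] by (simp add: Compl_eq_Diff_UNIV[symmetric])
    ultimately show ?thesis by (simp add: cdf_def)
  qed
  show ?thesis
  proof (cases "x < 0")
    case True
    then have "cdf M x \<le> 0" using cdf_nondecreasing[of x 0] nonneg[of 0] by simp
    then show ?thesis using True cdf_nonneg[of x] by simp
  qed (use nonneg in simp)
qed

theorem distr_GOE2_gap_eq_rayleigh:
  "distr traceless_GOE2 borel (\<lambda>A. eigenvalue_gap A / sqrt 2) = density lborel (\<lambda>x. ennreal (rayleigh_density x))"
proof (rule cdf_unique)
  interpret G: prob_space traceless_GOE2 by (rule prob_space_traceless_GOE2)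
  show G: "real_distribution (distr traceless_GOE2 borel (\<lambda>A. eigenvalue_gap A / sqrt 2))"
    by (intro G.real_distribution_distr) measurable
  show "cdf (distr traceless_GOE2 borel (\<lambda>A. eigenvalue_gap A / sqrt 2)) =
      cdf (density lborel (\<lambda>x. ennreal (rayleigh_density x)))"
    using cdf_of_rayleigh_tail[OF G GOE2_gap_tail] cdf_of_rayleigh_tail[OF real_distribution_rayleigh rayleigh_tail]
    by auto
qed (rule real_distribution_rayleigh)

section \<open>The central limit theorem for the binomial distribution\<close>

lemma char_binomial:
  fixes p t :: real
  assumes "p \<in> {0..1}"
  shows "char (distr (binomial_pmf n p) borel real) t =
    (1 - complex_of_real p + complex_of_real p * exp (\<i> * complex_of_real t)) ^ n"
proof -
  have "char (distr (binomial_pmf n p) borel real) t =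
      (\<integral>k. exp (\<i> * complex_of_real (t * real k)) \<partial>measure_pmf (binomial_pmf n p))"
    unfolding char_def by (subst integral_distr) auto
  also have "\<dots> = (\<Sum>k\<le>n. pmf (binomial_pmf n p) k *\<^sub>R exp (\<i> * complex_of_real (t * real k)))"
    using assms set_pmf_binomial_eq[of p n] by (intro integral_measure_pmf) (auto split: if_splits)
  also have "\<dots> = (\<Sum>k\<le>n. of_nat (n choose k) * (complex_of_real p * exp (\<i> * complex_of_real t)) ^ k * (1 - complex_of_real p) ^ (n - k))"
    using assms by (intro sum.cong) (auto simp: scaleR_conv_of_real power_mult_distrib exp_of_nat_mult[symmetric] mult_ac)
  also have "\<dots> = (complex_of_real p * exp (\<i> * complex_of_real t) + (1 - complex_of_real p)) ^ n"
    by (subst binomial_ring) simp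
  finally show ?thesis by (simp add: add.commute)
qed

text \<open>
  The binomial distribution is the law of a sum of independent Bernoulli variables, as the
  characteristic functions show; so this is an instance of the general central limit theorem, on
  an infinite product of Bernoulli distributions.
\<close>

theorem binomial_clt:
  fixes p :: real
  assumes p: "0 < p" "p < 1"
  shows "weak_conv_m (\<lambda>n. distr (binomial_pmf n p) borel (\<lambda>k. (real k - real n * p) / sqrt (real n * (p * (1 - p)))))
    std_normal_distribution"
proof -
  define \<mu> where "\<mu> = distr (bernoulli_pmf p) borel (of_bool :: bool \<Rightarrow> real)"
  interpret \<mu>: prob_space \<mu> unfolding \<mu>_def by (intro measure_pmf.prob_space_distr) simp
  have sets\<mu> [measurable_cong]: "sets \<mu> = sets borel" by (simp add: \<mu>_def)
  define M where "M = (\<Pi>\<^sub>M i\<in>(UNIV :: nat set). \<mu>)"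
  interpret P: product_prob_space "\<lambda>_::nat. \<mu>" UNIV ..
  interpret M: prob_space M unfolding M_def by (intro prob_space_PiM \<mu>.prob_space_axioms)
  have [measurable]: "(\<lambda>\<omega>. \<omega> i) \<in> borel_measurable M" for i :: nat
  proof -
    have "(\<lambda>\<omega>. \<omega> i) \<in> measurable M \<mu>" unfolding M_def by (rule measurable_component_singleton) simp
    then show ?thesis by (simp only: measurable_cong_sets[OF refl sets\<mu>])
  qed
  have comp: "distr M borel (\<lambda>\<omega>. \<omega> i) = \<mu>" for i :: nat
  proof -
    have "distr M borel (\<lambda>\<omega>. \<omega> i) = distr M \<mu> (\<lambda>\<omega>. \<omega> i)" by (intro distr_cong) (simp_all add: sets\<mu>)
    then show ?thesis unfolding M_def using P.PiM_component[of i] by simp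
  qed
  have indep: "M.indep_vars (\<lambda>_. borel) (\<lambda>i \<omega>. \<omega> i) (UNIV :: nat set)"
  proof (subst M.indep_vars_iff_distr_eq_PiM')
    have "distr M (Pi\<^sub>M UNIV (\<lambda>_::nat. borel :: real measure)) (\<lambda>x. \<lambda>i\<in>UNIV. x i) = distr M M (\<lambda>x. x)"
      by (intro distr_cong) (auto simp: M_def sets\<mu> restrict_def intro!: sets_PiM_cong)
    also have "\<dots> = M" by (rule distr_id)
    finally show "distr M (Pi\<^sub>M UNIV (\<lambda>_::nat. borel :: real measure)) (\<lambda>x. \<lambda>i\<in>UNIV. x i) =
        Pi\<^sub>M UNIV (\<lambda>i. distr M borel (\<lambda>\<omega>. \<omega> i))" by (simp only: comp M_def[symmetric])
  qed auto
  have integrals: "(\<integral>\<omega>. f (\<omega> i) \<partial>M) = p * f 1 + (1 - p) * f 0"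
    if [measurable]: "f \<in> borel_measurable borel" for f :: "real \<Rightarrow> real" and i :: nat
  proof -
    have "(\<integral>\<omega>. f (\<omega> i) \<partial>M) = (\<integral>x. f x \<partial>\<mu>)" unfolding comp[of i, symmetric] by (subst integral_distr) simp_all
    also have "\<dots> = (\<integral>b. f (of_bool b) \<partial>measure_pmf (bernoulli_pmf p))" unfolding \<mu>_def by (subst integral_distr) simp_all
    also have "\<dots> = p * f 1 + (1 - p) * f 0" using p by simp
    finally show ?thesis .
  qed
  have bounded: "integrable M (\<lambda>\<omega>. f (\<omega> i))" if [measurable]: "f \<in> borel_measurable borel" for f :: "real \<Rightarrow> real" and i :: nat
  proof -
    have "integrable (measure_pmf (bernoulli_pmf p)) (\<lambda>b. f (of_bool b))"
      by (rule integrable_measure_pmf_finite) simp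
    then have "integrable \<mu> f" unfolding \<mu>_def by (subst integrable_distr_eq) simp_all
    then show ?thesis unfolding comp[of i, symmetric] by (subst (asm) integrable_distr_eq) simp_all
  qed
  have mean: "M.expectation (\<lambda>\<omega>. \<omega> i) = p" for i :: nat using integrals[of "\<lambda>x. x" i] by simp
  have var: "M.variance (\<lambda>\<omega>. \<omega> i) = (sqrt (p * (1 - p)))\<^sup>2" for i :: nat
    using p by (simp add: mean integrals[of "\<lambda>x. (x - p)\<^sup>2"]) (simp add: power2_eq_square algebra_simps)
  have clt: "weak_conv_m (\<lambda>n. distr M borel (\<lambda>\<omega>. (\<Sum>i<n. \<omega> i - p) / sqrt (real n * (sqrt (p * (1 - p)))\<^sup>2)))
      std_normal_distribution"
    by (rule M.central_limit_theorem[where \<mu> = \<mu>]) (use p indep mean var comp bounded[of "\<lambda>x. x\<^sup>2"] in auto)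
  have char\<mu>: "char \<mu> t = 1 - complex_of_real p + complex_of_real p * exp (\<i> * complex_of_real t)" for t
  proof -
    have "char \<mu> t = (\<integral>b. exp (\<i> * complex_of_real (t * of_bool b)) \<partial>measure_pmf (bernoulli_pmf p))"
      unfolding char_def \<mu>_def by (subst integral_distr) auto
    also have "\<dots> = (\<Sum>b\<in>UNIV. pmf (bernoulli_pmf p) b *\<^sub>R exp (\<i> * complex_of_real (t * of_bool b)))"
      by (intro integral_measure_pmf) auto
    also have "\<dots> = 1 - complex_of_real p + complex_of_real p * exp (\<i> * complex_of_real t)" using p by (simp add: UNIV_bool scaleR_conv_of_real)
    finally show ?thesis .
  qed
  have law: "distr M borel (\<lambda>\<omega>. \<Sum>i<n. \<omega> i) = distr (binomial_pmf n p) borel real" for n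
  proof (rule Levy_uniqueness)
    show "real_distribution (distr M borel (\<lambda>\<omega>. \<Sum>i<n. \<omega> i))" by (intro M.real_distribution_distr) measurable
    show "real_distribution (distr (binomial_pmf n p) borel real)"
      by (intro prob_space.real_distribution_distr measure_pmf.prob_space_axioms) simp
    show "char (distr M borel (\<lambda>\<omega>. \<Sum>i<n. \<omega> i)) = char (distr (binomial_pmf n p) borel real)"
    proof
      fix t
      have "char (distr M borel (\<lambda>\<omega>. \<Sum>i<n. \<omega> i)) t = (\<Prod>i<n. char (distr M borel (\<lambda>\<omega>. \<omega> i)) t)"
        by (rule M.char_distr_sum) (rule M.indep_vars_subset[OF indep], simp)
      then show "char (distr M borel (\<lambda>\<omega>. \<Sum>i<n. \<omega> i)) t = char (distr (binomial_pmf n p) borel real) t"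
        using p by (simp add: comp char\<mu> char_binomial)
    qed
  qed
  have "distr M borel (\<lambda>\<omega>. (\<Sum>i<n. \<omega> i - p) / sqrt (real n * (sqrt (p * (1 - p)))\<^sup>2)) =
      distr (binomial_pmf n p) borel (\<lambda>k. (real k - real n * p) / sqrt (real n * (p * (1 - p))))" for n
  proof -
    have "distr M borel (\<lambda>\<omega>. (\<Sum>i<n. \<omega> i - p) / sqrt (real n * (sqrt (p * (1 - p)))\<^sup>2)) =
        distr (distr M borel (\<lambda>\<omega>. \<Sum>i<n. \<omega> i)) borel (\<lambda>x. (x - real n * p) / sqrt (real n * (p * (1 - p))))"
      using p by (subst distr_distr) (auto simp: comp_def sum_subtractf)
    then show ?thesis unfolding law by (subst (asm) distr_distr) (auto simp: comp_def)
  qed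
  then show ?thesis using clt by simp
qed

lemma isCont_cdf_std_normal: "isCont (cdf std_normal_distribution) x"
proof -
  interpret real_distribution std_normal_distribution by (rule real_dist_normal_dist)
  have "emeasure std_normal_distribution {x} = 0"
    by (subst emeasure_density) (auto simp: nn_integral_0_iff_AE intro!: AE_mp[OF AE_lborel_singleton[of x]])
  then show ?thesis by (simp add: isCont_cdf measure_def)
qed

text \<open>
  Pointwise convergence of distribution functions to a continuous limit also holds along moving
  arguments: monotonicity squeezes the value between the values at two fixed points near \<open>x\<close>.
\<close>

lemma tendsto_mono_functions:
  fixes F :: "nat \<Rightarrow> real \<Rightarrow> real" and G :: "real \<Rightarrow> real"
  assumes mono: "\<And>n. mono (F n)" and lim: "\<And>z. (\<lambda>n. F n z) \<longlonglongrightarrow> G z"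
    and cont: "isCont G x" and z: "z \<longlonglongrightarrow> x"
  shows "(\<lambda>n. F n (z n)) \<longlonglongrightarrow> G x"
proof (rule LIMSEQ_I)
  fix e :: real assume e: "e > 0"
  from cont obtain d where d: "d > 0" "\<And>y. \<bar>y - x\<bar> < d \<Longrightarrow> \<bar>G y - G x\<bar> < e / 2"
    using e unfolding continuous_at_eps_delta dist_real_def by (meson half_gt_zero)
  have "eventually (\<lambda>n. \<bar>z n - x\<bar> < d / 2) sequentially"
    using tendstoD[OF z, of "d / 2"] d(1) by (simp add: dist_real_def)
  moreover have "eventually (\<lambda>n. \<bar>F n (x + d / 2) - G (x + d / 2)\<bar> < e / 2) sequentially"
    "eventually (\<lambda>n. \<bar>F n (x - d / 2) - G (x - d / 2)\<bar> < e / 2) sequentially"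
    using tendstoD[OF lim, of "e / 2"] e by (simp_all add: dist_real_def)
  ultimately have "eventually (\<lambda>n. norm (F n (z n) - G x) < e) sequentially"
  proof eventually_elim
    case (elim n)
    have "F n (x - d / 2) \<le> F n (z n)" "F n (z n) \<le> F n (x + d / 2)"
      using elim(1) unfolding abs_less_iff by (intro monoD[OF mono]; linarith)+
    moreover have "\<bar>G (x + d / 2) - G x\<bar> < e / 2" "\<bar>G (x - d / 2) - G x\<bar> < e / 2"
      using d(1) d(2)[of "x + d / 2"] d(2)[of "x - d / 2"] by simp_all
    ultimately show ?case using elim(2,3) unfolding real_norm_def abs_less_iff by linarith
  qed
  then show "\<exists>no. \<forall>n\<ge>no. norm (F n (z n) - G x) < e" by (simp add: eventually_sequentially)
qed

lemma tendsto_mono_functions_at_bot: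
  fixes F :: "nat \<Rightarrow> real \<Rightarrow> real" and G :: "real \<Rightarrow> real"
  assumes mono: "\<And>n. mono (F n)" and nonneg: "\<And>n z. F n z \<ge> 0" and lim: "\<And>z. (\<lambda>n. F n z) \<longlonglongrightarrow> G z"
    and bot: "(G \<longlongrightarrow> 0) at_bot" and z: "filterlim z at_bot sequentially"
  shows "(\<lambda>n. F n (z n)) \<longlonglongrightarrow> 0"
proof (rule LIMSEQ_I)
  fix e :: real assume e: "e > 0"
  have "eventually (\<lambda>y. G y < e) at_bot" using order_tendstoD(2)[OF bot e] .
  then obtain y where y: "G y < e" by (metis eventually_at_bot_linorder order_refl)
  have "eventually (\<lambda>n. F n y < e) sequentially" using order_tendstoD(2)[OF lim y] .
  moreover have "eventually (\<lambda>n. z n \<le> y) sequentially" using z by (simp add: filterlim_at_bot)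
  ultimately have "eventually (\<lambda>n. norm (F n (z n) - 0) < e) sequentially"
  proof eventually_elim
    case (elim n)
    then show ?case using monoD[OF mono[of n], of "z n" y] nonneg[of n "z n"] by simp
  qed
  then show "\<exists>no. \<forall>n\<ge>no. norm (F n (z n) - 0) < e" by (simp add: eventually_sequentially)
qed

text \<open>
  A lower end far below the mean on the scale of the standard deviation has no influence in the limit.
\<close>

lemma binomial_interval_limit:
  fixes l c :: "nat \<Rightarrow> real"
  assumes p: "0 < p" "p < 1"
    and l: "filterlim (\<lambda>n. (l n - real n * p) / sqrt (real n * (p * (1 - p)))) at_bot sequentially"
  shows "(\<lambda>n. (c n - real n * p) / sqrt (real n * (p * (1 - p)))) \<longlonglongrightarrow> x \<Longrightarrow>
      (\<lambda>n. measure (binomial_pmf n p) {k. l n \<le> real k \<and> real k \<le> c n}) \<longlonglongrightarrow> cdf std_normal_distribution x"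
    and "(\<lambda>n. measure (binomial_pmf n p) {k. l n \<le> real k}) \<longlonglongrightarrow> 1"
proof -
  let ?z = "\<lambda>n y. (y - real n * p) / sqrt (real n * (p * (1 - p)))"
  define F where "F n = cdf (distr (binomial_pmf n p) borel (\<lambda>k. ?z n (real k)))" for n :: nat
  interpret N: real_distribution std_normal_distribution by (rule real_dist_normal_dist)
  interpret F: real_distribution "distr (binomial_pmf n p) borel (\<lambda>k. ?z n (real k))" for n
    by (intro prob_space.real_distribution_distr measure_pmf.prob_space_axioms) simp
  have lim: "(\<lambda>n. F n z) \<longlonglongrightarrow> cdf std_normal_distribution z" for z
    using binomial_clt[OF p] isCont_cdf_std_normal unfolding weak_conv_m_def weak_conv_def F_def by blast
  have mono: "mono (F n)" for n unfolding F_def by (intro monoI F.cdf_nondecreasing)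
  have nonneg: "F n z \<ge> 0" for n z unfolding F_def by (rule F.cdf_nonneg)
  have F: "F n z = measure (binomial_pmf n p) {k. ?z n (real k) \<le> z}" for n z
    unfolding F_def cdf_def by (subst measure_distr) (auto intro!: arg_cong[where f = "measure (binomial_pmf n p)"])
  have Fl: "(\<lambda>n. F n (?z n (l n))) \<longlonglongrightarrow> 0"
    by (rule tendsto_mono_functions_at_bot[OF mono nonneg lim N.cdf_lim_at_bot l])
  have le: "?z n (real k) \<le> ?z n y \<longleftrightarrow> real k \<le> y" if "n > 0" for n k y
  proof -
    have "sqrt (real n * (p * (1 - p))) > 0" using that p by simp
    then show ?thesis by (simp only: divide_le_cancel) auto
  qed
  have Fc: "F n (?z n y) = measure (binomial_pmf n p) {k. real k \<le> y}" if "n > 0" for n y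
    unfolding F using le[OF that] by simp
  have below: "measure (binomial_pmf n p) {k. real k < l n} \<le> F n (?z n (l n))" if "n > 0" for n
    unfolding Fc[OF that] by (intro measure_pmf.finite_measure_mono) auto
  show "(\<lambda>n. measure (binomial_pmf n p) {k. l n \<le> real k}) \<longlonglongrightarrow> 1"
  proof (rule real_tendsto_sandwich)
    show "(\<lambda>n. 1 - F n (?z n (l n))) \<longlonglongrightarrow> 1" using tendsto_diff[OF tendsto_const Fl] by simp
    have "measure (binomial_pmf n p) {k. l n \<le> real k} = 1 - measure (binomial_pmf n p) {k. real k < l n}" for n
    proof -
      have "{k. l n \<le> real k} = UNIV - {k. real k < l n}" by auto
      then show ?thesis by (simp add: measure_pmf.prob_compl[of "{k. real k < l n}", simplified])
    qed
    then show "\<forall>\<^sub>F n in sequentially. 1 - F n (?z n (l n)) \<le> measure (binomial_pmf n p) {k. l n \<le> real k}"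
      using below by (intro eventually_mono[OF eventually_gt_at_top[of 0]]) simp
    show "\<forall>\<^sub>F n in sequentially. measure (binomial_pmf n p) {k. l n \<le> real k} \<le> 1" by simp
  qed simp
  assume c: "(\<lambda>n. ?z n (c n)) \<longlonglongrightarrow> x"
  have Fcl: "(\<lambda>n. F n (?z n (c n))) \<longlonglongrightarrow> cdf std_normal_distribution x"
    by (rule tendsto_mono_functions[OF mono lim isCont_cdf_std_normal c])
  show "(\<lambda>n. measure (binomial_pmf n p) {k. l n \<le> real k \<and> real k \<le> c n}) \<longlonglongrightarrow> cdf std_normal_distribution x"
  proof (rule real_tendsto_sandwich[OF _ _ _ Fcl])
    show "(\<lambda>n. F n (?z n (c n)) - F n (?z n (l n))) \<longlonglongrightarrow> cdf std_normal_distribution x"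
      using tendsto_diff[OF Fcl Fl] by simp
    show "\<forall>\<^sub>F n in sequentially. measure (binomial_pmf n p) {k. l n \<le> real k \<and> real k \<le> c n} \<le> F n (?z n (c n))"
      using eventually_gt_at_top[of 0]
      by eventually_elim (auto simp: Fc intro!: measure_pmf.finite_measure_mono)
    show "\<forall>\<^sub>F n in sequentially. F n (?z n (c n)) - F n (?z n (l n)) \<le>
        measure (binomial_pmf n p) {k. l n \<le> real k \<and> real k \<le> c n}"
      using eventually_gt_at_top[of 0]
    proof eventually_elim
      case (elim n)
      have "F n (?z n (c n)) \<le> measure (binomial_pmf n p) ({k. l n \<le> real k \<and> real k \<le> c n} \<union> {k. real k < l n})"
        unfolding Fc[OF elim] by (intro measure_pmf.finite_measure_mono) auto
      also have "\<dots> \<le> measure (binomial_pmf n p) {k. l n \<le> real k \<and> real k \<le> c n} + measure (binomial_pmf n p) {k. real k < l n}"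
        by (intro measure_Un_le) auto
      finally show ?case using below[OF elim] by simp
    qed
  qed
qed

section \<open>The law of the number of fixed points\<close>

definition fp_weight :: "real \<Rightarrow> nat \<Rightarrow> nat \<Rightarrow> real" where
  "fp_weight q n j = fp_count n j * q ^ (n - 2 * j)"

lemma prob_fp:
  assumes \<sigma>: "\<sigma> \<in> {one_line [3,2,1], one_line [1,3,2], one_line [2,1,3]}" and q: "q > 0"
  shows "measure (involution_pmf q n 3 \<sigma>) {\<pi>. Q (fp n \<pi>)} =
    (\<Sum>j\<in>{j. j \<le> n div 2 \<and> Q (n - 2 * j)}. fp_weight q n j) / (\<Sum>j\<le>n div 2. fp_weight q n j)"
proof -
  let ?A = "avoiding_involutions n 3 \<sigma>"
  have ne: "?A \<noteq> {}" using avoiding_involutions_nonempty[OF \<sigma>] by blast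
  note pmf = pmf_involution_pmf[OF q ne]
  have Z: "(\<Sum>\<tau>\<in>?A. q ^ fp n \<tau>) = (\<Sum>j\<le>n div 2. fp_weight q n j)"
    unfolding fp_weight_def by (rule sum_avoiding_involutions_by_fp[OF \<sigma>])
  have "measure (involution_pmf q n 3 \<sigma>) {\<pi>. Q (fp n \<pi>)} =
      (\<integral>\<pi>. indicat_real {\<pi>. Q (fp n \<pi>)} \<pi> \<partial>involution_pmf q n 3 \<sigma>)"
    by simp
  also have "\<dots> = (\<Sum>\<pi>\<in>?A. indicat_real {\<pi>. Q (fp n \<pi>)} \<pi> * pmf (involution_pmf q n 3 \<sigma>) \<pi>)"
    by (rule integral_measure_pmf_real[OF finite_avoiding_involutions]) (auto simp: set_pmf_iff pmf split: if_splits)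
  also have "\<dots> = (\<Sum>\<pi>\<in>?A. (if Q (fp n \<pi>) then q ^ fp n \<pi> else 0) / (\<Sum>\<tau>\<in>?A. q ^ fp n \<tau>))"
    by (intro sum.cong) (auto simp: pmf)
  also have "\<dots> = (\<Sum>\<pi>\<in>?A. (if Q (fp n \<pi>) then q ^ fp n \<pi> else 0)) / (\<Sum>j\<le>n div 2. fp_weight q n j)"
    unfolding Z by (rule sum_divide_distrib[symmetric])
  also have "(\<Sum>\<pi>\<in>?A. (if Q (fp n \<pi>) then q ^ fp n \<pi> else 0)) =
      (\<Sum>j\<le>n div 2. fp_count n j * (if Q (n - 2 * j) then q ^ (n - 2 * j) else 0))"
    using sum_avoiding_involutions_by_fp[OF \<sigma>, of "\<lambda>k. if Q k then q ^ k else 0" n] .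
  also have "\<dots> = (\<Sum>j\<in>{j. j \<le> n div 2 \<and> Q (n - 2 * j)}. fp_weight q n j)"
    unfolding fp_weight_def by (intro sum.mono_neutral_cong_right) auto
  finally show ?thesis .
qed

text \<open>
  The ballot number relative to the binomial coefficient: the numerator is the number of fixed points
  plus one, the origin of the factor \<open>k + 1\<close> in the negative binomial law.
\<close>

lemma fp_count_closed_form:
  assumes "2 * j \<le> n"
  shows "fp_count n j = real (n choose j) * real (n - 2 * j + 1) / real (n - j + 1)"
proof (cases j)
  case 0
  then show ?thesis by (simp add: fp_count_def)
next
  case (Suc i)
  have ni: "n - i = n - j + 1" using Suc assms by simp
  have "Suc i * (n choose Suc i) = (n choose i) * (n - i)"
    using binomial_absorb_comp[of n i] binomial_absorption[of i n] by (simp add: mult.commute)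
  then have "real j * real (n choose j) = real (n choose i) * real (n - j + 1)"
    unfolding Suc[symmetric] ni[symmetric] by (metis of_nat_mult)
  then have "real (n choose i) = real (n choose j) * (real j / real (n - j + 1))"
    by (simp add: field_simps del: of_nat_add of_nat_Suc)
  moreover have "1 - real j / real (n - j + 1) = real (n - 2 * j + 1) / real (n - j + 1)"
  proof -
    have "real (n - 2 * j + 1) = real (n - j + 1) - real j" using assms by (simp add: of_nat_diff)
    moreover have nz: "real (n - j + 1) \<noteq> 0" by simp
    ultimately show ?thesis by (simp only: diff_divide_distrib divide_self[OF nz])
  qed
  ultimately show ?thesis using Suc by (simp add: fp_count_def right_diff_distrib[symmetric] del: of_nat_add of_nat_Suc) (metis mult.right_neutral right_diff_distrib times_divide_eq_right)
qed

lemma sum_fp_count: "(\<Sum>j<Suc J. fp_count n j) = real (n choose J)"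
  by (induction J) (auto simp: fp_count_def)

section \<open>The limit for q less than 1\<close>

lemma weak_conv_pmf_nat:
  fixes p :: "nat \<Rightarrow> nat pmf"
  assumes "\<And>k. (\<lambda>n. pmf (p n) k) \<longlonglongrightarrow> pmf P k"
  shows "weak_conv_m (\<lambda>n. distr (p n) borel real) (distr P borel real)"
  unfolding weak_conv_m_def weak_conv_def
proof (intro allI impI)
  fix x :: real
  have fin: "finite {k::nat. real k \<le> x}"
    by (rule finite_subset[of _ "{..nat \<lfloor>x\<rfloor>}"]) (auto simp: le_nat_iff le_floor_iff)
  have "cdf (distr Q borel real) x = (\<Sum>k\<in>{k. real k \<le> x}. pmf Q k)" for Q :: "nat pmf"
    unfolding cdf_def by (subst measure_distr) (auto simp: vimage_def measure_measure_pmf_finite[OF fin])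
  then show "(\<lambda>n. cdf (distr (p n) borel real) x) \<longlonglongrightarrow> cdf (distr P borel real) x"
    by (simp add: assms tendsto_sum)
qed

lemma measure_pmf_parity_sums:
  fixes P :: "nat pmf"
  assumes "e < 2"
  shows "(\<lambda>i. pmf P (e + 2 * i)) sums measure P {k. k mod 2 = e}"
proof -
  have U: "{k. k mod 2 = e} = (\<Union>i. {e + 2 * i})"
  proof (intro set_eqI iffI)
    fix k assume "k \<in> {k. k mod 2 = e}"
    then have "k mod 2 = e" by simp
    then have "k = e + 2 * (k div 2)" by presburger
    then show "k \<in> (\<Union>i. {e + 2 * i})" by blast
  qed (use assms in auto)
  have "(\<lambda>i. measure P {e + 2 * i}) sums measure P (\<Union>i. {e + 2 * i})"
    by (intro measure_pmf.finite_measure_UNION) (auto simp: disjoint_family_on_def)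
  then show ?thesis unfolding U by (simp add: pmf.rep_eq)
qed

text \<open>
  The index \<open>i\<close> counts from the centre, so that \<open>n - i\<close> two-cycles leave \<open>e + 2 * i\<close> fixed points.
  Rescaled by \<open>c\<close>, the weight is \<open>(e + 2 * i + 1) * q ^ (e + 2 * i)\<close> times a factor that is at most
  \<open>1\<close> and tends to \<open>1\<close>; the summable limit therefore dominates, and Tannery's theorem applies.
\<close>

lemma subcritical_weights_limit:
  fixes q :: real and e :: nat
  assumes q: "0 < q" "q < 1" and e: "e < 2"
  defines "c \<equiv> \<lambda>n. real (n + e + 1) / real ((2 * n + e) choose n)"
  shows "(\<lambda>n. if i \<le> n then c n * fp_weight q (2 * n + e) (n - i) else 0) \<longlonglongrightarrow> real (e + 2 * i + 1) * q ^ (e + 2 * i)"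
    and "summable (\<lambda>i. real (e + 2 * i + 1) * q ^ (e + 2 * i))"
    and "(\<lambda>n. c n * (\<Sum>j\<le>n. fp_weight q (2 * n + e) j)) \<longlonglongrightarrow> (\<Sum>i. real (e + 2 * i + 1) * q ^ (e + 2 * i))"
proof -
  define u where "u i n = (if i \<le> n then c n * fp_weight q (2 * n + e) (n - i) else 0)" for i n
  let ?b = "\<lambda>i. real (e + 2 * i + 1) * q ^ (e + 2 * i)"
  have form: "u i n = (real ((2 * n + e) choose (n - i)) / real ((2 * n + e) choose n)) *
      (real (n + e + 1) / real (n + e + i + 1)) * ?b i" if "i \<le> n" for i n
  proof -
    have k: "2 * n + e - 2 * (n - i) = e + 2 * i" "2 * n + e - (n - i) = n + e + i" using that by auto
    have "2 * (n - i) \<le> 2 * n + e" by simp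
    from fp_count_closed_form[OF this] show ?thesis
      using that unfolding u_def c_def fp_weight_def k by simp
  qed
  have div2: "(2 * n + e) div 2 = n" for n using e by simp
  have lim: "(\<lambda>n. u i n) \<longlonglongrightarrow> ?b i" for i
  proof -
    have "(\<lambda>n. real i / sqrt (real n)) \<longlonglongrightarrow> 0" by real_asymp
    then have "(\<lambda>n. real (n choose (n div 2 - i)) / real (n choose (n div 2))) \<longlonglongrightarrow> exp (- (2 * 0\<^sup>2))"
      by (rule binomial_local_limit)
    moreover have "filterlim (\<lambda>n. 2 * n + e) sequentially sequentially"
      by (rule filterlim_subseq) (auto simp: strict_mono_def)
    ultimately have "(\<lambda>n. real ((2 * n + e) choose ((2 * n + e) div 2 - i)) / real ((2 * n + e) choose ((2 * n + e) div 2)))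
        \<longlonglongrightarrow> exp (- (2 * 0\<^sup>2))"
      by (rule filterlim_compose)
    then have 1: "(\<lambda>n. real ((2 * n + e) choose (n - i)) / real ((2 * n + e) choose n)) \<longlonglongrightarrow> 1"
      unfolding div2 by simp
    have 2: "(\<lambda>n. real (n + e + 1) / real (n + e + i + 1)) \<longlonglongrightarrow> 1" by real_asymp
    have "(\<lambda>n. (real ((2 * n + e) choose (n - i)) / real ((2 * n + e) choose n)) *
      (real (n + e + 1) / real (n + e + i + 1)) * ?b i) \<longlonglongrightarrow> 1 * 1 * ?b i"
      by (intro tendsto_mult 1 2 tendsto_const)
    moreover have "\<forall>\<^sub>F n in sequentially. (real ((2 * n + e) choose (n - i)) / real ((2 * n + e) choose n)) *
      (real (n + e + 1) / real (n + e + i + 1)) * ?b i = u i n"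
      using eventually_ge_at_top[of i] by eventually_elim (simp only: form)
    ultimately show ?thesis by (simp add: tendsto_cong)
  qed
  then show "(\<lambda>n. if i \<le> n then c n * fp_weight q (2 * n + e) (n - i) else 0) \<longlonglongrightarrow> ?b i"
    unfolding u_def .
  have bound: "norm (u i n) \<le> ?b i" for i n
  proof (cases "i \<le> n")
    case True
    have "(2 * n + e) choose (n - i) \<le> (2 * n + e) choose n" using binomial_maximum[of "2 * n + e" "n - i"] by (simp add: div2)
    then have "real ((2 * n + e) choose (n - i)) / real ((2 * n + e) choose n) \<le> 1" by simp
    moreover have "real (n + e + 1) / real (n + e + i + 1) \<le> 1" by simp
    ultimately have "(real ((2 * n + e) choose (n - i)) / real ((2 * n + e) choose n)) *
        (real (n + e + 1) / real (n + e + i + 1)) * ?b i \<le> 1 * ?b i"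
      using q by (intro mult_right_mono mult_le_one) auto
    moreover have "0 \<le> (real ((2 * n + e) choose (n - i)) / real ((2 * n + e) choose n)) *
        (real (n + e + 1) / real (n + e + i + 1)) * ?b i" using q by simp
    ultimately show ?thesis unfolding form[OF True] real_norm_def by (simp only: abs_of_nonneg mult_1)
  qed (use q in \<open>simp add: u_def\<close>)
  show summ: "summable ?b"
  proof -
    have "(\<lambda>i. pmf (neg_binomial_pmf 2 (1 - q)) (e + 2 * i)) sums measure (neg_binomial_pmf 2 (1 - q)) {k. k mod 2 = e}"
      by (rule measure_pmf_parity_sums[OF e])
    then have "summable (\<lambda>i. (1 - q)\<^sup>2 * ?b i)"
      unfolding pmf_neg_binomial_2[OF q] by (auto simp: sums_iff mult_ac add_ac)
    then show ?thesis by (rule summable_mult_D) (use q in simp)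
  qed
  have "(\<lambda>n. suminf (\<lambda>i. u i n)) \<longlonglongrightarrow> suminf ?b"
    using tannerys_theorem[of u ?b sequentially ?b] lim summ bound by (auto intro!: always_eventually)
  moreover have "suminf (\<lambda>i. u i n) = c n * (\<Sum>j\<le>n. fp_weight q (2 * n + e) j)" for n
  proof -
    have "suminf (\<lambda>i. u i n) = (\<Sum>i\<le>n. u i n)" by (intro suminf_finite) (auto simp: u_def)
    also have "\<dots> = (\<Sum>i\<le>n. c n * fp_weight q (2 * n + e) (n - i))" by (intro sum.cong) (auto simp: u_def)
    also have "\<dots> = (\<Sum>j\<le>n. c n * fp_weight q (2 * n + e) j)"
      by (rule sum.reindex_bij_witness[where i = "\<lambda>j. n - j" and j = "\<lambda>j. n - j"]) auto
    finally show ?thesis by (simp add: sum_distrib_left)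
  qed
  ultimately show "(\<lambda>n. c n * (\<Sum>j\<le>n. fp_weight q (2 * n + e) j)) \<longlonglongrightarrow> suminf ?b" by simp
qed

theorem subcritical_limit:
  fixes q :: real and e :: nat
  assumes \<sigma>: "\<sigma> \<in> {one_line [3,2,1], one_line [1,3,2], one_line [2,1,3]}"
    and q: "0 < q" "q < 1" and e: "e < 2"
  shows "weak_conv_m (\<lambda>n. distr (involution_pmf q (2 * n + e) 3 \<sigma>) borel (\<lambda>\<pi>. real (fp (2 * n + e) \<pi>)))
    (distr (cond_pmf (neg_binomial_pmf 2 (1 - q)) {j. j mod 2 = e}) borel real)"
proof -
  let ?N = "neg_binomial_pmf 2 (1 - q)" and ?S = "{j. j mod 2 = e}"
  let ?b = "\<lambda>i. real (e + 2 * i + 1) * q ^ (e + 2 * i)"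
  let ?p = "\<lambda>n. map_pmf (fp (2 * n + e)) (involution_pmf q (2 * n + e) 3 \<sigma>)"
  define c where "c n = real (n + e + 1) / real ((2 * n + e) choose n)" for n
  have c: "c n \<noteq> 0" for n unfolding c_def by (simp del: of_nat_add of_nat_Suc)
  have div2: "(2 * n + e) div 2 = n" for n using e by simp
  note lims = subcritical_weights_limit[OF q e, folded c_def]
  have pos: "suminf ?b > 0" using lims(2) q by (intro suminf_pos) auto
  have "(\<lambda>i. pmf ?N (e + 2 * i)) sums measure ?N ?S" by (rule measure_pmf_parity_sums[OF e])
  then have "(\<lambda>i. ?b i * (1 - q)\<^sup>2) sums measure ?N ?S"
    unfolding pmf_neg_binomial_2[OF q] by (simp add: add_ac)
  moreover have "(\<lambda>i. ?b i * (1 - q)\<^sup>2) sums (suminf ?b * (1 - q)\<^sup>2)"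
    using lims(2) by (intro sums_mult2 summable_sums)
  ultimately have meas: "measure ?N ?S = suminf ?b * (1 - q)\<^sup>2" by (rule sums_unique2)
  have "set_pmf ?N \<inter> ?S \<noteq> {}"
  proof -
    have "pmf ?N e > 0" using q by (simp add: pmf_neg_binomial_2[OF q])
    moreover have "e mod 2 = e" using e by simp
    ultimately show ?thesis by (force simp: set_pmf_iff)
  qed
  note cond = pmf_cond[OF this]
  have pmf_p: "pmf (?p n) k = (if k \<le> 2 * n + e \<and> k mod 2 = e then fp_weight q (2 * n + e) ((2 * n + e - k) div 2) else 0) /
      (\<Sum>j\<le>n. fp_weight q (2 * n + e) j)" for n k
  proof -
    have "pmf (?p n) k = measure (involution_pmf q (2 * n + e) 3 \<sigma>) {\<pi>. fp (2 * n + e) \<pi> = k}"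
      by (simp add: pmf_map vimage_def)
    also have "\<dots> = (\<Sum>j\<in>{j. j \<le> n \<and> 2 * n + e - 2 * j = k}. fp_weight q (2 * n + e) j) / (\<Sum>j\<le>n. fp_weight q (2 * n + e) j)"
      using prob_fp[OF \<sigma> q(1), of "2 * n + e" "\<lambda>x. x = k"] unfolding div2 .
    also have "{j. j \<le> n \<and> 2 * n + e - 2 * j = k} = (if k \<le> 2 * n + e \<and> k mod 2 = e then {(2 * n + e - k) div 2} else {})"
    proof (intro set_eqI)
      fix j
      have "(j \<le> n \<and> 2 * n + e - 2 * j = k) \<longleftrightarrow> (k \<le> 2 * n + e \<and> k mod 2 = e \<and> j = (2 * n + e - k) div 2)"
      proof
        assume j: "j \<le> n \<and> 2 * n + e - 2 * j = k"
        then obtain d where "n = j + d" by (auto simp: le_iff_add)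
        then have "k = e + 2 * d" "2 * n + e - k = 2 * j" using j by auto
        then show "k \<le> 2 * n + e \<and> k mod 2 = e \<and> j = (2 * n + e - k) div 2"
          using e \<open>n = j + d\<close> by simp
      next
        assume k: "k \<le> 2 * n + e \<and> k mod 2 = e \<and> j = (2 * n + e - k) div 2"
        define i where "i = k div 2"
        have ki: "k = e + 2 * i" using k mult_div_mod_eq[of 2 k] by (simp add: i_def)
        then have "i \<le> n" "2 * n + e - k = 2 * (n - i)" using k by auto
        then have "j = n - i" using k by simp
        then show "j \<le> n \<and> 2 * n + e - 2 * j = k" using ki \<open>i \<le> n\<close> by auto
      qed
      then show "j \<in> {j. j \<le> n \<and> 2 * n + e - 2 * j = k} \<longleftrightarrow>
          j \<in> (if k \<le> 2 * n + e \<and> k mod 2 = e then {(2 * n + e - k) div 2} else {})" by auto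
    qed
    finally show ?thesis by simp
  qed
  have "(\<lambda>n. pmf (?p n) k) \<longlonglongrightarrow> pmf (cond_pmf ?N ?S) k" for k
  proof (cases "k mod 2 = e")
    case False
    then show ?thesis by (simp add: pmf_p cond)
  next
    case True
    define i where "i = k div 2"
    have k: "k = e + 2 * i" unfolding i_def using True by presburger
    have "(\<lambda>n. (if i \<le> n then c n * fp_weight q (2 * n + e) (n - i) else 0) / (c n * (\<Sum>j\<le>n. fp_weight q (2 * n + e) j)))
        \<longlonglongrightarrow> ?b i / suminf ?b"
      using pos by (intro tendsto_divide lims) auto
    moreover have "\<forall>\<^sub>F n in sequentially. (if i \<le> n then c n * fp_weight q (2 * n + e) (n - i) else 0) /
        (c n * (\<Sum>j\<le>n. fp_weight q (2 * n + e) j)) = pmf (?p n) k"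
      using eventually_ge_at_top[of i]
    proof eventually_elim
      case (elim n)
      have "(2 * n + e - k) div 2 = n - i" "k \<le> 2 * n + e" using elim by (auto simp: k)
      then show ?case using elim c[of n] True by (simp add: pmf_p)
    qed
    moreover have "?b i / suminf ?b = pmf (cond_pmf ?N ?S) k"
      using True q by (simp add: cond meas pmf_neg_binomial_2[OF q] k add_ac)
    ultimately show ?thesis by (simp add: tendsto_cong)
  qed
  then have "weak_conv_m (\<lambda>n. distr (?p n) borel real) (distr (cond_pmf ?N ?S) borel real)"
    by (rule weak_conv_pmf_nat)
  moreover have "distr (?p n) borel real = distr (involution_pmf q (2 * n + e) 3 \<sigma>) borel (\<lambda>\<pi>. real (fp (2 * n + e) \<pi>))" for n
    unfolding map_pmf_rep_eq by (subst distr_distr) (auto simp: comp_def)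
  ultimately show ?thesis by simp
qed

section \<open>The limit for q equal to 1\<close>

text \<open>
  The partial sums of the ballot numbers telescope, so for \<open>q = 1\<close> the tail probability is a quotient
  of binomial coefficients.
\<close>

lemma critical_tail_limit:
  assumes \<sigma>: "\<sigma> \<in> {one_line [3,2,1], one_line [1,3,2], one_line [2,1,3]}" and x: "x \<ge> 0"
  shows "(\<lambda>n. measure (involution_pmf 1 n 3 \<sigma>) {\<pi>. x * sqrt (real n) < real (fp n \<pi>)}) \<longlonglongrightarrow> exp (- x\<^sup>2 / 2)"
proof -
  \<comment> \<open>For large \<open>n\<close>, the largest \<open>j\<close> for which \<open>n - 2 * j\<close> exceeds \<open>x * sqrt n\<close>.\<close>
  define J where "J n = nat (\<lceil>(real n - x * sqrt (real n)) / 2\<rceil> - 1)" for n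
  define i where "i n = n div 2 - J n" for n
  have "filterlim (\<lambda>n. real n - x * sqrt (real n)) at_top sequentially" by real_asymp
  then have "eventually (\<lambda>n. real n - x * sqrt (real n) > 0) sequentially"
    by (rule filterlim_at_top_dense[THEN iffD1, rule_format])
  then have ev: "eventually (\<lambda>n. real (J n) < (real n - x * sqrt (real n)) / 2 \<and>
      (real n - x * sqrt (real n)) / 2 \<le> real (J n) + 1 \<and> J n \<le> n div 2 \<and> n > 0) sequentially"
    using eventually_gt_at_top[of 0]
  proof eventually_elim
    case (elim n)
    let ?c = "(real n - x * sqrt (real n)) / 2"
    have "real (J n) = real_of_int \<lceil>?c\<rceil> - 1" using elim(1) unfolding J_def by (simp add: less_ceiling_iff)
    then have J: "real (J n) < ?c" "?c \<le> real (J n) + 1" by linarith+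
    have "?c \<le> real n / 2" using x by simp
    then have "2 * real (J n) < real n" using J(1) by linarith
    then have "real (2 * J n) < real n" by simp
    then have "2 * J n < n" by (simp only: of_nat_less_iff)
    then show ?case using J elim by auto
  qed
  have "(\<lambda>n. real (i n) / sqrt (real n)) \<longlonglongrightarrow> x / 2"
  proof (rule real_tendsto_sandwich)
    have bounds: "x * sqrt (real n) / 2 - 1 / 2 \<le> real (i n) \<and> real (i n) \<le> x * sqrt (real n) / 2 + 1"
      if J: "real (J n) < (real n - x * sqrt (real n)) / 2 \<and>
        (real n - x * sqrt (real n)) / 2 \<le> real (J n) + 1 \<and> J n \<le> n div 2 \<and> n > 0" for n
    proof -
      have "n \<le> 2 * (n div 2) + 1" "2 * (n div 2) \<le> n" by presburger+
      then have "real n \<le> real (2 * (n div 2) + 1)" "real (2 * (n div 2)) \<le> real n"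
        by (simp_all only: of_nat_le_iff)
      then have "real n \<le> 2 * real (n div 2) + 1" "2 * real (n div 2) \<le> real n" by simp_all
      moreover have "real (i n) = real (n div 2) - real (J n)" unfolding i_def using J by (simp add: of_nat_diff)
      moreover have "(real n - x * sqrt (real n)) / 2 = real n / 2 - x * sqrt (real n) / 2" by (rule diff_divide_distrib)
      ultimately show ?thesis using J by linarith
    qed
    show "\<forall>\<^sub>F n in sequentially. (x * sqrt (real n) / 2 - 1 / 2) / sqrt (real n) \<le> real (i n) / sqrt (real n)"
      using ev by eventually_elim (intro divide_right_mono, use bounds in auto)
    show "\<forall>\<^sub>F n in sequentially. real (i n) / sqrt (real n) \<le> (x * sqrt (real n) / 2 + 1) / sqrt (real n)"
      using ev by eventually_elim (intro divide_right_mono, use bounds in auto)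
    show "(\<lambda>n. (x * sqrt (real n) / 2 - 1 / 2) / sqrt (real n)) \<longlonglongrightarrow> x / 2" by real_asymp
    show "(\<lambda>n. (x * sqrt (real n) / 2 + 1) / sqrt (real n)) \<longlonglongrightarrow> x / 2" by real_asymp
  qed
  then have "(\<lambda>n. real (n choose (n div 2 - i n)) / real (n choose (n div 2))) \<longlonglongrightarrow> exp (- (2 * (x / 2)\<^sup>2))"
    by (rule binomial_local_limit)
  moreover have "- (2 * (x / 2)\<^sup>2) = - x\<^sup>2 / 2" by (simp add: power2_eq_square)
  moreover have "\<forall>\<^sub>F n in sequentially. real (n choose (n div 2 - i n)) / real (n choose (n div 2)) =
      measure (involution_pmf 1 n 3 \<sigma>) {\<pi>. x * sqrt (real n) < real (fp n \<pi>)}"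
    using ev
  proof eventually_elim
    case (elim n)
    have "{j. j \<le> n div 2 \<and> x * sqrt (real n) < real (n - 2 * j)} = {..<Suc (J n)}"
    proof (intro set_eqI iffI)
      fix j assume "j \<in> {j. j \<le> n div 2 \<and> x * sqrt (real n) < real (n - 2 * j)}"
      then have j: "2 * j \<le> n" "x * sqrt (real n) < real (n - 2 * j)" by auto
      then have "real (n - 2 * j) = real n - 2 * real j" by (simp add: of_nat_diff)
      then have "real j < real (J n) + 1" using j(2) elim by (simp add: field_simps)
      then show "j \<in> {..<Suc (J n)}" by simp
    next
      fix j assume "j \<in> {..<Suc (J n)}"
      then have j: "j \<le> J n" by simp
      then have "real j < (real n - x * sqrt (real n)) / 2" using elim of_nat_mono[OF j, where 'a = real] by linarith
      moreover have "j \<le> n div 2" using j elim by simp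
      moreover have "real (n - 2 * j) = real n - 2 * real j" using \<open>j \<le> n div 2\<close> by (simp add: of_nat_diff)
      ultimately show "j \<in> {j. j \<le> n div 2 \<and> x * sqrt (real n) < real (n - 2 * j)}" by (simp add: field_simps)
    qed
    then have "measure (involution_pmf 1 n 3 \<sigma>) {\<pi>. x * sqrt (real n) < real (fp n \<pi>)} =
        (\<Sum>j<Suc (J n). fp_count n j) / (\<Sum>j<Suc (n div 2). fp_count n j)"
      using prob_fp[OF \<sigma>, of 1 n "\<lambda>k. x * sqrt (real n) < real k"]
      by (simp add: fp_weight_def lessThan_Suc_atMost)
    moreover have "n div 2 - i n = J n" using elim unfolding i_def by simp
    ultimately show ?case unfolding sum_fp_count by simp
  qed
  ultimately show ?thesis by (simp add: tendsto_cong)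
qed

theorem critical_limit:
  assumes \<sigma>: "\<sigma> \<in> {one_line [3,2,1], one_line [1,3,2], one_line [2,1,3]}"
  shows "weak_conv_m (\<lambda>n. distr (involution_pmf 1 n 3 \<sigma>) borel (\<lambda>\<pi>. sqrt (1 / real n) * real (fp n \<pi>)))
    (density lborel (\<lambda>x. ennreal (rayleigh_density x)))"
  unfolding weak_conv_m_def weak_conv_def
proof (intro allI impI)
  fix x :: real
  let ?M = "\<lambda>n. involution_pmf 1 n 3 \<sigma>"
  have cdf: "cdf (distr (?M n) borel (\<lambda>\<pi>. sqrt (1 / real n) * real (fp n \<pi>))) x =
      measure (?M n) {\<pi>. sqrt (1 / real n) * real (fp n \<pi>) \<le> x}" for n
    unfolding cdf_def by (subst measure_distr) (auto simp: vimage_def)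
  have limit: "cdf (density lborel (\<lambda>x. ennreal (rayleigh_density x))) x = (if x < 0 then 0 else 1 - exp (- x\<^sup>2 / 2))"
    by (rule cdf_of_rayleigh_tail[OF real_distribution_rayleigh rayleigh_tail])
  show "(\<lambda>n. cdf (distr (?M n) borel (\<lambda>\<pi>. sqrt (1 / real n) * real (fp n \<pi>))) x) \<longlonglongrightarrow>
      cdf (density lborel (\<lambda>x. ennreal (rayleigh_density x))) x"
  proof (cases "x < 0")
    case True
    have "\<not> sqrt (1 / real n) * real (fp n \<pi>) \<le> x" for n \<pi>
    proof -
      have "0 \<le> sqrt (1 / real n) * real (fp n \<pi>)" by (intro mult_nonneg_nonneg) auto
      with True show ?thesis by linarith
    qed
    then show ?thesis unfolding cdf limit using True by simp
  next
    case False
    have "measure (?M n) {\<pi>. sqrt (1 / real n) * real (fp n \<pi>) \<le> x} =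
        1 - measure (?M n) {\<pi>. x * sqrt (real n) < real (fp n \<pi>)}" if "n > 0" for n
    proof -
      have "sqrt (1 / real n) * real (fp n \<pi>) \<le> x \<longleftrightarrow> \<not> x * sqrt (real n) < real (fp n \<pi>)" for \<pi>
        using that by (simp add: real_sqrt_divide pos_divide_le_eq not_less)
      then have "{\<pi>. sqrt (1 / real n) * real (fp n \<pi>) \<le> x} = UNIV - {\<pi>. x * sqrt (real n) < real (fp n \<pi>)}" by auto
      then show ?thesis
        using measure_pmf.prob_compl[of "{\<pi>. x * sqrt (real n) < real (fp n \<pi>)}" "?M n"] by simp
    qed
    then have "\<forall>\<^sub>F n in sequentially. 1 - measure (?M n) {\<pi>. x * sqrt (real n) < real (fp n \<pi>)} =
        measure (?M n) {\<pi>. sqrt (1 / real n) * real (fp n \<pi>) \<le> x}"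
      by (intro eventually_mono[OF eventually_gt_at_top[of 0]]) simp
    moreover have "(\<lambda>n. 1 - measure (?M n) {\<pi>. x * sqrt (real n) < real (fp n \<pi>)}) \<longlonglongrightarrow> 1 - exp (- x\<^sup>2 / 2)"
      using False by (intro tendsto_diff tendsto_const critical_tail_limit[OF \<sigma>]) simp
    ultimately show ?thesis unfolding cdf limit using False by (simp add: tendsto_cong)
  qed
qed

section \<open>The limit for q greater than 1\<close>

text \<open>
  Put \<open>i = n - j\<close>. Then \<open>q ^ (n - 2 * j) * (n choose j)\<close> is \<open>(q + 1 / q) ^ n\<close> times the probability
  of \<open>i\<close>, and \<open>q ^ (n - 2 * j) * (n choose (j - 1))\<close> is \<open>(q + 1 / q) ^ n / q\<^sup>2\<close> times that of
  \<open>i + 1\<close>. The second event is shifted accordingly. For \<open>j = 0\<close> the value \<open>i + 1 = n + 1\<close> has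
  probability \<open>0\<close>, in accordance with the missing second term.
\<close>

lemma sum_fp_weight_as_binomial:
  fixes q :: real
  assumes q: "q > 0"
  defines "P \<equiv> q\<^sup>2 / (q\<^sup>2 + 1)"
  shows "(\<Sum>j\<in>{j. j \<le> n div 2 \<and> Q (n - 2 * j)}. fp_weight q n j) =
    (q + 1 / q) ^ n * (measure (binomial_pmf n P) {i. n - n div 2 \<le> i \<and> Q (2 * i - n)} -
      measure (binomial_pmf n P) {i. n - n div 2 + 1 \<le> i \<and> Q (2 * (i - 1) - n)} / q\<^sup>2)"
proof -
  let ?J = "{j. j \<le> n div 2 \<and> Q (n - 2 * j)}" and ?b = "pmf (binomial_pmf n P)"
  define K where "K = (q + 1 / q) ^ n"
  have "q\<^sup>2 + 1 > 0" using q by (simp add: add_pos_pos)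
  then have P: "0 < P" "P < 1" "1 - P = 1 / (q\<^sup>2 + 1)" using q by (simp_all add: P_def field_simps)
  have b: "K * ?b i = real (n choose i) * (q\<^sup>2) ^ i / q ^ n" if "i \<le> n" for i
  proof -
    have "q + 1 / q = (q\<^sup>2 + 1) / q" using q by (simp add: field_simps power2_eq_square)
    then have K: "K = (q\<^sup>2 + 1) ^ n / q ^ n" by (simp add: K_def power_divide)
    have "P ^ i * (1 - P) ^ (n - i) = (q\<^sup>2) ^ i / (q\<^sup>2 + 1) ^ n"
      unfolding P(3) unfolding P_def using that by (simp add: power_divide power_add[symmetric])
    then have "?b i = real (n choose i) * ((q\<^sup>2) ^ i / (q\<^sup>2 + 1) ^ n)"
      using P by (simp add: mult.assoc)
    then show ?thesis unfolding K using \<open>q\<^sup>2 + 1 > 0\<close> by simp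
  qed
  have weight: "fp_weight q n j = K * (?b (n - j) - ?b (n - j + 1) / q\<^sup>2)" if "j \<le> n div 2" for j
  proof -
    have j: "2 * j \<le> n" using that by simp
    have pow: "(q\<^sup>2) ^ (n - j) / q ^ n = q ^ (n - 2 * j)"
    proof -
      have "2 * (n - j) = n + (n - 2 * j)" using j by simp
      then have "(q\<^sup>2) ^ (n - j) = q ^ (n + (n - 2 * j))" by (simp only: power_mult[symmetric])
      then show ?thesis using q by (simp add: power_add)
    qed
    have 1: "K * ?b (n - j) = real (n choose j) * q ^ (n - 2 * j)"
      using b[of "n - j"] binomial_symmetric[of j n] j pow by (simp add: mult.assoc flip: times_divide_eq_right)
    have 2: "K * ?b (n - j + 1) / q\<^sup>2 = (if j = 0 then 0 else real (n choose (j - 1)) * q ^ (n - 2 * j))"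
    proof (cases j)
      case 0
      then show ?thesis using P by simp
    next
      case (Suc i)
      have ni: "n - j + 1 = n - i" using Suc j by simp
      have "K * ?b (n - i) = real (n choose i) * ((q\<^sup>2) ^ (n - i) / q ^ n)"
        using b[of "n - i"] binomial_symmetric[of i n] Suc j by simp
      also have "(q\<^sup>2) ^ (n - i) = q\<^sup>2 * (q\<^sup>2) ^ (n - j)" unfolding ni[symmetric] by simp
      finally have "K * ?b (n - i) / q\<^sup>2 = real (n choose i) * ((q\<^sup>2) ^ (n - j) / q ^ n)" using q by simp
      then show ?thesis unfolding ni pow using Suc by simp
    qed
    have "K * (?b (n - j) - ?b (n - j + 1) / q\<^sup>2) = K * ?b (n - j) - K * ?b (n - j + 1) / q\<^sup>2"
      by (simp add: right_diff_distrib)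
    also have "\<dots> = fp_weight q n j" unfolding 1 2 fp_weight_def fp_count_def by (simp add: left_diff_distrib)
    finally show ?thesis by simp
  qed
  have set: "set_pmf (binomial_pmf n P) = {..n}" using P by simp
  have m1: "(\<Sum>j\<in>?J. ?b (n - j)) = measure (binomial_pmf n P) {i. n - n div 2 \<le> i \<and> Q (2 * i - n)}"
  proof -
    have "(\<Sum>j\<in>?J. ?b (n - j)) = (\<Sum>i\<in>{i. n - n div 2 \<le> i \<and> Q (2 * i - n)} \<inter> {..n}. ?b i)"
    proof (rule sum.reindex_bij_witness[where i = "\<lambda>i. n - i" and j = "\<lambda>j. n - j"])
      fix i assume "i \<in> {i. n - n div 2 \<le> i \<and> Q (2 * i - n)} \<inter> {..n}"
      then have i: "n - n div 2 \<le> i" "i \<le> n" "Q (2 * i - n)" by auto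
      then have "n - 2 * (n - i) = 2 * i - n" by simp
      then show "n - i \<in> ?J" using i by simp
    next
      fix j assume j: "j \<in> ?J"
      then have "2 * (n - j) - n = n - 2 * j" "n - n div 2 \<le> n - j" by (auto intro: diff_le_mono2)
      then show "n - j \<in> {i. n - n div 2 \<le> i \<and> Q (2 * i - n)} \<inter> {..n}" using j by simp
    qed auto
    also have "\<dots> = measure (binomial_pmf n P) ({i. n - n div 2 \<le> i \<and> Q (2 * i - n)} \<inter> {..n})"
      by (rule measure_measure_pmf_finite[symmetric]) simp
    also have "\<dots> = measure (binomial_pmf n P) {i. n - n div 2 \<le> i \<and> Q (2 * i - n)}"
      unfolding set[symmetric] by (rule measure_Int_set_pmf)
    finally show ?thesis .
  qed
  have m2: "(\<Sum>j\<in>?J. ?b (n - j + 1)) = measure (binomial_pmf n P) {i. n - n div 2 + 1 \<le> i \<and> Q (2 * (i - 1) - n)}"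
  proof -
    let ?S = "{i. n - n div 2 + 1 \<le> i \<and> Q (2 * (i - 1) - n)}"
    have "(\<Sum>j\<in>?J. ?b (n - j + 1)) = (\<Sum>i\<in>?S \<inter> {..Suc n}. ?b i)"
    proof (rule sum.reindex_bij_witness[where i = "\<lambda>i. n + 1 - i" and j = "\<lambda>j. n - j + 1"])
      fix i assume "i \<in> ?S \<inter> {..Suc n}"
      then have i: "n - n div 2 + 1 \<le> i" "i \<le> Suc n" "Q (2 * (i - 1) - n)" by auto
      then have "n - 2 * (n + 1 - i) = 2 * (i - 1) - n" by simp
      then show "n + 1 - i \<in> ?J" using i by simp
      show "n - (n + 1 - i) + 1 = i" using i by simp
    next
      fix j assume j: "j \<in> ?J"
      then have "2 * (n - j + 1 - 1) - n = n - 2 * j" "n - n div 2 \<le> n - j" by (auto intro: diff_le_mono2)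
      then show "n - j + 1 \<in> ?S \<inter> {..Suc n}" using j by simp
    qed auto
    also have "\<dots> = measure (binomial_pmf n P) (?S \<inter> {..Suc n})"
      by (rule measure_measure_pmf_finite[symmetric]) simp
    also have "\<dots> = measure (binomial_pmf n P) (?S \<inter> {..Suc n} \<inter> set_pmf (binomial_pmf n P))"
      by (rule measure_Int_set_pmf[symmetric])
    also have "?S \<inter> {..Suc n} \<inter> set_pmf (binomial_pmf n P) = ?S \<inter> set_pmf (binomial_pmf n P)" unfolding set by auto
    also have "measure (binomial_pmf n P) (?S \<inter> set_pmf (binomial_pmf n P)) = measure (binomial_pmf n P) ?S"
      by (rule measure_Int_set_pmf)
    finally show ?thesis .
  qed
  have "(\<Sum>j\<in>?J. fp_weight q n j) = (\<Sum>j\<in>?J. K * (?b (n - j) - ?b (n - j + 1) / q\<^sup>2))"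
    by (intro sum.cong) (auto simp: weight)
  also have "\<dots> = K * ((\<Sum>j\<in>?J. ?b (n - j)) - (\<Sum>j\<in>?J. ?b (n - j + 1)) / q\<^sup>2)"
    by (simp only: sum_distrib_left[symmetric] sum_subtractf sum_divide_distrib[symmetric])
  finally show ?thesis unfolding m1 m2 K_def .
qed

text \<open>
  The fraction of two-cycles is close to \<open>1 - P < 1 / 2\<close>, so the condition \<open>j \<le> n div 2\<close> is no constraint
  in the limit. In numerator and denominator alike the second binomial probability is \<open>1 / q\<^sup>2\<close> times
  a quantity with the same limit as the first, and the factor \<open>1 - 1 / q\<^sup>2\<close> cancels.
\<close>

theorem supercritical_limit:
  fixes q :: real
  assumes \<sigma>: "\<sigma> \<in> {one_line [3,2,1], one_line [1,3,2], one_line [2,1,3]}" and q: "q > 1"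
  shows "weak_conv_m
         (\<lambda>n. distr (involution_pmf q n 3 \<sigma>) borel
           (\<lambda>\<pi>. (real (fp n \<pi>) - (q\<^sup>2 - 1) / (q\<^sup>2 + 1) * real n) /
                 (2 * q / (q\<^sup>2 + 1) * sqrt (real n))))
         std_normal_distribution"
  unfolding weak_conv_m_def weak_conv_def
proof (intro allI impI)
  fix x :: real
  define P where "P = q\<^sup>2 / (q\<^sup>2 + 1)"
  define s where "s = q / (q\<^sup>2 + 1)"
  have q0: "q > 0" "q\<^sup>2 + 1 > 0" "q\<^sup>2 > 1" using q by (simp_all add: add_pos_pos power2_eq_square less_1_mult)
  have P: "1 / 2 < P" "0 < P" "P < 1" "1 - P = 1 / (q\<^sup>2 + 1)" using q0 by (simp_all add: P_def field_simps)
  have s: "s > 0" using q0 by (simp add: s_def)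
  have "P * (1 - P) = s\<^sup>2" unfolding P(4) unfolding P_def s_def by (simp add: power_divide power2_eq_square)
  then have sd: "sqrt (real n * (P * (1 - P))) = s * sqrt (real n)" for n
    using s by (simp add: real_sqrt_mult mult.commute)
  have mean: "(q\<^sup>2 - 1) / (q\<^sup>2 + 1) = 2 * P - 1" using q0 by (simp add: P_def field_simps)
  have scale: "2 * q / (q\<^sup>2 + 1) = 2 * s" by (simp add: s_def)
  let ?M = "\<lambda>n. involution_pmf q n 3 \<sigma>" and ?B = "\<lambda>n. binomial_pmf n P"
  define y where "y n = (2 * P - 1) * real n + x * (2 * s * sqrt (real n))" for n
  define l where "l n = real (n - n div 2)" for n
  define c where "c n = (real n + y n) / 2" for n
  have l_le: "l n \<le> real n / 2 + 1 / 2" for n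
  proof -
    have "2 * (n - n div 2) \<le> n + 1" by presburger
    then have "real (2 * (n - n div 2)) \<le> real (n + 1)" by (simp only: of_nat_le_iff)
    then show ?thesis unfolding l_def by simp
  qed
  have l_lim: "filterlim (\<lambda>n. (l n + d - real n * P) / sqrt (real n * (P * (1 - P)))) at_bot sequentially" for d
  proof (rule filterlim_at_bot_mono)
    have a: "(P - 1 / 2) / s > 0" using P s by simp
    have "filterlim (\<lambda>n. - ((P - 1 / 2) / s) * sqrt (real n) + (\<bar>d\<bar> + 1 / 2) / s * (1 / sqrt (real n))) at_bot sequentially"
      using a by real_asymp
    then show "filterlim (\<lambda>n. (real n / 2 + 1 / 2 + \<bar>d\<bar> - real n * P) / (s * sqrt (real n))) at_bot sequentially"
    proof (rule filterlim_cong[OF refl refl, THEN iffD1, rotated])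
      show "\<forall>\<^sub>F n in sequentially. - ((P - 1 / 2) / s) * sqrt (real n) + (\<bar>d\<bar> + 1 / 2) / s * (1 / sqrt (real n)) =
          (real n / 2 + 1 / 2 + \<bar>d\<bar> - real n * P) / (s * sqrt (real n))"
        using eventually_gt_at_top[of 0]
      proof eventually_elim
        case (elim n)
        define r where "r = sqrt (real n)"
        have r: "r > 0" "real n = r * r" using elim by (simp_all add: r_def)
        show ?case unfolding r_def[symmetric] r(2) using r(1) s by (simp add: field_simps)
      qed
    qed
    show "\<forall>\<^sub>F n in sequentially. (l n + d - real n * P) / sqrt (real n * (P * (1 - P))) \<le>
        (real n / 2 + 1 / 2 + \<bar>d\<bar> - real n * P) / (s * sqrt (real n))"
    proof (intro always_eventually allI)
      fix n
      have "l n + d - real n * P \<le> real n / 2 + 1 / 2 + \<bar>d\<bar> - real n * P" using l_le[of n] by linarith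
      then show "(l n + d - real n * P) / sqrt (real n * (P * (1 - P))) \<le>
        (real n / 2 + 1 / 2 + \<bar>d\<bar> - real n * P) / (s * sqrt (real n))"
        unfolding sd using s by (intro divide_right_mono) auto
    qed
  qed
  have c_lim: "(\<lambda>n. (c n + d - real n * P) / sqrt (real n * (P * (1 - P)))) \<longlonglongrightarrow> x" for d
  proof -
    have "(\<lambda>n. x + d / s * (1 / sqrt (real n))) \<longlonglongrightarrow> x" by real_asymp
    moreover have "\<forall>\<^sub>F n in sequentially. x + d / s * (1 / sqrt (real n)) = (c n + d - real n * P) / sqrt (real n * (P * (1 - P)))"
      using eventually_gt_at_top[of 0]
    proof eventually_elim
      case (elim n)
      have eq: "c n + d - real n * P = x * (s * sqrt (real n)) + d" unfolding c_def y_def by (simp add: field_simps)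
      show ?case unfolding sd eq using s elim by (simp add: add_divide_distrib)
    qed
    ultimately show ?thesis by (simp add: tendsto_cong)
  qed
  let ?K = "\<lambda>n. (q + 1 / q) ^ n"
  let ?num = "\<lambda>n. measure (?B n) {i. l n + 0 \<le> real i \<and> real i \<le> c n + 0} - measure (?B n) {i. l n + 1 \<le> real i \<and> real i \<le> c n + 1} / q\<^sup>2"
  let ?den = "\<lambda>n. measure (?B n) {i. l n + 0 \<le> real i} - measure (?B n) {i. l n + 1 \<le> real i} / q\<^sup>2"
  let ?\<Phi> = "cdf std_normal_distribution x"
  have num: "?num \<longlonglongrightarrow> ?\<Phi> - ?\<Phi> / q\<^sup>2"
    using q0 by (intro tendsto_diff tendsto_divide tendsto_const binomial_interval_limit(1)[OF P(2,3) l_lim c_lim]) auto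
  have den: "?den \<longlonglongrightarrow> 1 - 1 / q\<^sup>2"
    using q0 by (intro tendsto_diff tendsto_divide tendsto_const binomial_interval_limit(2)[OF P(2,3) l_lim]) auto
  have pos: "1 - 1 / q\<^sup>2 > 0" using q0 by simp
  have "?\<Phi> - ?\<Phi> / q\<^sup>2 = ?\<Phi> * (1 - 1 / q\<^sup>2)" by (simp add: right_diff_distrib)
  then have "(?\<Phi> - ?\<Phi> / q\<^sup>2) / (1 - 1 / q\<^sup>2) = ?\<Phi>" using pos by (metis nonzero_mult_div_cancel_right order_less_irrefl)
  moreover have "(\<lambda>n. ?num n / ?den n) \<longlonglongrightarrow> (?\<Phi> - ?\<Phi> / q\<^sup>2) / (1 - 1 / q\<^sup>2)"
    by (rule tendsto_divide[OF num den]) (rule less_imp_neq[OF pos, symmetric])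
  ultimately have ratio: "(\<lambda>n. ?num n / ?den n) \<longlonglongrightarrow> ?\<Phi>" by (simp only:)
  have "\<forall>\<^sub>F n in sequentially. ?num n / ?den n =
      cdf (distr (?M n) borel (\<lambda>\<pi>. (real (fp n \<pi>) - (q\<^sup>2 - 1) / (q\<^sup>2 + 1) * real n) / (2 * q / (q\<^sup>2 + 1) * sqrt (real n)))) x"
    using eventually_gt_at_top[of 0]
  proof eventually_elim
    case (elim n)
    have "(real (fp n \<pi>) - (2 * P - 1) * real n) / (2 * s * sqrt (real n)) \<le> x \<longleftrightarrow> real (fp n \<pi>) \<le> y n" for \<pi>
      unfolding y_def using elim s by (subst pos_divide_le_eq) auto
    then have "cdf (distr (?M n) borel (\<lambda>\<pi>. (real (fp n \<pi>) - (q\<^sup>2 - 1) / (q\<^sup>2 + 1) * real n) / (2 * q / (q\<^sup>2 + 1) * sqrt (real n)))) x =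
        measure (?M n) {\<pi>. real (fp n \<pi>) \<le> y n}"
      unfolding mean scale cdf_def by (subst measure_distr) (auto simp: vimage_def)
    also have "\<dots> = (\<Sum>j\<in>{j. j \<le> n div 2 \<and> real (n - 2 * j) \<le> y n}. fp_weight q n j) / (\<Sum>j\<in>{j. j \<le> n div 2 \<and> True}. fp_weight q n j)"
      using prob_fp[OF \<sigma> q0(1), of n "\<lambda>k. real k \<le> y n"] by (simp add: atMost_def)
    also have "(\<Sum>j\<in>{j. j \<le> n div 2 \<and> True}. fp_weight q n j) = ?K n * ?den n"
    proof -
      have "{i. n - n div 2 \<le> i \<and> True} = {i. l n + 0 \<le> real i}" "{i. n - n div 2 + 1 \<le> i \<and> True} = {i. l n + 1 \<le> real i}"
        unfolding l_def by (auto simp flip: of_nat_Suc simp: add.commute)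
      then show ?thesis using sum_fp_weight_as_binomial[OF q0(1), of n "\<lambda>_. True"] by (simp only: P_def)
    qed
    also have "(\<Sum>j\<in>{j. j \<le> n div 2 \<and> real (n - 2 * j) \<le> y n}. fp_weight q n j) = ?K n * ?num n"
    proof -
      have conv: "real (2 * i - n) \<le> y n \<longleftrightarrow> real i \<le> c n" if "n - n div 2 \<le> i" for i
      proof -
        have "n \<le> 2 * i" using that by presburger
        then have "real (2 * i - n) = 2 * real i - real n" by (simp add: of_nat_diff)
        then show ?thesis unfolding c_def by auto
      qed
      have "{i. n - n div 2 \<le> i \<and> real (2 * i - n) \<le> y n} = {i. l n + 0 \<le> real i \<and> real i \<le> c n + 0}"
        unfolding l_def using conv by auto
      moreover have "{i. n - n div 2 + 1 \<le> i \<and> real (2 * (i - 1) - n) \<le> y n} = {i. l n + 1 \<le> real i \<and> real i \<le> c n + 1}"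
      proof (intro set_eqI)
        fix i
        show "i \<in> {i. n - n div 2 + 1 \<le> i \<and> real (2 * (i - 1) - n) \<le> y n} \<longleftrightarrow> i \<in> {i. l n + 1 \<le> real i \<and> real i \<le> c n + 1}"
          using conv[of "i - 1"] unfolding l_def by (cases i) auto
      qed
      ultimately show ?thesis using sum_fp_weight_as_binomial[OF q0(1), of n "\<lambda>k. real k \<le> y n"] by (simp only: P_def)
    qed
    also have "?K n * ?num n / (?K n * ?den n) = ?num n / ?den n"
    proof -
      have "?K n \<noteq> 0" using q0 by (simp add: add_pos_pos less_imp_neq[symmetric])
      then show ?thesis by (rule mult_divide_mult_cancel_left)
    qed
    finally show ?case by simp
  qed
  with ratio show "(\<lambda>n. cdf (distr (?M n) borel (\<lambda>\<pi>. (real (fp n \<pi>) - (q\<^sup>2 - 1) / (q\<^sup>2 + 1) * real n) / (2 * q / (q\<^sup>2 + 1) * sqrt (real n)))) x)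
      \<longlonglongrightarrow> ?\<Phi>"
    by (simp add: tendsto_cong)
qed

theorem theorem3:
  fixes q :: real and \<sigma> :: "nat \<Rightarrow> nat"
  assumes "\<sigma> \<in> {one_line [3,2,1], one_line [1,3,2], one_line [2,1,3]}"
    and "q > 0"
  shows
    "(q < 1 \<longrightarrow>
       weak_conv_m
         (\<lambda>n. distr (involution_pmf q (2 * n) 3 \<sigma>) borel (\<lambda>\<pi>. real (fp (2 * n) \<pi>)))
         (distr (cond_pmf (neg_binomial_pmf 2 (1 - q)) {j. even j}) borel real) \<and>
       weak_conv_m
         (\<lambda>n. distr (involution_pmf q (2 * n + 1) 3 \<sigma>) borel (\<lambda>\<pi>. real (fp (2 * n + 1) \<pi>)))
         (distr (cond_pmf (neg_binomial_pmf 2 (1 - q)) {j. odd j}) borel real)) \<and>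
     (q = 1 \<longrightarrow>
       weak_conv_m
         (\<lambda>n. distr (involution_pmf q n 3 \<sigma>) borel (\<lambda>\<pi>. sqrt (1 / real n) * real (fp n \<pi>)))
         (distr traceless_GOE2 borel (\<lambda>A. 1 / sqrt 2 * eigenvalue_gap A)) \<and>
       distr traceless_GOE2 borel (\<lambda>A. eigenvalue_gap A / sqrt 2) =
         density lborel (\<lambda>x. ennreal (rayleigh_density x))) \<and>
     (q > 1 \<longrightarrow>
       weak_conv_m
         (\<lambda>n. distr (involution_pmf q n 3 \<sigma>) borel
           (\<lambda>\<pi>. (real (fp n \<pi>) - (q\<^sup>2 - 1) / (q\<^sup>2 + 1) * real n) /
                 (2 * q / (q\<^sup>2 + 1) * sqrt (real n))))
         std_normal_distribution)"
proof (intro conjI impI)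
  assume q: "q < 1"
  show "weak_conv_m
         (\<lambda>n. distr (involution_pmf q (2 * n) 3 \<sigma>) borel (\<lambda>\<pi>. real (fp (2 * n) \<pi>)))
         (distr (cond_pmf (neg_binomial_pmf 2 (1 - q)) {j. even j}) borel real)"
    using subcritical_limit[OF assms q, of 0] by (simp add: even_iff_mod_2_eq_zero)
  show "weak_conv_m
         (\<lambda>n. distr (involution_pmf q (2 * n + 1) 3 \<sigma>) borel (\<lambda>\<pi>. real (fp (2 * n + 1) \<pi>)))
         (distr (cond_pmf (neg_binomial_pmf 2 (1 - q)) {j. odd j}) borel real)"
    using subcritical_limit[OF assms q, of 1] by (simp add: odd_iff_mod_2_eq_one)
next
  assume q: "q = 1"
  have "(\<lambda>A. 1 / sqrt 2 * eigenvalue_gap A) = (\<lambda>A. eigenvalue_gap A / sqrt 2)" by auto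
  then show "weak_conv_m
         (\<lambda>n. distr (involution_pmf q n 3 \<sigma>) borel (\<lambda>\<pi>. sqrt (1 / real n) * real (fp n \<pi>)))
         (distr traceless_GOE2 borel (\<lambda>A. 1 / sqrt 2 * eigenvalue_gap A))"
    using critical_limit[OF assms(1)] by (simp only: q distr_GOE2_gap_eq_rayleigh)
  show "distr traceless_GOE2 borel (\<lambda>A. eigenvalue_gap A / sqrt 2) =
         density lborel (\<lambda>x. ennreal (rayleigh_density x))"
    by (rule distr_GOE2_gap_eq_rayleigh)
next
  assume "q > 1"
  then show "weak_conv_m
         (\<lambda>n. distr (involution_pmf q n 3 \<sigma>) borel
           (\<lambda>\<pi>. (real (fp n \<pi>) - (q\<^sup>2 - 1) / (q\<^sup>2 + 1) * real n) /
                 (2 * q / (q\<^sup>2 + 1) * sqrt (real n))))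
         std_normal_distribution"
    by (rule supercritical_limit[OF assms(1)])
qed

end
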